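(* Let $G$ be a compact abelian group with normalized Haar measure $\mu$ and Pontryagin dual $\hat G$. For all $2\le p<\infty$ and $A_\theta\in L^q(G;\mathcal C_p)$, $$\sum_{k\in\hat G}\Big\|\int_G\overline{k(\theta)}A_\theta\,d\mu(\theta)\Big\|_p^p\le\Big(\int_G\|A_\theta\|_p^q\,d\mu(\theta)\Big)^{p/q},$$ where $q$ is conjugate to $p$, i.e. $q=p/(p-1)$.
   Context: $H$ is a separable complex Hilbert space. For $1\le p<\infty$, $\|A\|_p=(\operatorname{tr}|A|^p)^{1/p}$ with $|A|=(A^*A)^{1/2}$, and $\mathcal C_p$ is the Schatten class of operators on $H$ with $\|A\|_p<\infty$. The Haar measure $\mu$ of $G$ is normalized by $\mu(G)=1$. $\hat G$ is the (discrete) group of continuous homomorphisms $k:G\to\{z\in\mathbb C:|z|=1\}$. $L^q(G;\mathcal C_p)$ is the Bochner space of strongly measurable $\theta\mapsto A_\theta\in\mathcal C_p$ with $\int_G\|A_\theta\|_p^q\,d\mu(\theta)<\infty$; integrals of operator-valued functions are Bochner integrals. Sums over $\hat G$ are unordered sums. *)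

theory Defs
  imports "HOL-Analysis.Analysis"
begin

section \<open>Separable complex Hilbert spaces\<close>

text \<open>The distribution has no complex inner product spaces. The underlying real Hilbert space
  (with inner product the real part of the complex one) is inherited from the class
  \<^class>\<open>real_inner\<close>; positive definiteness and the norm come from there. The complex inner
  product is linear in its second argument. For metric spaces, separability is
  \<^class>\<open>second_countable_topology\<close>.\<close>

class complex_hilbert_space = real_inner + complete_space + second_countable_topology +
  fixes scaleC :: "complex \<Rightarrow> 'a \<Rightarrow> 'a" (infixr "*\<^sub>C" 75)
    and cinner :: "'a \<Rightarrow> 'a \<Rightarrow> complex"
  assumes scaleC_add_right: "a *\<^sub>C (x + y) = a *\<^sub>C x + a *\<^sub>C y"
    and scaleC_add_left: "(a + b) *\<^sub>C x = a *\<^sub>C x + b *\<^sub>C x"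
    and scaleC_scaleC: "a *\<^sub>C b *\<^sub>C x = (a * b) *\<^sub>C x"
    and scaleR_eq_scaleC: "r *\<^sub>R x = complex_of_real r *\<^sub>C x"
    and cinner_commute: "cinner x y = cnj (cinner y x)"
    and cinner_add_right: "cinner x (y + z) = cinner x y + cinner x z"
    and cinner_scaleC_right: "cinner x (a *\<^sub>C y) = a * cinner x y"
    and inner_eq_Re_cinner: "inner x y = Re (cinner x y)"

lemma norm_scaleC: "norm (a *\<^sub>C x) = cmod a * norm (x :: 'a::complex_hilbert_space)"
proof -
  have "cinner (a *\<^sub>C x) (a *\<^sub>C x) = (a * cnj a) * cinner x x"
    by (metis cinner_commute cinner_scaleC_right complex_cnj_mult mult.assoc)
  also have "\<dots> = complex_of_real ((cmod a)\<^sup>2) * cinner x x"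
    by (simp only: complex_norm_square)
  finally have "inner (a *\<^sub>C x) (a *\<^sub>C x) = (cmod a)\<^sup>2 * inner x x"
    by (simp add: inner_eq_Re_cinner)
  then show ?thesis
    by (simp add: norm_eq_sqrt_inner real_sqrt_mult)
qed

lemma bounded_linear_scaleC: "bounded_linear (\<lambda>x :: 'a::complex_hilbert_space. a *\<^sub>C x)"
  by (rule bounded_linear_intro[where K = "cmod a"])
    (simp_all add: scaleC_add_right scaleR_eq_scaleC scaleC_scaleC norm_scaleC mult.commute)

text \<open>A maximal orthonormal set.\<close>

definition is_onb :: "'h::complex_hilbert_space set \<Rightarrow> bool" where
  "is_onb B \<longleftrightarrow>
     (\<forall>e\<in>B. \<forall>f\<in>B. cinner e f = (if e = f then 1 else 0)) \<and>
     (\<forall>x. (\<forall>e\<in>B. cinner e x = 0) \<longrightarrow> x = 0)"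

section \<open>Bounded operators\<close>

text \<open>Elements of \<^typ>\<open>'h \<Rightarrow>\<^sub>L 'h\<close> are only real-linear; complex linearity is imposed separately.\<close>

definition clinear_op :: "('h::complex_hilbert_space \<Rightarrow>\<^sub>L 'h) \<Rightarrow> bool" where
  "clinear_op T \<longleftrightarrow> (\<forall>c x. blinfun_apply T (c *\<^sub>C x) = c *\<^sub>C blinfun_apply T x)"

lift_definition scaleC_op :: "complex \<Rightarrow> ('h::complex_hilbert_space \<Rightarrow>\<^sub>L 'h) \<Rightarrow> ('h \<Rightarrow>\<^sub>L 'h)"
  is "\<lambda>c T x. c *\<^sub>C T x"
  by (rule bounded_linear_compose[OF bounded_linear_scaleC])

definition adjoint_op :: "('h::complex_hilbert_space \<Rightarrow>\<^sub>L 'h) \<Rightarrow> ('h \<Rightarrow>\<^sub>L 'h)" where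
  "adjoint_op T =
     (THE S. \<forall>x y. cinner (blinfun_apply T x) y = cinner x (blinfun_apply S y))"

definition poly_op :: "real poly \<Rightarrow> ('h::complex_hilbert_space \<Rightarrow>\<^sub>L 'h) \<Rightarrow> ('h \<Rightarrow>\<^sub>L 'h)" where
  "poly_op P T = (\<Sum>i\<le>degree P. coeff P i *\<^sub>R ((\<lambda>S. T o\<^sub>L S) ^^ i) id_blinfun)"

text \<open>Continuous functional calculus of a positive operator \<open>T\<close>, whose spectrum lies in
  \<open>[0, \<parallel>T\<parallel>]\<close>: \<open>f(T)\<close> is the operator-norm limit of \<open>P\<^sub>n(T)\<close> for polynomials \<open>P\<^sub>n\<close> converging to
  \<open>f\<close> uniformly on \<open>[0, \<parallel>T\<parallel>]\<close>. For positive \<open>T\<close> and continuous \<open>f\<close> such \<open>P\<^sub>n\<close> exist and the limit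
  does not depend on their choice.\<close>

definition cfc_pos :: "(real \<Rightarrow> real) \<Rightarrow> ('h::complex_hilbert_space \<Rightarrow>\<^sub>L 'h) \<Rightarrow> ('h \<Rightarrow>\<^sub>L 'h)" where
  "cfc_pos f T =
     (THE S. \<forall>P. uniform_limit {0..norm T} (\<lambda>n x. poly (P n) x) f sequentially
        \<longrightarrow> (\<lambda>n. poly_op (P n) T) \<longlonglongrightarrow> S)"

text \<open>\<open>T\<^sup>s\<close> for a positive operator \<open>T\<close> and \<open>s > 0\<close>; note \<^prop>\<open>0 powr s = (0::real)\<close>.\<close>

definition powr_op :: "('h::complex_hilbert_space \<Rightarrow>\<^sub>L 'h) \<Rightarrow> real \<Rightarrow> ('h \<Rightarrow>\<^sub>L 'h)" where
  "powr_op T s = cfc_pos (\<lambda>x. x powr s) T"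

definition abs_op :: "('h::complex_hilbert_space \<Rightarrow>\<^sub>L 'h) \<Rightarrow> ('h \<Rightarrow>\<^sub>L 'h)" where
  "abs_op T = powr_op (adjoint_op T o\<^sub>L T) (1/2)"

text \<open>The trace, in \<open>[0, \<infinity>]\<close>, of a positive operator, for which it does not depend on the
  orthonormal basis; meaningless for operators that are not positive.\<close>

definition trace_pos :: "('h::complex_hilbert_space \<Rightarrow>\<^sub>L 'h) \<Rightarrow> ennreal" where
  "trace_pos T =
     (\<Sum>\<^sub>\<infinity>e\<in>(SOME B. is_onb B). ennreal (Re (cinner e (blinfun_apply T e))))"

section \<open>Schatten classes\<close>

definition schatten_class :: "real \<Rightarrow> ('h::complex_hilbert_space \<Rightarrow>\<^sub>L 'h) set" where
  "schatten_class p = {T. clinear_op T \<and> trace_pos (powr_op (abs_op T) p) < \<infinity>}"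

text \<open>Real-valued, hence only meaningful on \<^term>\<open>schatten_class p\<close>.\<close>

definition schatten_norm :: "real \<Rightarrow> ('h::complex_hilbert_space \<Rightarrow>\<^sub>L 'h) \<Rightarrow> real" where
  "schatten_norm p T = enn2real (trace_pos (powr_op (abs_op T) p)) powr (1/p)"

section \<open>Bochner integration in Schatten classes\<close>

text \<open>The Bochner integral of the library integrates with respect to the norm of a type, which for
  \<^typ>\<open>'h \<Rightarrow>\<^sub>L 'h\<close> is the operator norm. The following follows its construction with the
  \<open>p\<close>-norm in place of the norm. Strong measurability allows an exceptional null set, so that
  \<open>\<theta> \<mapsto> \<parallel>F \<theta>\<parallel>\<^sub>p\<close> need only be almost everywhere equal to a measurable function; for such functions
  \<^const>\<open>nn_integral\<close> is still the usual integral.\<close>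

definition schatten_strongly_measurable ::
    "real \<Rightarrow> 'a measure \<Rightarrow> ('a \<Rightarrow> ('h::complex_hilbert_space \<Rightarrow>\<^sub>L 'h)) \<Rightarrow> bool" where
  "schatten_strongly_measurable p M F \<longleftrightarrow>
     (\<forall>x\<in>space M. F x \<in> schatten_class p) \<and>
     (\<exists>s. (\<forall>n. simple_function M (s n) \<and> (\<forall>x\<in>space M. s n x \<in> schatten_class p)) \<and>
          (AE x in M. (\<lambda>n. schatten_norm p (s n x - F x)) \<longlonglongrightarrow> 0))"

definition schatten_has_integral ::
    "real \<Rightarrow> 'a measure \<Rightarrow> ('a \<Rightarrow> ('h::complex_hilbert_space \<Rightarrow>\<^sub>L 'h)) \<Rightarrow> ('h \<Rightarrow>\<^sub>L 'h) \<Rightarrow> bool" where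
  "schatten_has_integral p M F I \<longleftrightarrow>
     schatten_strongly_measurable p M F \<and> I \<in> schatten_class p \<and>
     (\<exists>s. (\<forall>n. Bochner_Integration.simple_bochner_integrable M (s n) \<and> (\<forall>x\<in>space M. s n x \<in> schatten_class p)) \<and>
          (\<lambda>n. \<integral>\<^sup>+x. ennreal (schatten_norm p (F x - s n x)) \<partial>M) \<longlonglongrightarrow> 0 \<and>
          (\<lambda>n. schatten_norm p (Bochner_Integration.simple_bochner_integral M (s n) - I)) \<longlonglongrightarrow> 0)"

definition schatten_integral ::
    "real \<Rightarrow> 'a measure \<Rightarrow> ('a \<Rightarrow> ('h::complex_hilbert_space \<Rightarrow>\<^sub>L 'h)) \<Rightarrow> ('h \<Rightarrow>\<^sub>L 'h)" where
  "schatten_integral p M F = (THE I. schatten_has_integral p M F I)"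

text \<open>\<open>L\<^sup>q(M; C\<^sub>p)\<close>, as a set of functions rather than of equivalence classes.\<close>

definition schatten_Lq ::
    "real \<Rightarrow> 'a measure \<Rightarrow> real \<Rightarrow> ('a \<Rightarrow> ('h::complex_hilbert_space \<Rightarrow>\<^sub>L 'h)) set" where
  "schatten_Lq q M p =
     {F. schatten_strongly_measurable p M F \<and>
         (\<integral>\<^sup>+x. ennreal (schatten_norm p (F x) powr q) \<partial>M) < \<infinity>}"

section \<open>Compact abelian groups\<close>

text \<open>On a compact group that is not second countable, uniqueness of Haar measure on the Borel sets
  requires regularity. For a finite measure on a compact Hausdorff space, inner regularity implies
  outer regularity.\<close>

definition normalized_haar_measure :: "'g::topological_ab_group_add measure \<Rightarrow> bool" where
  "normalized_haar_measure \<mu> \<longleftrightarrow>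
     sets \<mu> = sets borel \<and>
     emeasure \<mu> UNIV = 1 \<and>
     (\<forall>g. \<forall>B\<in>sets borel. emeasure \<mu> ((+) g ` B) = emeasure \<mu> B) \<and>
     (\<forall>B\<in>sets borel. emeasure \<mu> B = (SUP K\<in>{K. compact K \<and> K \<subseteq> B}. emeasure \<mu> K))"

definition pontryagin_dual :: "('g::topological_ab_group_add \<Rightarrow> complex) set" where
  "pontryagin_dual =
     {k. continuous_on UNIV k \<and> (\<forall>x y. k (x + y) = k x * k y) \<and> (\<forall>x. cmod (k x) = 1)}"

end

theory Submission
  imports Defs "HOL-Computational_Algebra.Fundamental_Theorem_Algebra"
    "HOL-Complex_Analysis.Conformal_Mappings"
begin

text \<open>The inequality interpolates between two simple endpoints. For \<open>p = 2\<close> it is Bessel's inequality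
  for the orthonormal system of characters, applied to every matrix element of \<open>A\<close>; for \<open>p = \<infinity>\<close> it says
  that the operator norm of a Fourier coefficient is at most \<open>\<integral> norm (A \<theta>)\<close>. The work lies in making
  both the Schatten norms and the interpolation concrete.

  For \<open>p \<ge> 2\<close> the \<open>p\<close>-th power of the Schatten norm is \<open>tr |T|\<^sup>p = sup (\<Sum>e\<in>F. norm (T e) powr p)\<close>,
  where \<open>F\<close> ranges over the finite orthonormal systems (\<open>trace_powr_abs_eq_sup\<close>). That the supremum is at most the trace is
  Jensen's inequality for \<open>|T|\<^sup>2\<close> in the state given by \<open>e\<close>; this uses the functional calculus, which
  rests on the fact that a polynomial that is nonnegative on \<open>[0, norm H]\<close> is positive at a positive
  operator \<open>H\<close> (\<open>psd_poly_op\<close>). Conversely, if the supremum is finite, then \<open>T\<^sup>* T\<close> has an orthonormal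
  basis of eigenvectors (\<open>eigenbasis_exists\<close>), whose finite parts exhaust the trace. The description by
  finite orthonormal systems makes the triangle inequality, completeness and the bound for the operator
  norm elementary, so that the Bochner integrals exist. It also reduces the theorem to finitely many
  matrix elements: with finite orthonormal systems \<open>F k\<close> and vectors \<open>f k e\<close> of norm at most \<open>1\<close>, one
  has to bound \<open>\<Sum>k. \<Sum>e\<in>F k. |cinner (f k e) (I k e)|\<^sup>p\<close>, where \<open>I k\<close> is the Fourier coefficient of \<open>A\<close>
  at \<open>k\<close>.

  Such matrix elements depend continuously on \<open>A\<close>, so \<open>A\<close> may be replaced by a simple function, and each
  of its finitely many values by a truncated singular value decomposition. With the singular vectors
  fixed, the matrix elements are the image of the singular values \<open>s j i\<close> under a finite complex matrix.
  For arbitrary complex coefficients in place of the singular values, the two endpoints bound this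
  matrix from \<open>\<ell>\<^sup>2(\<ell>\<^sup>2)\<close> to \<open>\<ell>\<^sup>2\<close> and from \<open>\<ell>\<^sup>1(\<ell>\<^sup>\<infinity>)\<close> to \<open>\<ell>\<^sup>\<infinity>\<close>, and interpolation by the three lines
  theorem (\<open>finite_riesz_thorin\<close>) gives the bound from \<open>\<ell>\<^sup>q(\<ell>\<^sup>p)\<close> to \<open>\<ell>\<^sup>p\<close> that is needed.\<close>

section \<open>The complex inner product\<close>

instance complex_hilbert_space < banach ..

lemma cinner_add_left: "cinner (x + y) z = cinner x z + cinner y (z :: 'h::complex_hilbert_space)"
  by (metis cinner_add_right cinner_commute complex_cnj_add)

lemma cinner_scaleC_left: "cinner (a *\<^sub>C x) y = cnj a * cinner x (y :: 'h::complex_hilbert_space)"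
  by (metis cinner_commute cinner_scaleC_right complex_cnj_mult)

lemma cinner_scaleR_right: "cinner x (r *\<^sub>R y) = r * cinner x (y :: 'h::complex_hilbert_space)"
  by (simp add: scaleR_eq_scaleC cinner_scaleC_right)

lemma cinner_scaleR_left: "cinner (r *\<^sub>R x) y = r * cinner x (y :: 'h::complex_hilbert_space)"
  by (simp add: scaleR_eq_scaleC cinner_scaleC_left)

lemma cinner_self: "cinner x x = complex_of_real ((norm (x :: 'h::complex_hilbert_space))\<^sup>2)"
proof -
  have "Im (cinner x x) = 0"
    by (metis cinner_commute cnj.simps(2) equal_neg_zero)
  moreover have "Re (cinner x x) = (norm x)\<^sup>2"
    by (metis inner_eq_Re_cinner power2_norm_eq_inner)
  ultimately show ?thesis
    by (simp add: complex_eq_iff)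
qed

lemma scaleC_one [simp]: "1 *\<^sub>C x = (x :: 'h::complex_hilbert_space)"
  using scaleR_eq_scaleC[of 1 x] by simp

lemma scaleC_zero_left [simp]: "0 *\<^sub>C x = (0 :: 'h::complex_hilbert_space)"
  using scaleR_eq_scaleC[of 0 x] by simp

lemma scaleC_zero_right [simp]: "a *\<^sub>C 0 = (0 :: 'h::complex_hilbert_space)"
  using norm_scaleC[of a "0::'h"] by simp

lemma scaleC_minus_left: "(- a) *\<^sub>C x = - (a *\<^sub>C (x :: 'h::complex_hilbert_space))"
  using scaleC_add_left[of "-a" a x] by (simp add: eq_neg_iff_add_eq_0)

lemma cnj_sgn_mult: "cnj (sgn w) * w = complex_of_real (cmod w)"
proof -
  have "cnj (sgn w) * w = (w * cnj w) / cmod w"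
    by (simp add: sgn_eq)
  also have "\<dots> = complex_of_real ((cmod w)\<^sup>2) / cmod w"
    by (simp only: complex_norm_square)
  finally show ?thesis
    by (simp add: power2_eq_square)
qed

lemma cinner_sgn_left: "cinner (sgn x) x = complex_of_real (norm (x :: 'h::complex_hilbert_space))"
  by (cases "x = 0") (simp_all add: sgn_div_norm cinner_scaleR_left cinner_self power2_eq_square
      field_simps)

text \<open>The Cauchy-Schwarz inequality for the real inner product, after rotating \<open>y\<close> so that the complex
  inner product becomes real.\<close>

lemma cmod_cinner_le: "cmod (cinner x y) \<le> norm x * norm (y :: 'h::complex_hilbert_space)"
proof (cases "cinner x y = 0")
  case False
  define a where "a = cnj (sgn (cinner x y))"
  have a: "cmod a = 1"
    using False by (simp add: a_def norm_sgn)
  have "cinner x (a *\<^sub>C y) = cmod (cinner x y)"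
    by (simp add: cinner_scaleC_right a_def cnj_sgn_mult)
  then have "cmod (cinner x y) = inner x (a *\<^sub>C y)"
    by (simp add: inner_eq_Re_cinner)
  also have "\<dots> \<le> norm x * norm (a *\<^sub>C y)"
    by (rule norm_cauchy_schwarz)
  finally show ?thesis
    by (simp add: norm_scaleC a)
qed auto

lemma bounded_bilinear_cinner:
  "bounded_bilinear (cinner :: 'h::complex_hilbert_space \<Rightarrow> 'h \<Rightarrow> complex)"
proof
  show "\<exists>K. \<forall>a b. cmod (cinner a b) \<le> norm a * norm (b :: 'h) * K"
    using cmod_cinner_le by (intro exI[of _ 1]) auto
qed (auto simp: cinner_add_left cinner_add_right cinner_scaleR_left cinner_scaleR_right scaleR_conv_of_real)

interpretation cinner: bounded_bilinear "cinner :: 'h::complex_hilbert_space \<Rightarrow> 'h \<Rightarrow> complex"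
  by (rule bounded_bilinear_cinner)

lemma cinner_ext: "(\<And>y. cinner y x = cinner y z) \<Longrightarrow> x = (z :: 'h::complex_hilbert_space)"
proof -
  assume "\<And>y. cinner y x = cinner y z"
  then have "cinner (x - z) (x - z) = 0"
    by (simp add: cinner.diff_right)
  then show "x = z"
    by (simp add: cinner_self)
qed

section \<open>Orthonormal sets\<close>

definition orthonormal :: "'h::complex_hilbert_space set \<Rightarrow> bool" where
  "orthonormal B \<longleftrightarrow> (\<forall>e\<in>B. \<forall>f\<in>B. cinner e f = (if e = f then 1 else 0))"

lemma orthonormal_subset: "orthonormal B \<Longrightarrow> F \<subseteq> B \<Longrightarrow> orthonormal F"
  by (simp add: orthonormal_def subset_iff)

lemma orthonormal_norm: "orthonormal B \<Longrightarrow> e \<in> B \<Longrightarrow> norm e = 1"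
proof -
  assume "orthonormal B" "e \<in> B"
  then have "complex_of_real ((norm e)\<^sup>2) = 1"
    unfolding cinner_self[symmetric] by (simp add: orthonormal_def)
  then have "(norm e)\<^sup>2 = 1"
    using of_real_eq_1_iff by blast
  then show "norm e = 1"
    using norm_ge_zero[of e] by (auto simp: power2_eq_1_iff)
qed

lemma orthonormal_insert:
  assumes "orthonormal B" "norm x = 1" "\<And>e. e \<in> B \<Longrightarrow> cinner e x = 0"
  shows "orthonormal (insert x B)"
proof -
  have "cinner x e = 0" if "e \<in> B" for e
    using assms(3)[OF that] cinner_commute[of x e] by simp
  moreover have "x \<notin> B"
    using assms(2) assms(3)[of x] by (auto simp: cinner_self)
  ultimately show ?thesis
    using assms unfolding orthonormal_def by (auto simp: cinner_self)
qed

lemma cinner_orthonormal_combination: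
  assumes "orthonormal F" "finite F" "e \<in> F"
  shows "cinner e (\<Sum>f\<in>F. c f *\<^sub>C f) = c e"
proof -
  have "cinner e (\<Sum>f\<in>F. c f *\<^sub>C f) = (\<Sum>f\<in>F. if f = e then c f else 0)"
    unfolding cinner.sum_right
    using assms by (intro sum.cong) (auto simp: cinner_scaleC_right orthonormal_def)
  then show ?thesis
    using assms by simp
qed

definition orthonormal_family :: "'i set \<Rightarrow> ('i \<Rightarrow> 'h::complex_hilbert_space) \<Rightarrow> bool" where
  "orthonormal_family I v \<longleftrightarrow> (\<forall>i\<in>I. \<forall>j\<in>I. cinner (v i) (v j) = (if i = j then 1 else 0))"

lemma norm_orthonormal_family_combination:
  assumes "finite I" "orthonormal_family I v"
  shows "(norm (\<Sum>i\<in>I. a i *\<^sub>C v i))\<^sup>2 = (\<Sum>i\<in>I. (cmod (a i))\<^sup>2)"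
proof -
  have "complex_of_real ((norm (\<Sum>i\<in>I. a i *\<^sub>C v i))\<^sup>2)
      = (\<Sum>i\<in>I. \<Sum>j\<in>I. cnj (a i) * (a j * cinner (v i) (v j)))"
    unfolding cinner_self[symmetric] cinner.sum_left cinner.sum_right
    by (subst sum.swap) (simp add: cinner_scaleC_left cinner_scaleC_right mult.left_commute)
  also have "\<dots> = (\<Sum>i\<in>I. \<Sum>j\<in>I. if j = i then cnj (a i) * a i else 0)"
    using assms(2) by (intro sum.cong) (auto simp: orthonormal_family_def)
  also have "\<dots> = complex_of_real (\<Sum>i\<in>I. (cmod (a i))\<^sup>2)"
    unfolding of_real_sum complex_norm_square using assms(1) by (simp add: mult.commute)
  finally show ?thesis
    by (simp only: of_real_eq_iff)
qed

lemma norm_orthonormal_combination: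
  assumes "orthonormal F" "finite F"
  shows "(norm (\<Sum>e\<in>F. c e *\<^sub>C e))\<^sup>2 = (\<Sum>e\<in>F. (cmod (c e))\<^sup>2)"
  using assms by (intro norm_orthonormal_family_combination) (simp_all add: orthonormal_def
      orthonormal_family_def)

lemma norm_minus_orthonormal_projection:
  assumes "orthonormal F" "finite F"
  shows "(norm (x - (\<Sum>e\<in>F. cinner e x *\<^sub>C e)))\<^sup>2 = (norm x)\<^sup>2 - (\<Sum>e\<in>F. (cmod (cinner e x))\<^sup>2)"
proof -
  let ?v = "\<Sum>e\<in>F. cinner e x *\<^sub>C e"
  have "cinner ?v x = (\<Sum>e\<in>F. cnj (cinner e x) * cinner e x)"
    by (subst cinner.sum_left) (simp add: cinner_scaleC_left)
  also have "\<dots> = (\<Sum>e\<in>F. (cmod (cinner e x))\<^sup>2)"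
    by (simp only: of_real_sum complex_norm_square mult.commute)
  finally have "inner ?v x = (\<Sum>e\<in>F. (cmod (cinner e x))\<^sup>2)"
    by (simp add: inner_eq_Re_cinner)
  moreover have "(norm (x - ?v))\<^sup>2 = (norm x)\<^sup>2 - 2 * inner ?v x + (norm ?v)\<^sup>2"
    by (simp add: power2_norm_eq_inner inner_diff inner_commute)
  ultimately show ?thesis
    using norm_orthonormal_combination[OF assms, of "\<lambda>e. cinner e x"] by simp
qed

lemma bessel_inequality:
  assumes "orthonormal F" "finite F"
  shows "(\<Sum>e\<in>F. (cmod (cinner e x))\<^sup>2) \<le> (norm x)\<^sup>2"
  using norm_minus_orthonormal_projection[OF assms, of x] by (smt (verit) zero_le_power2)

text \<open>Riesz-Fischer: the partial sums are Cauchy because the squared norm of a difference of two of them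
  is a tail of a convergent series of nonnegative numbers.\<close>

lemma riesz_fischer:
  fixes B :: "'h::complex_hilbert_space set"
  assumes "orthonormal B" and bound: "\<And>F. finite F \<Longrightarrow> F \<subseteq> B \<Longrightarrow> (\<Sum>e\<in>F. (cmod (c e))\<^sup>2) \<le> C"
  shows "(\<lambda>e. c e *\<^sub>C e) summable_on B"
proof -
  have "(\<lambda>e. (cmod (c e))\<^sup>2) summable_on B"
    by (rule nonneg_bdd_above_summable_on) (auto intro!: bdd_aboveI2[of _ _ C] bound)
  then obtain L where lim: "(sum (\<lambda>e. (cmod (c e))\<^sup>2) \<longlongrightarrow> L) (finite_subsets_at_top B)"
    unfolding has_sum_def summable_on_def by blast
  have "\<exists>P. eventually P (finite_subsets_at_top B) \<and>
          (\<forall>F F'. P F \<and> P F' \<longrightarrow> dist (\<Sum>e\<in>F. c e *\<^sub>C e) (\<Sum>e\<in>F'. c e *\<^sub>C e) < \<epsilon>)" if "\<epsilon> > 0" for \<epsilon>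
  proof -
    define d where "d = (\<epsilon> / 2)\<^sup>2 / 2"
    have "d > 0"
      using that by (simp add: d_def)
    have "\<forall>\<^sub>F F in finite_subsets_at_top B. dist (\<Sum>e\<in>F. (cmod (c e))\<^sup>2) L < d"
      using lim \<open>d > 0\<close> by (simp add: tendsto_iff)
    then obtain F0 where F0: "finite F0" "F0 \<subseteq> B"
      and near: "\<And>F. finite F \<Longrightarrow> F0 \<subseteq> F \<Longrightarrow> F \<subseteq> B \<Longrightarrow> dist (\<Sum>e\<in>F. (cmod (c e))\<^sup>2) L < d"
      by (auto simp: eventually_finite_subsets_at_top)
    define P where "P F \<longleftrightarrow> finite F \<and> F0 \<subseteq> F \<and> F \<subseteq> B" for F
    have close: "dist (\<Sum>e\<in>F. c e *\<^sub>C e) (\<Sum>e\<in>F0. c e *\<^sub>C e) < \<epsilon> / 2" if "P F" for F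
    proof -
      have F: "finite F" "F0 \<subseteq> F" "F \<subseteq> B"
        using that by (auto simp: P_def)
      have "(norm (\<Sum>e\<in>F - F0. c e *\<^sub>C e))\<^sup>2 = (\<Sum>e\<in>F - F0. (cmod (c e))\<^sup>2)"
        using F assms(1) by (intro norm_orthonormal_combination) (auto intro: orthonormal_subset)
      also have "\<dots> = (\<Sum>e\<in>F. (cmod (c e))\<^sup>2) - (\<Sum>e\<in>F0. (cmod (c e))\<^sup>2)"
        using F by (simp add: sum_diff)
      also have "\<dots> < 2 * d"
        using near[of F] near[of F0] F F0 by (simp add: dist_real_def)
      also have "2 * d = (\<epsilon> / 2)\<^sup>2"
        by (simp add: d_def)
      finally have "norm (\<Sum>e\<in>F - F0. c e *\<^sub>C e) < \<epsilon> / 2"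
        by (rule power2_less_imp_less) (use \<open>\<epsilon> > 0\<close> in simp)
      then show ?thesis
        using F by (simp add: dist_norm sum_diff)
    qed
    have "eventually P (finite_subsets_at_top B)"
      unfolding eventually_finite_subsets_at_top P_def using F0 by blast
    moreover have "dist (\<Sum>e\<in>F. c e *\<^sub>C e) (\<Sum>e\<in>F'. c e *\<^sub>C e) < \<epsilon>" if "P F" "P F'" for F F'
      using close[OF that(1)] close[OF that(2)]
        dist_triangle2[of "\<Sum>e\<in>F. c e *\<^sub>C e" "\<Sum>e\<in>F'. c e *\<^sub>C e" "\<Sum>e\<in>F0. c e *\<^sub>C e"] by linarith
    ultimately show ?thesis
      by blast
  qed
  then have "cauchy_filter (filtermap (sum (\<lambda>e. c e *\<^sub>C e)) (finite_subsets_at_top B))"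
    by (simp add: cauchy_filter_metric_filtermap)
  moreover have "complete (UNIV :: 'h set)"
    by (meson Cauchy_convergent UNIV_I complete_def convergent_def)
  ultimately obtain v where "(sum (\<lambda>e. c e *\<^sub>C e) \<longlongrightarrow> v) (finite_subsets_at_top B)"
    using complete_uniform[where S = UNIV] by (force simp add: filterlim_def)
  then show ?thesis
    using summable_on_def has_sum_def by blast
qed

lemma cinner_has_sum:
  assumes "orthonormal B" "((\<lambda>e. c e *\<^sub>C e) has_sum v) B" "e \<in> B"
  shows "cinner e v = c e"
proof -
  have "((\<lambda>f. cinner e (c f *\<^sub>C f)) has_sum cinner e v) B"
    using assms(2) cinner.bounded_linear_right by (rule has_sum_bounded_linear[rotated])
  moreover have "((\<lambda>f. cinner e (c f *\<^sub>C f)) has_sum c e) B"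
    using assms by (intro has_sum_finite_neutralI[of
        "{e}"]) (auto simp: cinner_scaleC_right orthonormal_def)
  ultimately show ?thesis
    using has_sum_unique by blast
qed

lemma is_onb_orthonormal: "is_onb B \<Longrightarrow> orthonormal B"
  by (simp add: is_onb_def orthonormal_def)

lemma onb_expansion:
  assumes "is_onb B"
  shows "((\<lambda>e. cinner e x *\<^sub>C e) has_sum x) B"
proof -
  have B: "orthonormal B"
    using assms by (rule is_onb_orthonormal)
  then have "(\<lambda>e. cinner e x *\<^sub>C e) summable_on B"
    by (rule riesz_fischer[where C = "(norm x)\<^sup>2"]) (auto intro!: bessel_inequality
        orthonormal_subset[OF B])
  then obtain v where v: "((\<lambda>e. cinner e x *\<^sub>C e) has_sum v) B"
    unfolding summable_on_def by blast
  have "cinner e (x - v) = 0" if "e \<in> B" for e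
    using cinner_has_sum[OF B v that] by (simp add: cinner.diff_right)
  then have "x - v = 0"
    using assms unfolding is_onb_def by blast
  then show ?thesis
    using v by simp
qed

lemma parseval_has_sum:
  assumes "is_onb B"
  shows "((\<lambda>e. (cmod (cinner e x))\<^sup>2) has_sum (norm x)\<^sup>2) B"
proof -
  have B: "orthonormal B"
    using assms by (rule is_onb_orthonormal)
  have "((\<lambda>F. (norm x)\<^sup>2 - (norm (x - (\<Sum>e\<in>F. cinner e x *\<^sub>C e)))\<^sup>2) \<longlongrightarrow> (norm x)\<^sup>2 - (norm (x - x))\<^sup>2)
    (finite_subsets_at_top B)"
    by (intro tendsto_intros onb_expansion[OF assms, unfolded has_sum_def])
  then have "((\<lambda>F. (norm x)\<^sup>2 - (norm (x - (\<Sum>e\<in>F. cinner e x *\<^sub>C e)))\<^sup>2) \<longlongrightarrow> (norm x)\<^sup>2)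
    (finite_subsets_at_top B)"
    by simp
  then show ?thesis
    unfolding has_sum_def
    by (rule Lim_transform_eventually)
      (auto intro!: eventually_finite_subsets_at_top_weakI
        simp: norm_minus_orthonormal_projection orthonormal_subset[OF B])
qed

lemma infsum_ennreal_has_sum:
  fixes f :: "'a \<Rightarrow> real"
  assumes "(f has_sum v) A" "\<And>x. x \<in> A \<Longrightarrow> f x \<ge> 0"
  shows "(\<Sum>\<^sub>\<infinity>x\<in>A. ennreal (f x)) = ennreal v"
proof -
  have "ennreal v = (SUP F\<in>{F. finite F \<and> F \<subseteq> A}. ennreal (sum f F))"
    using assms infsum_nonneg_is_SUPREMUM_ennreal[of f A] by (auto simp: has_sum_iff)
  also have "\<dots> = (SUP F\<in>{F. finite F \<and> F \<subseteq> A}. \<Sum>x\<in>F. ennreal (f x))"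
    using assms(2) by (intro SUP_cong refl) (auto simp: sum_ennreal subset_iff)
  also have "\<dots> = (\<Sum>\<^sub>\<infinity>x\<in>A. ennreal (f x))"
    by (simp add: nonneg_infsum_complete)
  finally show ?thesis ..
qed

lemma parseval:
  "is_onb B \<Longrightarrow> (\<Sum>\<^sub>\<infinity>e\<in>B. ennreal ((cmod (cinner e x))\<^sup>2)) = ennreal ((norm x)\<^sup>2)"
  by (intro infsum_ennreal_has_sum parseval_has_sum) auto

text \<open>Zorn's lemma. With all vectors for \<open>Q\<close> the result is an orthonormal basis, with the eigenvectors
  of an operator it is a candidate for an eigenbasis.\<close>

lemma maximal_orthonormal_subset:
  fixes Q :: "'h::complex_hilbert_space set"
  obtains E where "orthonormal E" "E \<subseteq> Q" "\<And>x. x \<in> Q \<Longrightarrow> norm x = 1 \<Longrightarrow> \<exists>e\<in>E. cinner e x \<noteq> 0"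
proof -
  define \<A> where "\<A> = {E. orthonormal E \<and> E \<subseteq> Q}"
  have "\<exists>M\<in>\<A>. \<forall>X\<in>\<A>. M \<subseteq> X \<longrightarrow> X = M"
  proof (rule subset_Zorn_nonempty)
    show "\<A> \<noteq> {}"
      by (auto simp: \<A>_def orthonormal_def intro!: exI[of _ "{}"])
    fix \<C> assume "\<C> \<noteq> {}" and chain: "subset.chain \<A> \<C>"
    have "cinner e f = (if e = f then 1 else 0)" if ef: "e \<in> X" "f \<in> Y" "X \<in> \<C>" "Y \<in> \<C>" for e f X Y
    proof -
      have "X \<subseteq> Y \<or> Y \<subseteq> X"
        using chain ef by (auto simp: subset.chain_def)
      then obtain Z where "Z \<in> \<C>" "e \<in> Z" "f \<in> Z"
        using ef by blast
      then show ?thesis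
        using chain by (auto simp: subset.chain_def \<A>_def orthonormal_def)
    qed
    then show "\<Union> \<C> \<in> \<A>"
      using chain by (fastforce simp: \<A>_def orthonormal_def subset.chain_def)
  qed
  then obtain E where E: "E \<in> \<A>" and maxE: "\<And>X. X \<in> \<A> \<Longrightarrow> E \<subseteq> X \<Longrightarrow> X = E"
    by blast
  show ?thesis
  proof
    fix x assume x: "x \<in> Q" "norm x = 1"
    show "\<exists>e\<in>E. cinner e x \<noteq> 0"
    proof (rule ccontr)
      assume "\<not> ?thesis"
      then have "insert x E \<in> \<A>" and "x \<notin> E"
        using E x by (auto simp: \<A>_def cinner_self intro!: orthonormal_insert)
      then show False
        using maxE[of "insert x E"] by blast
    qed
  qed (use E in \<open>auto simp: \<A>_def\<close>)
qed

lemma is_onbI: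
  assumes "orthonormal B" "\<And>x. norm x = 1 \<Longrightarrow> \<exists>e\<in>B. cinner e x \<noteq> 0"
  shows "is_onb B"
proof -
  have "x = 0" if x: "\<forall>e\<in>B. cinner e x = 0" for x
  proof (rule ccontr)
    assume "x \<noteq> 0"
    then have "norm (sgn x) = 1"
      by (simp add: norm_sgn)
    then obtain e where "e \<in> B" "cinner e (sgn x) \<noteq> 0"
      using assms(2) by blast
    then show False
      using x by (simp add: sgn_div_norm cinner_scaleR_right)
  qed
  then show ?thesis
    using assms(1) by (simp add: is_onb_def orthonormal_def)
qed

lemma onb_exists: "\<exists>B :: 'h::complex_hilbert_space set. is_onb B"
proof -
  obtain B :: "'h set" where "orthonormal B" "\<And>x. norm x = 1 \<Longrightarrow> \<exists>e\<in>B. cinner e x \<noteq> 0"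
    by (rule maximal_orthonormal_subset[of UNIV]) auto
  then show ?thesis
    using is_onbI by blast
qed

section \<open>Adjoints\<close>

lemma clinear_op_scaleC: "clinear_op T \<Longrightarrow> T (c *\<^sub>C x) = c *\<^sub>C T x"
  by (simp add: clinear_op_def)

text \<open>The adjoint at \<open>y\<close> is the vector with coefficients \<open>cinner (T e) y\<close> in an orthonormal basis. A
  finite partial sum \<open>v\<close> of it satisfies \<open>(norm v)^2 = cinner (T v) y\<close>, which bounds the coefficients.\<close>

lemma adjoint_vector_exists:
  fixes T :: "'h::complex_hilbert_space \<Rightarrow>\<^sub>L 'h"
  assumes "clinear_op T"
  shows "\<exists>z. \<forall>x. cinner (T x) y = cinner x z"
proof -
  obtain B :: "'h set" where B: "is_onb B"
    using onb_exists by blast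
  then have oB: "orthonormal B"
    by (rule is_onb_orthonormal)
  have "(\<lambda>e. cinner (T e) y *\<^sub>C e) summable_on B"
  proof (rule riesz_fischer[OF oB])
    fix F assume F: "finite F" "F \<subseteq> B"
    define v where "v = (\<Sum>e\<in>F. cinner (T e) y *\<^sub>C e)"
    have v2: "(norm v)\<^sup>2 = (\<Sum>e\<in>F. (cmod (cinner (T e) y))\<^sup>2)"
      unfolding v_def using F by (intro norm_orthonormal_combination orthonormal_subset[OF oB]) auto
    have "cinner (T v) y = (\<Sum>e\<in>F. cnj (cinner (T e) y) * cinner (T e) y)"
      by (simp add: v_def blinfun.sum_right clinear_op_scaleC[OF assms] cinner.sum_left cinner_scaleC_left)
    also have "\<dots> = (norm v)\<^sup>2"
      by (simp only: v2 of_real_sum complex_norm_square mult.commute)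
    finally have "(norm v)\<^sup>2 = cmod (cinner (T v) y)"
      by (simp add: norm_power)
    also have "\<dots> \<le> norm T * norm v * norm y"
      by (meson cmod_cinner_le mult_right_mono norm_blinfun norm_ge_zero order_trans)
    finally have "norm v * norm v \<le> (norm T * norm y) * norm v"
      by (simp add: power2_eq_square mult_ac)
    then have "norm v \<le> norm T * norm y"
      by (cases "norm v = 0") (auto simp: mult_le_cancel_right)
    then show "(\<Sum>e\<in>F. (cmod (cinner (T e) y))\<^sup>2) \<le> (norm T * norm y)\<^sup>2"
      unfolding v2[symmetric] by (intro power_mono) auto
  qed
  then obtain z where z: "((\<lambda>e. cinner (T e) y *\<^sub>C e) has_sum z) B"
    unfolding summable_on_def by blast
  have "cinner (T x) y = cinner x z" for x
  proof -
    have "((\<lambda>e. cinner (T (cinner e x *\<^sub>C e)) y) has_sum cinner (T x) y) B"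
      by (rule has_sum_bounded_linear[OF _ onb_expansion[OF B]])
        (intro bounded_linear_compose[OF cinner.bounded_linear_left] blinfun.bounded_linear_right)
    moreover have "((\<lambda>e. cinner (cinner e x *\<^sub>C e) z) has_sum cinner x z) B"
      by (rule has_sum_bounded_linear[OF cinner.bounded_linear_left onb_expansion[OF B]])
    moreover have "cinner (T (cinner e x *\<^sub>C e)) y = cinner (cinner e x *\<^sub>C e) z" if "e \<in> B" for e
      using cinner_has_sum[OF oB z that] by (simp add: clinear_op_scaleC[OF assms] cinner_scaleC_left)
    ultimately have "((\<lambda>e. cinner (cinner e x *\<^sub>C e) z) has_sum cinner (T x) y) B"
      "((\<lambda>e. cinner (cinner e x *\<^sub>C e) z) has_sum cinner x z) B"
      by (simp_all cong: has_sum_cong)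
    then show ?thesis
      by (rule has_sum_unique)
  qed
  then show ?thesis
    by blast
qed

lemma cinner_adjoint:
  fixes T :: "'h::complex_hilbert_space \<Rightarrow>\<^sub>L 'h"
  assumes T: "clinear_op T"
  shows "cinner (T x) y = cinner x (adjoint_op T y)"
proof -
  obtain S where S: "\<And>x y. cinner (T x) y = cinner x (S y)"
    using adjoint_vector_exists[OF T] by metis
  have "bounded_linear S"
  proof (rule bounded_linear_intro[where K = "norm T"])
    show "S (y + z) = S y + S z" for y z
      by (rule cinner_ext) (simp add: S[symmetric] cinner_add_right)
    show "S (r *\<^sub>R y) = r *\<^sub>R S y" for r y
      by (rule cinner_ext) (simp add: S[symmetric] cinner_scaleR_right)
    show "norm (S y) \<le> norm y * norm T" for y
    proof -
      have "(norm (S y))\<^sup>2 = cmod (cinner (S y) (S y))"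
        by (simp add: cinner_self norm_power)
      also have "\<dots> \<le> norm T * norm (S y) * norm y"
        unfolding S[symmetric] by (meson cmod_cinner_le mult_right_mono norm_blinfun norm_ge_zero
            order_trans)
      finally have "norm (S y) * norm (S y) \<le> (norm y * norm T) * norm (S y)"
        by (simp add: power2_eq_square mult_ac)
      then show ?thesis
        by (cases "norm (S y) = 0") (auto simp: mult_le_cancel_right)
    qed
  qed
  then have ex: "\<forall>x y. cinner (T x) y = cinner x (Blinfun S y)"
    by (simp add: S bounded_linear_Blinfun_apply)
  have "\<forall>x y. cinner (T x) y = cinner x (adjoint_op T y)"
    unfolding adjoint_op_def
  proof (rule theI[of _ "Blinfun S"])
    fix S' assume "\<forall>x y. cinner (T x) y = cinner x (blinfun_apply S' y)"
    then show "S' = Blinfun S"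
      using ex by (intro blinfun_eqI cinner_ext) metis
  qed (rule ex)
  then show ?thesis
    by blast
qed

section \<open>Functional calculus of positive operators\<close>

definition selfadjoint_op :: "('h::complex_hilbert_space \<Rightarrow>\<^sub>L 'h) \<Rightarrow> bool" where
  "selfadjoint_op T \<longleftrightarrow> (\<forall>x y. cinner (T x) y = cinner x (T y))"

definition psd_op :: "('h::complex_hilbert_space \<Rightarrow>\<^sub>L 'h) \<Rightarrow> bool" where
  "psd_op T \<longleftrightarrow> (\<forall>x. 0 \<le> inner x (T x))"

lemma selfadjoint_inner: "selfadjoint_op T \<Longrightarrow> inner (T x) y = inner x (T y)"
  by (simp add: selfadjoint_op_def inner_eq_Re_cinner)

lemma poly_op_eq_sum:
  assumes "degree P \<le> n"
  shows "poly_op P T = (\<Sum>i\<le>n. coeff P i *\<^sub>R ((\<lambda>S. T o\<^sub>L S) ^^ i) id_blinfun)"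
  unfolding poly_op_def using assms
  by (intro sum.mono_neutral_left) (auto simp: coeff_eq_0)

lemma poly_op_0 [simp]: "poly_op 0 T = 0"
  by (simp add: poly_op_def)

lemma poly_op_add: "poly_op (P + Q) T = poly_op P T + poly_op Q T"
proof -
  let ?n = "max (degree P) (degree Q)"
  show ?thesis
    by (simp add: poly_op_eq_sum[of _ ?n] degree_add_le scaleR_add_left sum.distrib)
qed

lemma poly_op_smult: "poly_op (smult a P) T = a *\<^sub>R poly_op P T"
  by (simp add: poly_op_eq_sum[of _ "degree P"] scaleR_sum_right)

lemma poly_op_minus: "poly_op (- P) T = - poly_op P T"
  using poly_op_smult[of "-1" P T] by simp

lemma poly_op_diff: "poly_op (P - Q) T = poly_op P T - poly_op Q T"
  using poly_op_add[of P "- Q" T] by (simp add: poly_op_minus)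

lemma poly_op_pCons: "poly_op (pCons a P) T = a *\<^sub>R id_blinfun + (T o\<^sub>L poly_op P T)"
proof -
  have "poly_op (pCons a P) T =
      (\<Sum>i\<le>Suc (degree P). coeff (pCons a P) i *\<^sub>R ((\<lambda>S. T o\<^sub>L S) ^^ i) id_blinfun)"
    by (rule poly_op_eq_sum) (simp add: degree_pCons_le)
  also have "\<dots> = a *\<^sub>R id_blinfun + (\<Sum>i\<le>degree P. coeff P i *\<^sub>R (T o\<^sub>L ((\<lambda>S. T o\<^sub>L S) ^^ i) id_blinfun))"
    by (subst sum.atMost_Suc_shift) simp
  also have "(\<Sum>i\<le>degree P. coeff P i *\<^sub>R (T o\<^sub>L ((\<lambda>S. T o\<^sub>L S) ^^ i) id_blinfun)) = T o\<^sub>L poly_op P T"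
    unfolding poly_op_def
    by (simp add: bounded_bilinear.sum_right[OF bounded_bilinear_blinfun_compose]
        bounded_bilinear.scaleR_right[OF bounded_bilinear_blinfun_compose])
  finally show ?thesis .
qed

lemma poly_op_mult: "poly_op (P * Q) T = poly_op P T o\<^sub>L poly_op Q T"
proof (induction P)
  case (pCons a P)
  show ?case
    by (rule blinfun_eqI)
      (simp add: poly_op_add poly_op_smult poly_op_pCons pCons.IH blinfun.add_left
          blinfun.scaleR_left blinfun.add_right)
qed (auto intro: blinfun_eqI)

lemma poly_op_const: "poly_op [:c:] T = c *\<^sub>R id_blinfun"
  by (rule blinfun_eqI) (simp add: poly_op_pCons blinfun.add_left)

lemma poly_op_var: "poly_op [:0, 1:] T = T"
  by (rule blinfun_eqI) (simp add: poly_op_pCons blinfun.add_left)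

lemma selfadjoint_poly_op:
  assumes "selfadjoint_op T"
  shows "selfadjoint_op (poly_op P T)"
proof (induction P)
  case (pCons a P)
  have "poly_op P T (T y) = T (poly_op P T y)" for y
    using poly_op_mult[of P "[:0, 1:]" T] poly_op_mult[of "[:0, 1:]" P T]
    by (metis blinfun_apply_blinfun_compose mult.commute poly_op_var)
  then show ?case
    using pCons.IH assms
    by (simp add: selfadjoint_op_def poly_op_pCons blinfun.add_left blinfun.scaleR_left
        cinner_add_left cinner_add_right cinner_scaleR_left cinner_scaleR_right)
qed (simp add: selfadjoint_op_def cinner.zero_left cinner.zero_right)

text \<open>The polynomials \<open>Q\<close> in \<open>positive_multipliers H\<close> remain positive at \<open>H\<close> after multiplication by
  \<open>x\<close>, by \<open>m - x\<close> (where \<open>m\<close> is the norm of \<open>H\<close>), or by both. Multiplying twice by \<open>x\<close> or by \<open>m - x\<close> is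
  conjugation with a self-adjoint operator, so this cone is closed under multiplication with \<open>x\<close> and \<open>m
  - x\<close>; a polynomial that is positive on \<open>[0, m]\<close> is built from these factors, positive constants and
  squares.\<close>

definition positive_multipliers :: "('h::complex_hilbert_space \<Rightarrow>\<^sub>L 'h) \<Rightarrow> real poly set" where
  "positive_multipliers H = {Q.
     psd_op (poly_op Q H) \<and> psd_op (poly_op ([:0, 1:] * Q) H) \<and>
     psd_op (poly_op ([:norm H, -1:] * Q) H) \<and> psd_op (poly_op ([:0, 1:] * [:norm H, -1:] * Q) H)}"

lemma psd_poly_op_add:
  "psd_op (poly_op P H) \<Longrightarrow> psd_op (poly_op Q H) \<Longrightarrow> psd_op (poly_op (P + Q) H)"
  by (simp add: psd_op_def poly_op_add blinfun.add_left inner_add_right)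

lemma psd_poly_op_smult:
  "psd_op (poly_op P H) \<Longrightarrow> 0 \<le> a \<Longrightarrow> psd_op (poly_op (smult a P) H)"
  by (simp add: psd_op_def poly_op_smult blinfun.scaleR_left)

lemma psd_poly_op_square:
  assumes "selfadjoint_op H" "psd_op (poly_op P H)"
  shows "psd_op (poly_op (R * R * P) H)"
proof -
  have "inner x (poly_op (R * R * P) H x) = inner (poly_op R H x) (poly_op P H (poly_op R H x))" for x
  proof -
    have "R * R * P = R * (P * R)"
      by (simp add: mult_ac)
    show ?thesis
      unfolding \<open>R * R * P = R * (P * R)\<close>
      by (simp add: poly_op_mult selfadjoint_inner[OF selfadjoint_poly_op[OF assms(1)]])
  qed
  then show ?thesis
    using assms(2) by (simp add: psd_op_def)
qed

lemma positive_multipliers_add: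
  "P \<in> positive_multipliers H \<Longrightarrow> Q \<in> positive_multipliers H \<Longrightarrow> P + Q \<in> positive_multipliers H"
  unfolding positive_multipliers_def mem_Collect_eq distrib_left by (blast intro: psd_poly_op_add)

lemma positive_multipliers_smult:
  "P \<in> positive_multipliers H \<Longrightarrow> 0 \<le> a \<Longrightarrow> smult a P \<in> positive_multipliers H"
  unfolding positive_multipliers_def mem_Collect_eq mult_smult_right by (blast intro: psd_poly_op_smult)

lemma positive_multipliers_square:
  assumes "selfadjoint_op H" "P \<in> positive_multipliers H"
  shows "R * R * P \<in> positive_multipliers H"
proof -
  have *: "A * (R * R * P) = R * R * (A * P)" for A
    by (simp only: mult_ac)
  show ?thesis
    using assms(2) unfolding positive_multipliers_def mem_Collect_eq *
    by (blast intro: psd_poly_op_square[OF assms(1)])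
qed

lemma positive_multipliers_var:
  assumes H: "selfadjoint_op H" and P: "P \<in> positive_multipliers H"
  shows "[:0, 1:] * P \<in> positive_multipliers H" "[:norm H, -1:] * P \<in> positive_multipliers H"
proof -
  let ?X = "[:0, 1:] :: real poly" and ?Y = "[:norm H, -1:]"
  have *: "?X * (?X * P) = ?X * ?X * P" "?Y * (?X * P) = ?X * ?Y * P" "?X * ?Y * (?X * P)
      = ?X * ?X * (?Y * P)"
    "?X * (?Y * P) = ?X * ?Y * P" "?Y * (?Y * P) = ?Y * ?Y * P" "?X * ?Y * (?Y * P) = ?Y * ?Y * (?X * P)"
    by (simp_all only: mult_ac)
  show "?X * P \<in> positive_multipliers H"
    using P psd_poly_op_square[OF H, of _ ?X] unfolding positive_multipliers_def mem_Collect_eq * by blast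
  show "?Y * P \<in> positive_multipliers H"
    using P psd_poly_op_square[OF H, of _ ?Y] unfolding positive_multipliers_def mem_Collect_eq * by blast
qed

lemma psd_poly_op_var: "psd_op H \<Longrightarrow> psd_op (poly_op [:0, 1:] H)"
  by (simp add: poly_op_var)

lemma psd_norm_minus: "psd_op (poly_op [:norm H, -1:] H)"
proof -
  have "inner x (H x) \<le> norm H * (norm x)\<^sup>2" for x
  proof -
    have "inner x (H x) \<le> norm x * norm (H x)"
      by (rule norm_cauchy_schwarz)
    also have "\<dots> \<le> norm x * (norm H * norm x)"
      by (intro mult_left_mono norm_blinfun) auto
    finally show ?thesis
      by (simp add: power2_eq_square mult_ac)
  qed
  moreover have "poly_op [:norm H, -1:] H = norm H *\<^sub>R id_blinfun - H"
    by (rule blinfun_eqI) (simp add: poly_op_pCons blinfun.add_left blinfun.diff_left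
        blinfun.scaleR_left blinfun.minus_left blinfun.minus_right)
  ultimately show ?thesis
    by (simp add: psd_op_def blinfun.diff_left blinfun.scaleR_left inner_diff_right power2_norm_eq_inner)
qed

lemma positive_multipliers_1:
  assumes "selfadjoint_op H" "psd_op H"
  shows "1 \<in> positive_multipliers H"
proof -
  let ?X = "[:0, 1:] :: real poly" and ?Y = "[:norm H, -1:]"
  have X: "psd_op (poly_op ?X H)" and Y: "psd_op (poly_op ?Y H)"
    using assms by (simp_all add: psd_poly_op_var psd_norm_minus)
  have "psd_op (poly_op (?X * ?Y) H)"
  proof (cases "H = 0")
    case False
    \<comment> \<open>With \<open>y = m - x\<close> one has \<open>m x y = (x + y) x y\<close>.\<close>
    have "?X * ?Y = smult (1 / norm H) (?X * ?X * ?Y + ?Y * ?Y * ?X)"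
      using False by (simp add: field_simps)
    then show ?thesis
      using psd_poly_op_square[OF assms(1)] X Y
      by (metis norm_ge_zero psd_poly_op_add psd_poly_op_smult zero_le_divide_1_iff)
  qed (simp only: poly_op_mult poly_op_var psd_op_def, simp)
  moreover have "psd_op (poly_op 1 H)"
    by (simp add: one_pCons poly_op_const psd_op_def blinfun.scaleR_left)
  ultimately show ?thesis
    using X Y by (simp only: positive_multipliers_def mem_Collect_eq mult_1_right)
qed

abbreviation cpoly :: "real poly \<Rightarrow> complex \<Rightarrow> complex" where
  "cpoly P z \<equiv> poly (map_poly complex_of_real P) z"

lemma cpoly_pCons: "cpoly (pCons a P) z = a + z * cpoly P z"
  by (simp add: map_poly_pCons)

lemma cpoly_add: "cpoly (P + Q) z = cpoly P z + cpoly Q z"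
  by (induction P Q rule: poly_induct2) (simp_all add: cpoly_pCons algebra_simps)

lemma cpoly_smult: "cpoly (smult a P) z = a * cpoly P z"
  by (induction P) (simp_all add: cpoly_pCons algebra_simps)

lemma cpoly_mult: "cpoly (P * Q) z = cpoly P z * cpoly Q z"
  by (induction P) (simp_all add: cpoly_pCons cpoly_add cpoly_smult algebra_simps)

lemma cpoly_of_real: "cpoly P (complex_of_real x) = poly P x"
  by (induction P) (simp_all add: cpoly_pCons)

text \<open>At a complex root \<open>z\<close> that is not real, the remainder of \<open>P\<close> modulo \<open>(x - Re z)\<^sup>2 + (Im z)\<^sup>2\<close>
  vanishes. It is linear with real coefficients, so it is \<open>0\<close>.\<close>

lemma real_poly_factor_cases:
  fixes P :: "real poly"
  assumes "degree P \<noteq> 0"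
  obtains r Q where "P = [:- r, 1:] * Q" | a b Q where "b \<noteq> 0" "P = ([:- a, 1:] * [:- a, 1:] + [:b\<^sup>2:]) * Q"
proof -
  have "degree (map_poly complex_of_real P) \<noteq> 0"
    using assms by (simp add: degree_map_poly)
  then have "\<nexists>a l. a \<noteq> 0 \<and> l = 0 \<and> map_poly complex_of_real P = pCons a l"
    by auto
  then obtain z where z: "cpoly P z = 0"
    using fundamental_theorem_of_algebra_alt by blast
  show thesis
  proof (cases "Im z = 0")
    case True
    then have "z = complex_of_real (Re z)"
      by (simp add: complex_eq_iff)
    then have "poly P (Re z) = 0"
      using z by (metis cpoly_of_real of_real_eq_0_iff)
    then show thesis
      using that(1) by (metis dvdE poly_eq_0_iff_dvd)
  next
    case False
    define D where "D = [:- Re z, 1:] * [:- Re z, 1:] + [:(Im z)\<^sup>2:]"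
    have degD: "degree D = 2" and "D \<noteq> 0"
      by (simp_all add: D_def)
    have "cpoly D z = 0"
      by (simp add: D_def cpoly_pCons complex_eq_iff power2_eq_square algebra_simps)
    moreover have "cpoly P z = cpoly (P div D) z * cpoly D z + cpoly (P mod D) z"
      by (simp only: cpoly_mult[symmetric] cpoly_add[symmetric] div_mult_mod_eq)
    ultimately have R: "cpoly (P mod D) z = 0"
      using z by simp
    have "degree (P mod D) < 2"
      using degree_mod_less[OF \<open>D \<noteq> 0\<close>, of P] degD by auto
    then have "P mod D = [:coeff (P mod D) 0, coeff (P mod D) 1:]"
      by (intro poly_eqI) (auto simp: coeff_pCons coeff_eq_0 split: nat.split)
    then obtain c d where cd: "P mod D = [:c, d:]"
      by blast
    then have "complex_of_real c + z * complex_of_real d = 0"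
      using R by (simp add: cpoly_pCons)
    then have "d = 0" "c = 0"
      using False by (auto simp: complex_eq_iff)
    then have "P = D * (P div D)"
      using cd div_mult_mod_eq[of P D] by (simp add: mult.commute)
    then show thesis
      using that(2)[OF False] unfolding D_def by blast
  qed
qed

lemma positive_imp_positive_multipliers:
  assumes H: "selfadjoint_op H" "psd_op H"
  shows "(\<And>x. 0 \<le> x \<Longrightarrow> x \<le> norm H \<Longrightarrow> 0 < poly P x) \<Longrightarrow> P \<in> positive_multipliers H"
proof (induction "degree P" arbitrary: P rule: less_induct)
  case less
  show ?case
  proof (cases "degree P = 0")
    case True
    then obtain c where c: "P = [:c:]"
      by (rule degree_eq_zeroE)
    then have "P = smult c 1" "0 \<le> c"
      using less.prems[of 0] by simp_all
    then show ?thesis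
      using positive_multipliers_smult[OF positive_multipliers_1[OF H], of c] by simp
  next
    case False
    then have "P \<noteq> 0"
      by auto
    consider (linear) r Q where "P = [:- r, 1:] * Q"
      | (quadratic) a b Q where "b \<noteq> 0" "P = ([:- a, 1:] * [:- a, 1:] + [:b\<^sup>2:]) * Q"
      using False by (rule real_poly_factor_cases)
    then show ?thesis
    proof cases
      case linear
      have "Q \<noteq> 0"
        using \<open>P \<noteq> 0\<close> linear by auto
      have deg: "degree Q < degree P"
        unfolding linear using \<open>Q \<noteq> 0\<close> by (subst degree_mult_eq) auto
      have pos: "0 < (x - r) * poly Q x" if "0 \<le> x" "x \<le> norm H" for x
        using less.prems[OF that] linear by (simp add: algebra_simps)
      have "r < 0 \<or> norm H < r"
        using pos[of r] by force
      then consider "r < 0" | "norm H < r"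
        by blast
      then show ?thesis
      proof cases
        case 1
        have "0 < poly Q x" if "0 \<le> x" "x \<le> norm H" for x
          using pos[OF that] that 1 by (simp add: zero_less_mult_iff)
        then have "Q \<in> positive_multipliers H"
          using deg less.hyps by blast
        moreover have "P = [:0, 1:] * Q + smult (- r) Q"
          using linear by simp
        ultimately show ?thesis
          using 1 H by (simp only:)
            (intro positive_multipliers_add positive_multipliers_var positive_multipliers_smult, auto)
      next
        case 2
        have "0 < poly (- Q) x" if "0 \<le> x" "x \<le> norm H" for x
          using pos[OF that] that 2 by (simp add: zero_less_mult_iff)
        then have "- Q \<in> positive_multipliers H"
          using deg less.hyps[of "- Q"] by simp
        moreover have "P = [:norm H, -1:] * (- Q) + smult (r - norm H) (- Q)"
          using linear by (simp add: algebra_simps smult_diff_left)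
        ultimately show ?thesis
          using 2 H by (simp only:)
            (intro positive_multipliers_add positive_multipliers_var positive_multipliers_smult, auto)
      qed
    next
      case quadratic
      let ?L = "[:- a, 1:]"
      have "Q \<noteq> 0"
        using \<open>P \<noteq> 0\<close> quadratic by auto
      have "degree (?L * ?L + [:b\<^sup>2:]) = 2"
        by simp
      moreover from this have "?L * ?L + [:b\<^sup>2:] \<noteq> 0"
        by (metis degree_0 zero_neq_numeral)
      ultimately have deg: "degree Q < degree P"
        unfolding quadratic(2) using \<open>Q \<noteq> 0\<close> by (subst degree_mult_eq) linarith+
      have "0 < poly Q x" if "0 \<le> x" "x \<le> norm H" for x
      proof -
        have "0 < ((x - a)\<^sup>2 + b\<^sup>2) * poly Q x"
          using less.prems[OF that] quadratic by (simp add: power2_eq_square algebra_simps)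
        moreover have "0 < (x - a)\<^sup>2 + b\<^sup>2"
          using \<open>b \<noteq> 0\<close> by (simp add: add_nonneg_pos)
        ultimately show ?thesis
          by (simp add: zero_less_mult_iff)
      qed
      then have Q: "Q \<in> positive_multipliers H"
        using deg less.hyps by blast
      have "P = ?L * ?L * Q + smult (b\<^sup>2) Q"
        using quadratic by (simp add: distrib_right smult_add_left)
      then show ?thesis
        using Q H(1) by (simp only:)
          (intro positive_multipliers_add positive_multipliers_square positive_multipliers_smult, auto)
    qed
  qed
qed

lemma nonneg_if_nonneg_add_epsilon:
  fixes a b :: real
  assumes "\<And>\<epsilon>. \<epsilon> > 0 \<Longrightarrow> 0 \<le> a + \<epsilon> * b"
  shows "0 \<le> a"
proof -
  have "((\<lambda>\<epsilon>. a + \<epsilon> * b) \<longlongrightarrow> a + 0 * b) (at_right 0)"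
    by (intro tendsto_intros)
  then have "0 \<le> a + 0 * b"
    by (rule tendsto_lowerbound) (auto intro!: assms eventually_at_rightI[of 0 1])
  then show ?thesis
    by simp
qed

lemma psd_poly_op:
  assumes H: "selfadjoint_op H" "psd_op H" and P: "\<And>x. 0 \<le> x \<Longrightarrow> x \<le> norm H \<Longrightarrow> 0 \<le> poly P x"
  shows "psd_op (poly_op P H)"
  unfolding psd_op_def
proof
  fix v
  show "0 \<le> inner v (poly_op P H v)"
  proof (rule nonneg_if_nonneg_add_epsilon)
    fix \<epsilon> :: real assume "\<epsilon> > 0"
    then have "P + [:\<epsilon>:] \<in> positive_multipliers H"
      using P by (intro positive_imp_positive_multipliers[OF H]) (simp add: add_nonneg_pos)
    then have "psd_op (poly_op (P + [:\<epsilon>:]) H)"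
      by (simp add: positive_multipliers_def)
    then show "0 \<le> inner v (poly_op P H v) + \<epsilon> * inner v v"
      by (simp add: psd_op_def poly_op_add poly_op_const blinfun.add_left blinfun.scaleR_left
          inner_add_right)
  qed
qed

text \<open>The polynomial \<open>c\<^sup>2 - P\<^sup>2\<close> is nonnegative on \<open>[0, norm H]\<close>, and its quadratic form at \<open>v\<close> is \<open>c\<^sup>2
  (norm v)\<^sup>2 - (norm (P(H) v))\<^sup>2\<close>.\<close>

lemma norm_poly_op_le:
  assumes H: "selfadjoint_op H" "psd_op H"
    and P: "\<And>x. 0 \<le> x \<Longrightarrow> x \<le> norm H \<Longrightarrow> \<bar>poly P x\<bar> \<le> c"
  shows "norm (poly_op P H) \<le> c"
proof (rule norm_blinfun_bound)
  show "0 \<le> c"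
    using P[of 0] by simp
  fix v
  have "psd_op (poly_op ([:c\<^sup>2:] - P * P) H)"
    using H
  proof (rule psd_poly_op)
    fix x assume "0 \<le> x" "x \<le> norm H"
    then have "\<bar>poly P x\<bar>\<^sup>2 \<le> c\<^sup>2"
      using P by (intro power_mono) auto
    then show "0 \<le> poly ([:c\<^sup>2:] - P * P) x"
      by (simp add: power2_eq_square)
  qed
  then have "0 \<le> inner v (poly_op ([:c\<^sup>2:] - P * P) H v)"
    by (simp add: psd_op_def)
  also have "\<dots> = c\<^sup>2 * inner v v - inner v (poly_op P H (poly_op P H v))"
    by (simp add: poly_op_diff poly_op_const poly_op_mult blinfun.diff_left blinfun.scaleR_left
        inner_diff_right)
  also have "inner v (poly_op P H (poly_op P H v)) = (norm (poly_op P H v))\<^sup>2"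
    unfolding power2_norm_eq_inner
    by (rule selfadjoint_inner[OF selfadjoint_poly_op[OF H(1)], symmetric])
  also have "c\<^sup>2 * inner v v = (c * norm v)\<^sup>2"
    by (simp only: power_mult_distrib power2_norm_eq_inner)
  finally have "(norm (poly_op P H v))\<^sup>2 \<le> (c * norm v)\<^sup>2"
    by simp
  then show "norm (poly_op P H v) \<le> c * norm v"
    by (rule power2_le_imp_le) (use \<open>0 \<le> c\<close> in simp)
qed

lemma weierstrass_sequence:
  fixes f :: "real \<Rightarrow> real"
  assumes "continuous_on {a..b} f"
  obtains P where "uniform_limit {a..b} (\<lambda>n x. poly (P n) x) f sequentially"
proof -
  have "\<exists>P. \<forall>x\<in>{a..b}. \<bar>f x - poly P x\<bar> < inverse (real (Suc n))" for n
  proof -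
    obtain g where g: "real_polynomial_function g" "\<And>x. x \<in> {a..b} \<Longrightarrow> \<bar>f x - g x\<bar> < inverse (real (Suc n))"
      using Stone_Weierstrass_real_polynomial_function[OF compact_Icc assms, of
          "inverse (real (Suc n))"] by auto
    then obtain c m where "g = (\<lambda>x. \<Sum>i\<le>m. c i * x ^ i)"
      by (auto simp: real_polynomial_function_iff_sum)
    then have "g x = poly (\<Sum>i\<le>m. monom (c i) i) x" for x
      by (simp add: poly_sum poly_monom)
    then show ?thesis
      using g(2) by metis
  qed
  then obtain P where P: "\<And>n x. x \<in> {a..b} \<Longrightarrow> \<bar>f x - poly (P n) x\<bar> < inverse (real (Suc n))"
    by metis
  have "uniform_limit {a..b} (\<lambda>n x. poly (P n) x) f sequentially"
    unfolding uniform_limit_iff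
  proof (intro allI impI)
    fix \<epsilon> :: real assume "\<epsilon> > 0"
    then have "\<forall>\<^sub>F n in sequentially. inverse (real (Suc n)) < \<epsilon>"
      using LIMSEQ_inverse_real_of_nat by (simp add: order_tendsto_iff)
    then show "\<forall>\<^sub>F n in sequentially. \<forall>x\<in>{a..b}. dist (poly (P n) x) (f x) < \<epsilon>"
    proof eventually_elim
      case (elim n)
      show ?case
      proof
        fix x assume "x \<in> {a..b}"
        from P[OF this, of n] elim show "dist (poly (P n) x) (f x) < \<epsilon>"
          by (simp add: dist_real_def abs_minus_commute)
      qed
    qed
  qed
  then show thesis
    by (rule that)
qed

text \<open>Polynomials that are uniformly close on \<open>[0, norm H]\<close> give operators that are close in norm. So
  the limit exists and does not depend on the sequence, which justifies the definite description that
  defines the functional calculus.\<close>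

lemma cfc_pos_tendsto:
  assumes H: "selfadjoint_op H" "psd_op H" and f: "continuous_on {0..norm H} f"
    and P: "uniform_limit {0..norm H} (\<lambda>n x. poly (P n) x) f sequentially"
  shows "(\<lambda>n. poly_op (P n) H) \<longlonglongrightarrow> cfc_pos f H"
proof -
  have close: "norm (poly_op A H - poly_op B H) \<le> 2 * \<epsilon>"
    if "\<forall>x\<in>{0..norm H}. dist (poly A x) (f x) < \<epsilon>" "\<forall>x\<in>{0..norm H}. dist (poly B x) (f x) < \<epsilon>" for A B \<epsilon>
  proof -
    have "norm (poly_op (A - B) H) \<le> 2 * \<epsilon>"
    proof (rule norm_poly_op_le[OF H])
      fix x assume "0 \<le> x" "x \<le> norm H"
      then have "dist (poly A x) (f x) < \<epsilon>" "dist (poly B x) (f x) < \<epsilon>"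
        using that by auto
      then show "\<bar>poly (A - B) x\<bar> \<le> 2 * \<epsilon>"
        by (simp add: dist_real_def)
    qed
    then show ?thesis
      by (simp add: poly_op_diff)
  qed
  obtain Q where Q: "uniform_limit {0..norm H} (\<lambda>n x. poly (Q n) x) f sequentially"
    using weierstrass_sequence[OF f] .
  have "Cauchy (\<lambda>n. poly_op (Q n) H)"
  proof (rule metric_CauchyI)
    fix \<epsilon> :: real assume "\<epsilon> > 0"
    then obtain N where N: "\<And>n. n \<ge> N \<Longrightarrow> \<forall>x\<in>{0..norm H}. dist (poly (Q n) x) (f x) < \<epsilon> / 3"
      using Q unfolding uniform_limit_iff eventually_sequentially
          by (meson zero_less_divide_iff zero_less_numeral)
    have "dist (poly_op (Q m) H) (poly_op (Q n) H) < \<epsilon>" if "m \<ge> N" "n \<ge> N" for m n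
      using close[OF N[OF that(1)] N[OF that(2)]] \<open>\<epsilon> > 0\<close> by (simp add: dist_norm)
    then show "\<exists>N. \<forall>m\<ge>N. \<forall>n\<ge>N. dist (poly_op (Q m) H) (poly_op (Q n) H) < \<epsilon>"
      by blast
  qed
  then obtain S where S: "(\<lambda>n. poly_op (Q n) H) \<longlonglongrightarrow> S"
    using Cauchy_convergent convergent_def by blast
  have lim: "(\<lambda>n. poly_op (R n) H) \<longlonglongrightarrow> S" if R: "uniform_limit {0..norm H} (\<lambda>n x. poly (R n) x) f
      sequentially" for R
  proof -
    have "(\<lambda>n. poly_op (R n) H - poly_op (Q n) H) \<longlonglongrightarrow> 0"
    proof (rule tendstoI)
      fix \<epsilon> :: real assume "\<epsilon> > 0"
      then have "\<forall>\<^sub>F n in sequentially. \<forall>x\<in>{0..norm H}. dist (poly (R n) x) (f x) < \<epsilon> / 3"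
        "\<forall>\<^sub>F n in sequentially. \<forall>x\<in>{0..norm H}. dist (poly (Q n) x) (f x) < \<epsilon> / 3"
        using R Q unfolding uniform_limit_iff by (meson zero_less_divide_iff zero_less_numeral)+
      then show "\<forall>\<^sub>F n in sequentially. dist (poly_op (R n) H - poly_op (Q n) H) 0 < \<epsilon>"
      proof eventually_elim
        case (elim n)
        from close[OF elim] \<open>\<epsilon> > 0\<close> show ?case
          by simp
      qed
    qed
    from tendsto_add[OF this S] show ?thesis
      by simp
  qed
  have "\<forall>P. uniform_limit {0..norm H} (\<lambda>n x. poly (P n) x) f sequentially
        \<longrightarrow> (\<lambda>n. poly_op (P n) H) \<longlonglongrightarrow> cfc_pos f H"
    unfolding cfc_pos_def
  proof (rule theI[of _ S])
    fix S' assume "\<forall>P. uniform_limit {0..norm H} (\<lambda>n x. poly (P n) x) f sequentially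
        \<longrightarrow> (\<lambda>n. poly_op (P n) H) \<longlonglongrightarrow> S'"
    then have "(\<lambda>n. poly_op (Q n) H) \<longlonglongrightarrow> S'"
      using Q by blast
    then show "S' = S"
      using S by (rule LIMSEQ_unique)
  qed (use lim in blast)
  then show ?thesis
    using P by blast
qed

context
  fixes H :: "'h::complex_hilbert_space \<Rightarrow>\<^sub>L 'h"
  assumes H: "selfadjoint_op H" "psd_op H"
begin

lemma cfc_pos_poly: "cfc_pos (poly P) H = poly_op P H"
proof -
  have "(\<lambda>n. poly_op P H) \<longlonglongrightarrow> cfc_pos (poly P) H"
    by (rule cfc_pos_tendsto[OF H _ uniform_limit_const]) (intro continuous_on_poly continuous_on_id)
  then show ?thesis
    by (simp add: LIMSEQ_const_iff)
qed

lemma selfadjoint_cfc_pos: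
  assumes "continuous_on {0..norm H} f"
  shows "selfadjoint_op (cfc_pos f H)"
  unfolding selfadjoint_op_def
proof (intro allI)
  fix x y
  obtain P where P: "uniform_limit {0..norm H} (\<lambda>n x. poly (P n) x) f sequentially"
    using weierstrass_sequence[OF assms] .
  note lim = blinfun.tendsto[OF cfc_pos_tendsto[OF H assms P] tendsto_const]
  have "cinner (poly_op (P n) H x) y = cinner x (poly_op (P n) H y)" for n
    using selfadjoint_poly_op[OF H(1)] by (simp add: selfadjoint_op_def)
  moreover have "(\<lambda>n. cinner (poly_op (P n) H x) y) \<longlonglongrightarrow> cinner (cfc_pos f H x) y"
    by (intro cinner.tendsto lim tendsto_const)
  ultimately have "(\<lambda>n. cinner x (poly_op (P n) H y)) \<longlonglongrightarrow> cinner (cfc_pos f H x) y"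
    by simp
  moreover have "(\<lambda>n. cinner x (poly_op (P n) H y)) \<longlonglongrightarrow> cinner x (cfc_pos f H y)"
    by (intro cinner.tendsto lim tendsto_const)
  ultimately show "cinner (cfc_pos f H x) y = cinner x (cfc_pos f H y)"
    by (rule LIMSEQ_unique)
qed

lemma cfc_pos_mult:
  assumes f: "continuous_on {0..norm H} f" and g: "continuous_on {0..norm H} g"
  shows "cfc_pos (\<lambda>x. f x * g x) H = cfc_pos f H o\<^sub>L cfc_pos g H"
proof -
  obtain P where P: "uniform_limit {0..norm H} (\<lambda>n x. poly (P n) x) f sequentially"
    using weierstrass_sequence[OF f] .
  obtain Q where Q: "uniform_limit {0..norm H} (\<lambda>n x. poly (Q n) x) g sequentially"
    using weierstrass_sequence[OF g] .
  have bdd: "bounded (f ` {0..norm H})" "bounded (g ` {0..norm H})"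
    by (auto intro!: compact_imp_bounded compact_continuous_image f g)
  have "uniform_limit {0..norm H} (\<lambda>n x. poly (P n * Q n) x) (\<lambda>x. f x * g x) sequentially"
    using uniform_lim_mult[OF P Q bdd] by simp
  then have "(\<lambda>n. poly_op (P n * Q n) H) \<longlonglongrightarrow> cfc_pos (\<lambda>x. f x * g x) H"
    by (rule cfc_pos_tendsto[OF H, rotated]) (intro continuous_intros f g)
  moreover have "(\<lambda>n. poly_op (P n * Q n) H) \<longlonglongrightarrow> (cfc_pos f H o\<^sub>L cfc_pos g H)"
    unfolding poly_op_mult
    by (intro bounded_bilinear.tendsto[OF bounded_bilinear_blinfun_compose] cfc_pos_tendsto[OF H] f g P Q)
  ultimately show ?thesis
    using LIMSEQ_unique by blast
qed

lemma cfc_pos_mono: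
  assumes f: "continuous_on {0..norm H} f" and g: "continuous_on {0..norm H} g"
    and le: "\<And>x. 0 \<le> x \<Longrightarrow> x \<le> norm H \<Longrightarrow> f x \<le> g x"
  shows "inner v (cfc_pos f H v) \<le> inner v (cfc_pos g H v)"
proof -
  obtain P where P: "uniform_limit {0..norm H} (\<lambda>n x. poly (P n) x) f sequentially"
    using weierstrass_sequence[OF f] .
  obtain Q where Q: "uniform_limit {0..norm H} (\<lambda>n x. poly (Q n) x) g sequentially"
    using weierstrass_sequence[OF g] .
  have "0 \<le> inner v (cfc_pos g H v) - inner v (cfc_pos f H v)"
  proof (rule nonneg_if_nonneg_add_epsilon)
    fix \<epsilon> :: real assume "\<epsilon> > 0"
    have "(\<lambda>n. inner v (poly_op (Q n) H v) - inner v (poly_op (P n) H v) + \<epsilon> * (2 * inner v v)) \<longlonglongrightarrow>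
      inner v (cfc_pos g H v) - inner v (cfc_pos f H v) + \<epsilon> * (2 * inner v v)"
      by (intro tendsto_intros blinfun.tendsto cfc_pos_tendsto[OF H] f g P Q)
    then show "0 \<le> inner v (cfc_pos g H v) - inner v (cfc_pos f H v) + \<epsilon> * (2 * inner v v)"
    proof (rule tendsto_lowerbound)
      have "\<forall>\<^sub>F n in sequentially. \<forall>x\<in>{0..norm H}. dist (poly (P n) x) (f x) < \<epsilon>"
        "\<forall>\<^sub>F n in sequentially. \<forall>x\<in>{0..norm H}. dist (poly (Q n) x) (g x) < \<epsilon>"
        using P Q \<open>\<epsilon> > 0\<close> by (simp_all add: uniform_limit_iff)
      then show "\<forall>\<^sub>F n in sequentially.
        0 \<le> inner v (poly_op (Q n) H v) - inner v (poly_op (P n) H v) + \<epsilon> * (2 * inner v v)"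
      proof eventually_elim
        case (elim n)
        have "psd_op (poly_op (Q n - P n + [:2 * \<epsilon>:]) H)"
          using H
        proof (rule psd_poly_op)
          fix x assume x: "0 \<le> x" "x \<le> norm H"
          then have "dist (poly (P n) x) (f x) < \<epsilon>" "dist (poly (Q n) x) (g x) < \<epsilon>"
            using elim by auto
          then show "0 \<le> poly (Q n - P n + [:2 * \<epsilon>:]) x"
            using le[OF x] by (simp add: dist_real_def abs_less_iff)
        qed
        then have "0 \<le> inner v (poly_op (Q n - P n + [:2 * \<epsilon>:]) H v)"
          by (simp add: psd_op_def)
        then show ?case
          by (simp add: poly_op_add poly_op_diff poly_op_const blinfun.add_left blinfun.diff_left
              blinfun.scaleR_left inner_add_right inner_diff_right mult_ac)
      qed
    qed simp
  qed
  then show ?thesis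
    by simp
qed

lemma psd_cfc_pos:
  assumes "continuous_on {0..norm H} f" "\<And>x. 0 \<le> x \<Longrightarrow> x \<le> norm H \<Longrightarrow> 0 \<le> f x"
  shows "psd_op (cfc_pos f H)"
proof -
  have "poly 0 = (\<lambda>x. 0 :: real)"
    by auto
  then have "cfc_pos (\<lambda>x. 0) H = 0"
    using cfc_pos_poly[of 0] by simp
  then show ?thesis
    unfolding psd_op_def using cfc_pos_mono[OF _ assms(1), of "\<lambda>x. 0"] assms(2) by simp
qed

lemma cfc_pos_eigenvector:
  assumes f: "continuous_on {0..norm H} f" and ev: "H e = l *\<^sub>R e" and l: "0 \<le> l" "l \<le> norm H"
  shows "cfc_pos f H e = f l *\<^sub>R e"
proof -
  obtain P where P: "uniform_limit {0..norm H} (\<lambda>n x. poly (P n) x) f sequentially"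
    using weierstrass_sequence[OF f] .
  have "poly_op A H e = poly A l *\<^sub>R e" for A
    by (induction A) (simp_all add: poly_op_pCons blinfun.add_left blinfun.scaleR_left blinfun.scaleR_right
        ev scaleR_add_left mult.commute)
  moreover have "(\<lambda>n. poly_op (P n) H e) \<longlonglongrightarrow> cfc_pos f H e"
    by (intro blinfun.tendsto cfc_pos_tendsto[OF H] f P tendsto_const)
  ultimately have "(\<lambda>n. poly (P n) l *\<^sub>R e) \<longlonglongrightarrow> cfc_pos f H e"
    by simp
  moreover have "(\<lambda>n. poly (P n) l *\<^sub>R e) \<longlonglongrightarrow> f l *\<^sub>R e"
    using l by (intro tendsto_intros tendsto_uniform_limitI[OF P]) auto
  ultimately show ?thesis
    by (rule LIMSEQ_unique)
qed

end

lemma cfc_pos_cong: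
  assumes "\<And>x. 0 \<le> x \<Longrightarrow> x \<le> norm H \<Longrightarrow> f x = g x"
  shows "cfc_pos f H = cfc_pos g H"
proof -
  have "uniform_limit {0..norm H} (\<lambda>n x. poly (P n) x) f sequentially
      = uniform_limit {0..norm H} (\<lambda>n x. poly (P n) x) g sequentially" for P :: "nat \<Rightarrow> real poly"
    using assms by (intro uniform_limit_cong') auto
  then show ?thesis
    by (simp add: cfc_pos_def)
qed

lemma continuous_on_powr_nonneg: "0 < s \<Longrightarrow> continuous_on {0..b} (\<lambda>x :: real. x powr s)"
  by (intro continuous_on_powr' continuous_on_id continuous_on_const) auto

lemma powr_op_selfadjoint_psd:
  assumes "selfadjoint_op H" "psd_op H" "0 < s"
  shows "selfadjoint_op (powr_op H s)" "psd_op (powr_op H s)"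
  unfolding powr_op_def
  using assms by (auto intro!: selfadjoint_cfc_pos psd_cfc_pos continuous_on_powr_nonneg)

lemma powr_op_half_square:
  assumes "selfadjoint_op H" "psd_op H" "0 < s"
  shows "powr_op H (s / 2) o\<^sub>L powr_op H (s / 2) = powr_op H s"
proof -
  have "powr_op H (s / 2) o\<^sub>L powr_op H (s / 2) = cfc_pos (\<lambda>x. x powr (s / 2) * x powr (s / 2)) H"
    unfolding powr_op_def using assms by (intro cfc_pos_mult[symmetric] continuous_on_powr_nonneg) auto
  then show ?thesis
    by (simp add: powr_op_def powr_add[symmetric])
qed

lemma powr_op_1:
  assumes "selfadjoint_op H" "psd_op H"
  shows "powr_op H 1 = H"
proof -
  have "powr_op H 1 = cfc_pos (poly [:0, 1:]) H"
    unfolding powr_op_def by (rule cfc_pos_cong) simp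
  then show ?thesis
    using cfc_pos_poly[OF assms, of "[:0, 1:]"] by (simp only: poly_op_var)
qed

lemma powr_op_eigenvector:
  assumes "selfadjoint_op H" "psd_op H" "0 < s" "H e = l *\<^sub>R e" "0 \<le> l" "norm e = 1"
  shows "powr_op H s e = (l powr s) *\<^sub>R e"
proof -
  have "l = norm (H e)"
    using assms by simp
  then have "l \<le> norm H"
    using norm_blinfun[of H e] assms(6) by simp
  then show ?thesis
    unfolding powr_op_def using assms by (intro cfc_pos_eigenvector continuous_on_powr_nonneg) auto
qed

lemma adjoint_comp_selfadjoint_psd:
  assumes "clinear_op T"
  shows "selfadjoint_op (adjoint_op T o\<^sub>L T)" "psd_op (adjoint_op T o\<^sub>L T)"
proof -
  have *: "cinner x (adjoint_op T (T y)) = cinner (T x) (T y)" for x y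
    by (simp add: cinner_adjoint[OF assms])
  moreover have "cinner (adjoint_op T (T x)) y = cinner (T x) (T y)" for x y
    using *[of y x] by (metis cinner_commute)
  ultimately show "selfadjoint_op (adjoint_op T o\<^sub>L T)"
    by (simp add: selfadjoint_op_def)
  show "psd_op (adjoint_op T o\<^sub>L T)"
    by (simp add: psd_op_def inner_eq_Re_cinner * cinner_self)
qed

lemma inner_adjoint_comp:
  "clinear_op T \<Longrightarrow> inner x (adjoint_op T (T x)) = (norm (T x))\<^sup>2"
  by (simp add: inner_eq_Re_cinner cinner_adjoint[symmetric] cinner_self)

lemma abs_op_properties:
  assumes "clinear_op T"
  shows "selfadjoint_op (abs_op T)" "psd_op (abs_op T)" "abs_op T o\<^sub>L abs_op T = adjoint_op T o\<^sub>L T"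
  unfolding abs_op_def
  using powr_op_selfadjoint_psd[OF adjoint_comp_selfadjoint_psd[OF assms], of "1/2"]
    powr_op_half_square[OF adjoint_comp_selfadjoint_psd[OF assms], of 1]
    powr_op_1[OF adjoint_comp_selfadjoint_psd[OF assms]] by simp_all

section \<open>The Schatten norms and orthonormal systems\<close>

lemma summable_ennreal: "(f :: 'a \<Rightarrow> ennreal) summable_on A"
  by (rule nonneg_summable_on_complete) simp

lemma infsum_ennreal_leI:
  fixes f :: "'a \<Rightarrow> ennreal"
  shows "(\<And>F. finite F \<Longrightarrow> F \<subseteq> A \<Longrightarrow> sum f F \<le> c) \<Longrightarrow> infsum f A \<le> c"
  by (subst nonneg_infsum_complete) (auto intro!: SUP_least)

lemma sum_infsum_swap_ennreal:
  fixes f :: "'a \<Rightarrow> 'b \<Rightarrow> ennreal"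
  assumes "finite F"
  shows "(\<Sum>a\<in>F. \<Sum>\<^sub>\<infinity>b\<in>B. f a b) = (\<Sum>\<^sub>\<infinity>b\<in>B. \<Sum>a\<in>F. f a b)"
  using assms by (induction F) (auto simp: infsum_add[OF summable_ennreal summable_ennreal])

text \<open>Expanding \<open>(norm (W e))^2\<close> in the basis \<open>B\<close> and moving \<open>W\<close> to the other side turns the sum over
  \<open>E\<close> into one that Bessel's inequality controls.\<close>

lemma hilbert_schmidt_sum_le:
  assumes W: "\<And>x y. cinner (W x) y = cinner x (V y)" and B: "is_onb B" and E: "orthonormal E"
  shows "(\<Sum>\<^sub>\<infinity>e\<in>E. ennreal ((norm (V e))\<^sup>2)) \<le> (\<Sum>\<^sub>\<infinity>b\<in>B. ennreal ((norm (W b))\<^sup>2))"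
proof (rule infsum_ennreal_leI)
  fix F assume F: "finite F" "F \<subseteq> E"
  have "(\<Sum>e\<in>F. ennreal ((norm (V e))\<^sup>2)) = (\<Sum>e\<in>F. \<Sum>\<^sub>\<infinity>b\<in>B. ennreal ((cmod (cinner b (V e)))\<^sup>2))"
    by (simp add: parseval[OF B])
  also have "\<dots> = (\<Sum>\<^sub>\<infinity>b\<in>B. \<Sum>e\<in>F. ennreal ((cmod (cinner e (W b)))\<^sup>2))"
    using F(1) by (subst sum_infsum_swap_ennreal)
      (simp_all add: W[symmetric] cinner_commute[of "W _"] cong: infsum_cong)
  also have "\<dots> \<le> (\<Sum>\<^sub>\<infinity>b\<in>B. ennreal ((norm (W b))\<^sup>2))"
    using F bessel_inequality[OF orthonormal_subset[OF E]]
    by (intro infsum_mono summable_ennreal) (auto simp: sum_ennreal intro!: ennreal_leI)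
  finally show "(\<Sum>e\<in>F. ennreal ((norm (V e))\<^sup>2)) \<le> (\<Sum>\<^sub>\<infinity>b\<in>B. ennreal ((norm (W b))\<^sup>2))" .
qed

lemma trace_pos_square:
  assumes W: "selfadjoint_op W" and E: "is_onb E"
  shows "trace_pos (W o\<^sub>L W) = (\<Sum>\<^sub>\<infinity>e\<in>E. ennreal ((norm (W e))\<^sup>2))"
proof -
  define B where "B = (SOME B :: 'a set. is_onb B)"
  have B: "is_onb B"
    unfolding B_def using onb_exists by (rule someI_ex)
  have W': "cinner (W x) y = cinner x (W y)" for x y
    using W by (simp add: selfadjoint_op_def)
  have "trace_pos (W o\<^sub>L W) = (\<Sum>\<^sub>\<infinity>e\<in>B. ennreal ((norm (W e))\<^sup>2))"
    unfolding trace_pos_def B_def[symmetric] by (simp add: W'[symmetric] cinner_self)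
  also have "\<dots> = (\<Sum>\<^sub>\<infinity>e\<in>E. ennreal ((norm (W e))\<^sup>2))"
    using hilbert_schmidt_sum_le[of W W B E, OF W' B] hilbert_schmidt_sum_le[of W W E B, OF W' E] B E
    by (intro antisym) (auto intro: is_onb_orthonormal)
  finally show ?thesis .
qed

text \<open>For \<open>p \<ge> 2\<close> this supremum is \<open>tr |T|^p\<close>. Unlike the trace it visibly satisfies the triangle
  inequality and is lower semicontinuous in \<open>T\<close>.\<close>

definition orthonormal_power_sup :: "real \<Rightarrow> ('h::complex_hilbert_space \<Rightarrow>\<^sub>L 'h) \<Rightarrow> ennreal" where
  "orthonormal_power_sup p T =
     (SUP F\<in>{F. finite F \<and> orthonormal F}. ennreal (\<Sum>e\<in>F. norm (T e) powr p))"

lemma bernoulli_powr: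
  fixes t r :: real
  assumes "0 \<le> t" "1 \<le> r"
  shows "1 + r * (t - 1) \<le> t powr r"
proof (cases "t = 0")
  case False
  then have "(t powr r) powr (1 / r) * 1 powr (1 - 1 / r) \<le> (1 / r) * t powr r + (1 - 1 / r) * 1"
    using assms by (intro Youngs_inequality_0) auto
  then have "t \<le> (1 / r) * t powr r + (1 - 1 / r)"
    using assms False by (simp add: powr_powr)
  then have "r * t \<le> r * ((1 / r) * t powr r + (1 - 1 / r))"
    using assms by (intro mult_left_mono) auto
  also have "\<dots> = t powr r + r - 1"
    using assms by (simp add: field_simps)
  finally show ?thesis
    by (simp add: algebra_simps)
qed (use assms in auto)

text \<open>Jensen's inequality in the state given by \<open>e\<close>: with \<open>s = norm (T e)\<close>, the parabola \<open>s^p + (p/2)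
  s^(p-2) (x^2 - s^2)\<close> lies below \<open>x^p\<close> on \<open>[0, \<infinity>)\<close>, and evaluated at \<open>|T|\<close> its expectation is \<open>s^p\<close>
  because the expectation of \<open>|T|^2\<close> is \<open>s^2\<close>.\<close>

lemma norm_powr_le_inner_powr_op:
  assumes T: "clinear_op T" and p: "2 \<le> p" and e: "norm e = 1"
  shows "norm (T e) powr p \<le> inner e (powr_op (abs_op T) p e)"
proof (cases "norm (T e) = 0")
  case True
  then show ?thesis
    using powr_op_selfadjoint_psd[OF abs_op_properties(1,2)[OF T], of p] p by (simp add: psd_op_def)
next
  case False
  define s where "s = norm (T e)"
  have "s > 0"
    using False by (simp add: s_def)
  define a where "a = p / 2 * s powr (p - 2)"
  define Q where "Q = [:s powr p - a * s\<^sup>2, 0, a:]"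
  note R = abs_op_properties[OF T]
  have below: "poly Q x \<le> x powr p" if "0 \<le> x" for x
  proof -
    have "poly Q x = s powr p + a * s\<^sup>2 * ((x / s)\<^sup>2 - 1)"
      using \<open>s > 0\<close> by (simp add: Q_def field_simps power2_eq_square)
    also have "a * s\<^sup>2 = p / 2 * s powr p"
      using \<open>s > 0\<close> by (simp add: a_def powr_diff powr_numeral)
    also have "s powr p + p / 2 * s powr p * ((x / s)\<^sup>2 - 1) = s powr p * (1 + p / 2 * ((x / s)\<^sup>2 - 1))"
      unfolding distrib_left by (simp only: mult_1_right mult_ac)
    also have "\<dots> \<le> s powr p * ((x / s)\<^sup>2 powr (p / 2))"
      using p by (intro mult_left_mono bernoulli_powr) auto
    also have "(x / s)\<^sup>2 powr (p / 2) = (x / s) powr p"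
    proof (cases "x = 0")
      case False
      then have "(x / s)\<^sup>2 = (x / s) powr 2"
        using that \<open>s > 0\<close> by simp
      then show ?thesis
        by (simp only: powr_powr) simp
    qed simp
    also have "s powr p * (x / s) powr p = x powr p"
      using that \<open>s > 0\<close> by (simp add: powr_divide)
    finally show ?thesis .
  qed
  have "poly_op Q (abs_op T) = (s powr p - a * s\<^sup>2) *\<^sub>R id_blinfun + a *\<^sub>R (adjoint_op T o\<^sub>L T)"
    unfolding R(3)[symmetric] by (rule blinfun_eqI)
      (simp add: Q_def poly_op_pCons blinfun.add_left blinfun.scaleR_left blinfun.scaleR_right
          blinfun.add_right)
  then have "inner e (poly_op Q (abs_op T) e) = (s powr p - a * s\<^sup>2) * inner e e + a * s\<^sup>2"
    by (simp add: blinfun.add_left blinfun.scaleR_left inner_add_right inner_adjoint_comp[OF T] s_def)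
  also have "\<dots> = s powr p"
    using e by (simp add: power2_norm_eq_inner[symmetric])
  finally have "s powr p = inner e (cfc_pos (poly Q) (abs_op T) e)"
    by (simp add: cfc_pos_poly[OF R(1,2)])
  also have "\<dots> \<le> inner e (powr_op (abs_op T) p e)"
    unfolding powr_op_def using below p
    by (intro cfc_pos_mono[OF R(1,2)] continuous_on_powr_nonneg continuous_on_poly continuous_on_id) auto
  finally show ?thesis
    by (simp add: s_def)
qed

lemma orthonormal_power_sup_le_trace:
  assumes T: "clinear_op T" and p: "2 \<le> p"
  shows "orthonormal_power_sup p T \<le> trace_pos (powr_op (abs_op T) p)"
  unfolding orthonormal_power_sup_def
proof (rule SUP_least, safe)
  fix F :: "'a set" assume F: "finite F" "orthonormal F"
  define W where "W = powr_op (abs_op T) (p / 2)"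
  note R = abs_op_properties[OF T]
  have WW: "W o\<^sub>L W = powr_op (abs_op T) p"
    unfolding W_def using p by (intro powr_op_half_square R) auto
  have W: "selfadjoint_op W"
    unfolding W_def using p by (intro powr_op_selfadjoint_psd R) auto
  obtain B :: "'a set" where B: "is_onb B"
    using onb_exists by blast
  have "norm (T e) powr p \<le> (norm (W e))\<^sup>2" if "e \<in> F" for e
    using norm_powr_le_inner_powr_op[OF T p orthonormal_norm[OF F(2) that]]
    by (simp add: WW[symmetric] selfadjoint_inner[OF W, symmetric] power2_norm_eq_inner)
  then have "ennreal (\<Sum>e\<in>F. norm (T e) powr p) \<le> (\<Sum>e\<in>F. ennreal ((norm (W e))\<^sup>2))"
    by (subst sum_ennreal) (auto intro!: ennreal_leI sum_mono)
  also have "\<dots> \<le> (\<Sum>\<^sub>\<infinity>b\<in>B. ennreal ((norm (W b))\<^sup>2))"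
    using hilbert_schmidt_sum_le[of W W B F] W B F by (simp add: selfadjoint_op_def)
  also have "\<dots> = trace_pos (powr_op (abs_op T) p)"
    unfolding WW[symmetric] using trace_pos_square[OF W B] by simp
  finally show "ennreal (\<Sum>e\<in>F. norm (T e) powr p) \<le> trace_pos (powr_op (abs_op T) p)" .
qed

lemma simultaneous_convergent_subsequence:
  fixes c :: "nat \<Rightarrow> 'a \<Rightarrow> complex"
  assumes "finite F" "\<And>e. e \<in> F \<Longrightarrow> bounded (range (\<lambda>n. c n e))"
  shows "\<exists>r :: nat \<Rightarrow> nat. strict_mono r \<and> (\<forall>e\<in>F. convergent (\<lambda>n. c (r n) e))"
  using assms
proof (induction F)
  case empty
  then show ?case
    using strict_mono_id by auto
next
  case (insert x F)
  then obtain r :: "nat \<Rightarrow> nat" where r: "strict_mono r" "\<And>e. e \<in> F \<Longrightarrow> convergent (\<lambda>n. c (r n) e)"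
    by auto
  have "bounded (range (\<lambda>n. c (r n) x))"
    using insert.prems[of x] by (auto intro: bounded_subset)
  then obtain l r' where r': "strict_mono (r' :: nat \<Rightarrow> nat)" "((\<lambda>n. c (r n) x) \<circ> r') \<longlonglongrightarrow> l"
    using bounded_imp_convergent_subsequence by blast
  have "convergent (\<lambda>n. c ((r \<circ> r') n) e)" if "e \<in> insert x F" for e
  proof (cases "e = x")
    case True
    then show ?thesis
      using r'(2) by (auto simp: convergent_def o_def)
  next
    case False
    then show ?thesis
      using that r(2)[of e] r'(1) convergent_subseq_convergent by (fastforce simp: o_def)
  qed
  then show ?case
    using strict_mono_o[OF r(1) r'(1)] by blast
qed

lemma orthonormal_power_sup_upper:
  fixes T :: "'h::complex_hilbert_space \<Rightarrow>\<^sub>L 'h"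
  shows "finite F \<Longrightarrow> orthonormal F \<Longrightarrow> ennreal (\<Sum>e\<in>F. norm (T e) powr p) \<le> orthonormal_power_sup p T"
  unfolding orthonormal_power_sup_def by (rule SUP_upper) simp

text \<open>If the supremum is finite, then the orthonormal systems on which \<open>T\<close> exceeds \<open>d\<close> have bounded
  size. A system of maximal size cannot be extended, so \<open>T\<close> is at most \<open>d\<close> on its orthogonal complement.
  This is the form of compactness of \<open>T\<close> that the spectral theorem needs.\<close>

lemma finite_dominating_system:
  fixes T :: "'h::complex_hilbert_space \<Rightarrow>\<^sub>L 'h"
  assumes fin: "orthonormal_power_sup p T < \<infinity>" and p: "0 < p" and d: "0 < d"
  obtains F where "finite F" "orthonormal F" "F \<subseteq> Y"
    "\<And>y. y \<in> Y \<Longrightarrow> norm y = 1 \<Longrightarrow> (\<And>e. e \<in> F \<Longrightarrow> cinner e y = 0) \<Longrightarrow> norm (T y) \<le> d"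
proof -
  define good where "good F \<longleftrightarrow> finite F \<and> orthonormal F \<and> F \<subseteq> Y \<and> (\<forall>e\<in>F. d < norm (T e))" for F
  define C where "C = enn2real (orthonormal_power_sup p T)"
  have C: "orthonormal_power_sup p T = ennreal C" "0 \<le> C"
    using fin by (simp_all add: C_def less_top)
  have card_le: "real (card F) * d powr p \<le> C" if "good F" for F
  proof -
    have "real (card F) * d powr p = (\<Sum>e\<in>F. d powr p)"
      by simp
    also have "\<dots> \<le> (\<Sum>e\<in>F. norm (T e) powr p)"
      using that p d by (intro sum_mono powr_mono2) (auto simp: good_def less_imp_le)
    also have "\<dots> \<le> C"
      using orthonormal_power_sup_upper[of F T p] that C by (simp add: good_def)
    finally show ?thesis .
  qed
  define k where "k = nat \<lceil>C / d powr p\<rceil>"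
  have "card F \<le> k" if "good F" for F
  proof -
    have "real (card F) \<le> C / d powr p"
      using card_le[OF that] d by (simp add: pos_le_divide_eq)
    then show ?thesis
      unfolding k_def by linarith
  qed
  moreover have "good {}"
    by (simp add: good_def orthonormal_def)
  ultimately obtain F where F: "good F" and max: "\<And>F'. good F' \<Longrightarrow> card F' \<le> card F"
    using ex_has_greatest_nat[of good "{}" card "Suc k"] by (auto simp: less_Suc_eq_le)
  show thesis
  proof
    fix y assume y: "y \<in> Y" "norm y = 1" "\<And>e. e \<in> F \<Longrightarrow> cinner e y = 0"
    show "norm (T y) \<le> d"
    proof (rule ccontr)
      assume "\<not> norm (T y) \<le> d"
      then have "good (insert y F)"
        using F y by (auto simp: good_def intro: orthonormal_insert)
      moreover have "y \<notin> F"
        using y(2) y(3)[of y] by (auto simp: cinner_self)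
      ultimately show False
        using max[of "insert y F"] F by (simp add: good_def)
    qed
  qed (use F in \<open>auto simp: good_def\<close>)
qed

lemma tendsto_scaleC_left:
  fixes e :: "'h::complex_hilbert_space"
  assumes "(g \<longlongrightarrow> l) F"
  shows "((\<lambda>n. g n *\<^sub>C e) \<longlongrightarrow> l *\<^sub>C e) F"
proof -
  have "(\<lambda>n. norm (g n *\<^sub>C e - l *\<^sub>C e)) = (\<lambda>n. cmod (g n - l) * norm e)"
    by (simp only: diff_conv_add_uminus scaleC_minus_left[symmetric] scaleC_add_left[symmetric] norm_scaleC)
  moreover have "((\<lambda>n. cmod (g n - l) * norm e) \<longlongrightarrow> cmod (l - l) * norm e) F"
    by (intro tendsto_intros assms)
  ultimately have "((\<lambda>n. norm (g n *\<^sub>C e - l *\<^sub>C e)) \<longlongrightarrow> 0) F"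
    by simp
  then show ?thesis
    by (rule LIM_zero_cancel[OF tendsto_norm_zero_cancel])
qed

text \<open>Let \<open>s\<close> be the supremum of \<open>norm (T x)\<close> over the unit vectors of \<open>Y\<close>. A maximizing sequence \<open>x n\<close>
  satisfies \<open>T\<^sup>* T x n - s\<^sup>2 x n \<longlonglongrightarrow> 0\<close>. After passing to a subsequence its component in the span of a
  dominating system converges, and on the complement \<open>s\<^sup>2 - T\<^sup>* T\<close> is bounded below by \<open>s\<^sup>2 / 2\<close>; so \<open>x
  n\<close> converges to an eigenvector.\<close>

lemma maximal_eigenvector_exists:
  fixes T :: "'h::complex_hilbert_space \<Rightarrow>\<^sub>L 'h"
  assumes T: "clinear_op T" and fin: "orthonormal_power_sup p T < \<infinity>" and p: "0 < p"
    and Y: "closed Y" "\<And>x y. x \<in> Y \<Longrightarrow> y \<in> Y \<Longrightarrow> x + y \<in> Y" "\<And>c x. x \<in> Y \<Longrightarrow> c *\<^sub>C x \<in> Y"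
    and inv: "\<And>x. x \<in> Y \<Longrightarrow> adjoint_op T (T x) \<in> Y"
    and nonzero: "y0 \<in> Y" "norm y0 = 1"
  obtains x where "x \<in> Y" "norm x = 1" "adjoint_op T (T x) = ((norm (T x))\<^sup>2) *\<^sub>R x"
proof -
  define H where "H = adjoint_op T o\<^sub>L T"
  have H: "selfadjoint_op H" "psd_op H"
    unfolding H_def by (rule adjoint_comp_selfadjoint_psd[OF T])+
  have HT: "inner x (H x) = (norm (T x))\<^sup>2" for x
    by (simp add: H_def inner_adjoint_comp[OF T])
  have invH: "H x \<in> Y" if "x \<in> Y" for x
    using inv[OF that] by (simp add: H_def)
  have YR: "r *\<^sub>R x \<in> Y" if "x \<in> Y" for r x
    using Y(3)[OF that] by (simp add: scaleR_eq_scaleC)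
  have Ydiff: "x - y \<in> Y" if "x \<in> Y" "y \<in> Y" for x y
    using Y(2)[OF that(1) YR[OF that(2), of "-1"]] by simp
  define \<S> where "\<S> = {x \<in> Y. norm x = 1}"
  have bdd: "bdd_above ((\<lambda>x. norm (T x)) ` \<S>)"
  proof (rule bdd_aboveI2)
    show "norm (T x) \<le> norm T" if "x \<in> \<S>" for x
      using norm_blinfun[of T x] that by (simp add: \<S>_def)
  qed
  define s where "s = (SUP x\<in>\<S>. norm (T x))"
  have "y0 \<in> \<S>"
    using nonzero by (simp add: \<S>_def)
  have upper: "norm (T x) \<le> s" if "x \<in> \<S>" for x
    unfolding s_def by (rule cSUP_upper[OF that bdd])
  have s0: "0 \<le> s"
    using upper[OF \<open>y0 \<in> \<S>\<close>] by (smt (verit) norm_ge_zero)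
  have Tle: "norm (T x) \<le> s * norm x" if "x \<in> Y" for x
  proof (cases "x = 0")
    case False
    then have "sgn x \<in> \<S>"
      using that YR by (simp add: \<S>_def norm_sgn sgn_div_norm)
    from upper[OF this] show ?thesis
      using False by (simp add: sgn_div_norm blinfun.scaleR_right field_simps)
  qed simp
  show thesis
  proof (cases "s = 0")
    case True
    then have "T y0 = 0"
      using Tle[OF nonzero(1)] by simp
    then show thesis
      using that[of y0] nonzero by simp
  next
    case False
    with s0 have s: "s > 0"
      by simp
    have Hle: "norm (H x) \<le> s\<^sup>2 * norm x" if "x \<in> Y" for x
    proof (cases "norm (H x) = 0")
      case nz: False
      have "(norm (H x))\<^sup>2 = inner (H x) (H x)"
        by (rule power2_norm_eq_inner)
      also have "\<dots> = inner (T (H x)) (T x)"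
        by (simp add: H_def inner_eq_Re_cinner cinner_adjoint[OF T, symmetric])
      also have "\<dots> \<le> norm (T (H x)) * norm (T x)"
        by (rule norm_cauchy_schwarz)
      also have "\<dots> \<le> (s * norm (H x)) * (s * norm x)"
        using s0 that invH by (intro mult_mono Tle) auto
      finally have "norm (H x) * norm (H x) \<le> (s\<^sup>2 * norm x) * norm (H x)"
        by (simp add: power2_eq_square mult_ac)
      then show ?thesis
        using nz by (simp add: mult_le_cancel_right)
    qed simp
    define S where "S = s\<^sup>2 *\<^sub>R id_blinfun - H"
    have S_apply: "S x = s\<^sup>2 *\<^sub>R x - H x" for x
      by (simp add: S_def blinfun.diff_left blinfun.scaleR_left)
    have S_small: "(norm (S x))\<^sup>2 \<le> 2 * s\<^sup>2 * (s\<^sup>2 - (norm (T x))\<^sup>2)" if "x \<in> \<S>" for x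
    proof -
      have x: "x \<in> Y" "norm x = 1" "inner x x = 1"
        using that by (auto simp: \<S>_def power2_norm_eq_inner[symmetric])
      have "(norm (H x))\<^sup>2 \<le> (s\<^sup>2)\<^sup>2"
        using Hle[OF x(1)] x(2) by (intro power_mono) auto
      moreover have "(norm (S x))\<^sup>2 = (s\<^sup>2)\<^sup>2 - 2 * s\<^sup>2 * inner x (H x) + (norm (H x))\<^sup>2"
        unfolding S_apply power2_norm_eq_inner
        by (simp add: inner_diff inner_commute[of "H x" x] x(3) power2_eq_square right_diff_distrib mult_ac)
      ultimately have "(norm (S x))\<^sup>2 \<le> 2 * (s\<^sup>2)\<^sup>2 - 2 * s\<^sup>2 * (norm (T x))\<^sup>2"
        by (simp add: HT)
      then show ?thesis
        by (simp add: power2_eq_square algebra_simps)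
    qed
    have "\<exists>x. x \<in> \<S> \<and> s - inverse (real (Suc n)) < norm (T x)" for n
      using less_cSUP_iff[OF _ bdd, of "s - inverse (real (Suc n))"] \<open>y0 \<in> \<S>\<close>
          by (auto simp: s_def[symmetric])
    then obtain x where x: "\<And>n. x n \<in> \<S>" and xs: "\<And>n. s - inverse (real (Suc n)) < norm (T (x n))"
      by metis
    have Tx: "(\<lambda>n. norm (T (x n))) \<longlonglongrightarrow> s"
    proof (rule tendsto_sandwich[OF _ _ _ tendsto_const])
      show "(\<lambda>n. s - inverse (real (Suc n))) \<longlonglongrightarrow> s"
        using tendsto_diff[OF tendsto_const LIMSEQ_inverse_real_of_nat, of s] by simp
    qed (use less_imp_le[OF xs] upper[OF x] in \<open>auto intro!: always_eventually\<close>)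
    have Sx: "(\<lambda>n. S (x n)) \<longlonglongrightarrow> 0"
    proof -
      have "(\<lambda>n. 2 * s\<^sup>2 * (s\<^sup>2 - (norm (T (x n)))\<^sup>2)) \<longlonglongrightarrow> 2 * s\<^sup>2 * (s\<^sup>2 - s\<^sup>2)"
        by (intro tendsto_intros Tx)
      then have lim: "(\<lambda>n. 2 * s\<^sup>2 * (s\<^sup>2 - (norm (T (x n)))\<^sup>2)) \<longlonglongrightarrow> 0"
        by simp
      have "(\<lambda>n. (norm (S (x n)))\<^sup>2) \<longlonglongrightarrow> 0"
        by (rule tendsto_sandwich[OF _ _ tendsto_const lim])
          (use S_small[OF x] in \<open>auto intro!: always_eventually\<close>)
      then have "(\<lambda>n. sqrt ((norm (S (x n)))\<^sup>2)) \<longlonglongrightarrow> sqrt 0"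
        by (rule tendsto_real_sqrt)
      then show ?thesis
        by (simp add: tendsto_norm_zero_iff)
    qed
    \<comment> \<open>With this \<open>d\<close>, \<open>T\<^sup>* T\<close> is at most \<open>s\<^sup>2 / 2\<close> on the complement of the dominating system.\<close>
    define d where "d = s / sqrt 2"
    have d: "d > 0" "d\<^sup>2 = s\<^sup>2 / 2"
      using s by (simp_all add: d_def power_divide)
    obtain F where F: "finite F" "orthonormal F" "F \<subseteq> Y"
      and dom: "\<And>y. y \<in> Y \<Longrightarrow> norm y = 1 \<Longrightarrow> (\<And>e. e \<in> F \<Longrightarrow> cinner e y = 0) \<Longrightarrow> norm (T y) \<le> d"
      using finite_dominating_system[OF fin p d(1)] by blast
    \<comment> \<open>The quadratic form of \<open>S\<close> is at least \<open>s\<^sup>2 / 2\<close> on the complement of \<open>F\<close>.\<close>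
    have coercive: "norm b \<le> 2 / s\<^sup>2 * norm (S b)" if b: "b \<in> Y" "\<And>e. e \<in> F \<Longrightarrow> cinner e b = 0" for b
    proof (cases "b = 0")
      case nz: False
      have "sgn b \<in> Y" "norm (sgn b) = 1"
        using b(1) YR nz by (simp_all add: norm_sgn sgn_div_norm)
      moreover have "cinner e (sgn b) = 0" if "e \<in> F" for e
        using b(2)[OF that] by (simp add: sgn_div_norm cinner_scaleR_right)
      ultimately have "norm (T (sgn b)) \<le> d"
        by (rule dom)
      then have "norm (T b) \<le> d * norm b"
        using nz by (simp add: sgn_div_norm blinfun.scaleR_right field_simps)
      then have "(norm (T b))\<^sup>2 \<le> (d * norm b)\<^sup>2"
        by (intro power_mono) auto
      then have "inner b (S b) \<ge> s\<^sup>2 / 2 * (norm b)\<^sup>2"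
        by (simp add: S_apply inner_diff_right HT power2_norm_eq_inner power_mult_distrib d(2) mult.commute)
      also have "inner b (S b) \<le> norm b * norm (S b)"
        by (rule norm_cauchy_schwarz)
      finally have "s\<^sup>2 / 2 * norm b \<le> norm (S b)"
        using nz by (simp add: power2_eq_square)
      then show ?thesis
        using s by (simp add: field_simps)
    qed simp
    have "bounded (range (\<lambda>n. cinner e (x n)))" if "e \<in> F" for e
    proof -
      have "cmod (cinner e (x n)) \<le> 1" for n
        using cmod_cinner_le[of e "x n"] x[of n] orthonormal_norm[OF F(2) that] by (simp add: \<S>_def)
      then show ?thesis
        by (auto intro!: boundedI)
    qed
    then obtain r where r: "strict_mono (r :: nat \<Rightarrow> nat)"
      and conv: "\<And>e. e \<in> F \<Longrightarrow> convergent (\<lambda>n. cinner e (x (r n)))"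
      using simultaneous_convergent_subsequence[OF F(1), of "\<lambda>n e. cinner e (x n)"] by auto
    obtain c where c: "\<And>e. e \<in> F \<Longrightarrow> (\<lambda>n. cinner e (x (r n))) \<longlonglongrightarrow> c e"
      using conv unfolding convergent_def by metis
    define a where "a n = (\<Sum>e\<in>F. cinner e (x (r n)) *\<^sub>C e)" for n
    define b where "b n = x (r n) - a n" for n
    have a_lim: "a \<longlonglongrightarrow> (\<Sum>e\<in>F. c e *\<^sub>C e)"
      unfolding a_def by (intro tendsto_sum tendsto_scaleC_left c)
    have aY: "a n \<in> Y" for n
    proof -
      have "0 \<in> Y"
        using YR[OF nonzero(1), of 0] by simp
      have "(\<Sum>e\<in>F'. cinner e (x (r n)) *\<^sub>C e) \<in> Y" if "finite F'" "F' \<subseteq> Y" for F'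
        using that \<open>0 \<in> Y\<close> by (induction rule: finite_induct) (auto intro: Y)
      then show ?thesis
        unfolding a_def using F by blast
    qed
    have bY: "b n \<in> Y" for n
      unfolding b_def using x aY by (auto intro!: Ydiff simp: \<S>_def)
    have borth: "cinner e (b n) = 0" if "e \<in> F" for e n
      using cinner_orthonormal_combination[OF F(2,1) that] by (simp add: b_def a_def cinner.diff_right)
    have "(\<lambda>n. S (x (r n)) - S (a n)) \<longlonglongrightarrow> 0 - S (\<Sum>e\<in>F. c e *\<^sub>C e)"
      by (intro tendsto_diff blinfun.tendsto tendsto_const a_lim LIMSEQ_subseq_LIMSEQ[OF Sx r,
          unfolded o_def])
    then have "Cauchy (\<lambda>n. S (b n))"
      unfolding b_def by (intro LIMSEQ_imp_Cauchy) (simp add: blinfun.diff_right)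
    have "Cauchy b"
    proof (rule metric_CauchyI)
      fix \<epsilon> :: real assume "\<epsilon> > 0"
      then obtain N where N: "\<And>i j. i \<ge> N \<Longrightarrow> j \<ge> N \<Longrightarrow> dist (S (b i)) (S (b j)) < \<epsilon> * (s\<^sup>2 / 2)"
        using metric_CauchyD[OF \<open>Cauchy (\<lambda>n. S (b n))\<close>, of "\<epsilon> * (s\<^sup>2 / 2)"] s by auto
      have "dist (b i) (b j) < \<epsilon>" if "i \<ge> N" "j \<ge> N" for i j
      proof -
        have "norm (b i - b j) \<le> 2 / s\<^sup>2 * norm (S (b i - b j))"
          using borth by (intro coercive Ydiff bY) (simp add: cinner.diff_right)
        also have "\<dots> < 2 / s\<^sup>2 * (\<epsilon> * (s\<^sup>2 / 2))"
          using N[OF that] s by (intro mult_strict_left_mono) (simp_all add: blinfun.diff_right dist_norm)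
        finally show ?thesis
          using s by (simp add: dist_norm)
      qed
      then show "\<exists>N. \<forall>i\<ge>N. \<forall>j\<ge>N. dist (b i) (b j) < \<epsilon>"
        by blast
    qed
    then obtain v where "b \<longlonglongrightarrow> v"
      using Cauchy_convergent convergent_def by blast
    then have "(\<lambda>n. a n + b n) \<longlonglongrightarrow> (\<Sum>e\<in>F. c e *\<^sub>C e) + v"
      using a_lim by (intro tendsto_add)
    then obtain z where z: "(\<lambda>n. x (r n)) \<longlonglongrightarrow> z"
      by (auto simp: b_def)
    have "z \<in> Y"
      using closed_sequentially[OF Y(1) _ z] x by (simp add: \<S>_def)
    have "norm z = 1"
      using tendsto_norm[OF z] x by (simp add: \<S>_def LIMSEQ_const_iff)
    have "(\<lambda>n. S (x (r n))) \<longlonglongrightarrow> S z"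
      by (intro blinfun.tendsto tendsto_const z)
    then have "S z = 0"
      using LIMSEQ_subseq_LIMSEQ[OF Sx r, unfolded o_def] by (rule LIMSEQ_unique)
    then have ev: "H z = s\<^sup>2 *\<^sub>R z"
      by (simp add: S_apply)
    have "(norm (T z))\<^sup>2 = s\<^sup>2"
      using \<open>norm z = 1\<close> by (simp add: HT[symmetric] ev power2_norm_eq_inner[symmetric])
    with ev have "adjoint_op T (T z) = ((norm (T z))\<^sup>2) *\<^sub>R z"
      by (simp add: H_def)
    then show thesis
      using that \<open>z \<in> Y\<close> \<open>norm z = 1\<close> by blast
  qed
qed

text \<open>A maximal orthonormal set of eigenvectors is a basis: otherwise its orthogonal complement, which
  is invariant, would contain another eigenvector.\<close>

lemma eigenbasis_exists:
  fixes T :: "'h::complex_hilbert_space \<Rightarrow>\<^sub>L 'h"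
  assumes T: "clinear_op T" and fin: "orthonormal_power_sup p T < \<infinity>" and p: "0 < p"
  obtains E where "is_onb E" "\<And>e. e \<in> E \<Longrightarrow> adjoint_op T (T e) = ((norm (T e))\<^sup>2) *\<^sub>R e"
proof -
  define Q where "Q = {e. adjoint_op T (T e) = ((norm (T e))\<^sup>2) *\<^sub>R e}"
  obtain E where E: "orthonormal E" "E \<subseteq> Q" and max: "\<And>x. x \<in> Q \<Longrightarrow> norm x = 1 \<Longrightarrow> \<exists>e\<in>E. cinner e x \<noteq> 0"
    using maximal_orthonormal_subset by blast
  define Y where "Y = {y. \<forall>e\<in>E. cinner e y = 0}"
  have "is_onb E"
  proof (rule is_onbI[OF E(1)], rule ccontr)
    fix y assume y: "norm y = 1" "\<not> (\<exists>e\<in>E. cinner e y \<noteq> 0)"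
    have "Y = (\<Inter>e\<in>E. {y. cinner e y = 0})"
      by (auto simp: Y_def)
    moreover have "closed {y. cinner e y = 0}" for e :: 'h
      by (intro closed_Collect_eq continuous_on_const
          linear_continuous_on[OF cinner.bounded_linear_right])
    ultimately have "closed Y"
      by auto
    have inv: "adjoint_op T (T x) \<in> Y" if "x \<in> Y" for x
    proof -
      have "cinner e (adjoint_op T (T x)) = 0" if "e \<in> E" for e
      proof -
        have "cinner e (adjoint_op T (T x)) = cinner (adjoint_op T (T e)) x"
          using adjoint_comp_selfadjoint_psd(1)[OF T] by (simp add: selfadjoint_op_def)
        also have "adjoint_op T (T e) = ((norm (T e))\<^sup>2) *\<^sub>R e"
          using E(2) that by (auto simp: Q_def)
        finally show ?thesis
          using \<open>x \<in> Y\<close> that by (simp add: Y_def cinner_scaleR_left)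
      qed
      then show ?thesis
        by (simp add: Y_def)
    qed
    have "y \<in> Y"
      using y by (simp add: Y_def)
    obtain x where "x \<in> Y" "norm x = 1" "adjoint_op T (T x) = ((norm (T x))\<^sup>2) *\<^sub>R x"
      by (rule maximal_eigenvector_exists[OF T fin p \<open>closed Y\<close> _ _ inv \<open>y \<in> Y\<close> y(1)])
        (auto simp: Y_def cinner_add_right cinner_scaleC_right)
    then show False
      using max[of x] by (auto simp: Q_def Y_def)
  qed
  then show thesis
    using that E(2) by (auto simp: Q_def)
qed

text \<open>One inequality is Jensen's. For the other, the finite parts of an eigenbasis of \<open>T\<^sup>* T\<close> compete in
  the supremum, and there \<open>|T|\<^sup>p\<close> maps \<open>e\<close> to \<open>norm (T e) powr p\<close> times \<open>e\<close>.\<close>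

theorem trace_powr_abs_eq_sup:
  fixes T :: "'h::complex_hilbert_space \<Rightarrow>\<^sub>L 'h"
  assumes T: "clinear_op T" and p: "2 \<le> p"
  shows "trace_pos (powr_op (abs_op T) p) = orthonormal_power_sup p T"
proof (rule antisym)
  show "trace_pos (powr_op (abs_op T) p) \<le> orthonormal_power_sup p T"
  proof (cases "orthonormal_power_sup p T < \<infinity>")
    case True
    obtain E where E: "is_onb E" and ev: "\<And>e. e \<in> E \<Longrightarrow> adjoint_op T (T e) = ((norm (T e))\<^sup>2) *\<^sub>R e"
      using eigenbasis_exists[OF T True] p by auto
    note H = adjoint_comp_selfadjoint_psd[OF T] and R = abs_op_properties[OF T]
    define W where "W = powr_op (abs_op T) (p / 2)"
    have W: "selfadjoint_op W" "W o\<^sub>L W = powr_op (abs_op T) p"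
      unfolding W_def using p by (auto intro!: powr_op_half_square powr_op_selfadjoint_psd R)
    have We: "(norm (W e))\<^sup>2 = norm (T e) powr p" if "e \<in> E" for e
    proof -
      have e: "norm e = 1"
        using orthonormal_norm[OF is_onb_orthonormal[OF E] that] .
      have "abs_op T e = ((norm (T e))\<^sup>2 powr (1/2)) *\<^sub>R e"
        unfolding abs_op_def using ev[OF that] e by (intro powr_op_eigenvector[OF H]) auto
      also have "(norm (T e))\<^sup>2 powr (1/2) = norm (T e)"
        by (simp add: powr_half_sqrt)
      finally have "W e = (norm (T e) powr (p / 2)) *\<^sub>R e"
        unfolding W_def using e p by (intro powr_op_eigenvector[OF R(1,2)]) auto
      then show ?thesis
        using e by (simp add: power2_eq_square powr_add[symmetric])
    qed
    have "trace_pos (powr_op (abs_op T) p) = (\<Sum>\<^sub>\<infinity>e\<in>E. ennreal ((norm (W e))\<^sup>2))"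
      unfolding W(2)[symmetric] by (rule trace_pos_square[OF W(1) E])
    also have "\<dots> \<le> orthonormal_power_sup p T"
    proof (rule infsum_ennreal_leI)
      fix F assume F: "finite F" "F \<subseteq> E"
      then have "(\<Sum>e\<in>F. ennreal ((norm (W e))\<^sup>2)) = ennreal (\<Sum>e\<in>F. norm (T e) powr p)"
        using We by (subst sum_ennreal) (auto intro!: sum.cong arg_cong[of _ _ ennreal])
      also have "\<dots> \<le> orthonormal_power_sup p T"
        using F E by (intro orthonormal_power_sup_upper) (auto intro: orthonormal_subset is_onb_orthonormal)
      finally show "(\<Sum>e\<in>F. ennreal ((norm (W e))\<^sup>2)) \<le> orthonormal_power_sup p T" .
    qed
    finally show ?thesis .
  qed (simp add: not_less top_unique)
qed (rule orthonormal_power_sup_le_trace[OF T p])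

section \<open>The Schatten classes are Banach spaces\<close>

text \<open>Bernoulli's inequality gives the supporting line of \<open>w \<mapsto> w powr p\<close> at the mean \<open>m\<close>.\<close>

lemma powr_convex_nonneg:
  fixes u v t p :: real
  assumes "1 \<le> p" "0 \<le> u" "0 \<le> v" "0 \<le> t" "t \<le> 1"
  shows "(t * u + (1 - t) * v) powr p \<le> t * u powr p + (1 - t) * v powr p"
proof -
  define m where "m = t * u + (1 - t) * v"
  have "0 \<le> m"
    using assms by (simp add: m_def)
  show ?thesis
  proof (cases "m = 0")
    case False
    with \<open>0 \<le> m\<close> have m: "m > 0"
      by simp
    have tangent: "m powr p * (1 + p * (w / m - 1)) \<le> w powr p" if "0 \<le> w" for w
    proof -
      have "m powr p * (1 + p * (w / m - 1)) \<le> m powr p * (w / m) powr p"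
        using m that assms(1) by (intro mult_left_mono bernoulli_powr) auto
      also have "\<dots> = w powr p"
        using m that by (simp add: powr_divide)
      finally show ?thesis .
    qed
    have affine: "t * (c * (1 + p * (x - 1))) + (1 - t) * (c * (1 + p * (y - 1)))
        = c * (1 + p * ((t * x + (1 - t) * y) - 1))" for c x y
      by (simp add: algebra_simps)
    have "t * (u / m) + (1 - t) * (v / m) = 1"
      using m by (simp add: m_def add_divide_distrib[symmetric])
    then have "m powr p = t * (m powr p * (1 + p * (u / m - 1))) + (1 - t) * (m powr p * (1
        + p * (v / m - 1)))"
      by (simp only: affine) simp
    also have "\<dots> \<le> t * u powr p + (1 - t) * v powr p"
      using assms by (intro add_mono mult_left_mono tangent) auto
    finally show ?thesis
      by (simp add: m_def)
  qed (use assms in \<open>simp add: m_def\<close>)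
qed

text \<open>Divided by \<open>A + B\<close>, the summand \<open>a i + b i\<close> is a convex combination of \<open>a i / A\<close> and \<open>b i / B\<close>.\<close>

lemma minkowski_powr:
  fixes a b :: "'a \<Rightarrow> real"
  assumes p: "1 \<le> p" and F: "finite F" and nonneg: "\<And>i. 0 \<le> a i" "\<And>i. 0 \<le> b i" "0 \<le> A" "0 \<le> B"
    and A: "(\<Sum>i\<in>F. a i powr p) \<le> A powr p" and B: "(\<Sum>i\<in>F. b i powr p) \<le> B powr p"
  shows "(\<Sum>i\<in>F. (a i + b i) powr p) \<le> (A + B) powr p"
proof -
  have zero: "\<forall>i\<in>F. f i = 0" if "(\<Sum>i\<in>F. f i powr p) \<le> 0 powr p" for f :: "'a \<Rightarrow> real"
  proof -
    have "(\<Sum>i\<in>F. f i powr p) = 0"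
      using that by (intro antisym sum_nonneg) auto
    then show ?thesis
      using F by (simp add: sum_nonneg_eq_0_iff)
  qed
  show ?thesis
  proof (cases "A = 0 \<or> B = 0")
    case True
    then show ?thesis
    proof
      assume "A = 0"
      then show ?thesis
        using zero[of a] A B by simp
    next
      assume "B = 0"
      then show ?thesis
        using zero[of b] A B by simp
    qed
  next
    case False
    then have pos: "A > 0" "B > 0"
      using nonneg by auto
    define t where "t = A / (A + B)"
    have t: "0 \<le> t" "t \<le> 1" "1 - t = B / (A + B)"
      using pos by (auto simp: t_def field_simps)
    have "(\<Sum>i\<in>F. (a i + b i) powr p) = (\<Sum>i\<in>F. (A + B) powr p * (t * (a i / A)
        + (1 - t) * (b i / B)) powr p)"
    proof (rule sum.cong)
      fix i
      have "t * (a i / A) = a i / (A + B)" "(1 - t) * (b i / B) = b i / (A + B)"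
        using pos unfolding t(3) by (simp_all add: t_def)
      then have "a i + b i = (A + B) * (t * (a i / A) + (1 - t) * (b i / B))"
        using pos by (simp add: add_divide_distrib[symmetric])
      then show "(a i + b i) powr p = (A + B) powr p * (t * (a i / A) + (1 - t) * (b i / B)) powr p"
        using pos nonneg t by (simp add: powr_mult)
    qed simp
    also have "\<dots> \<le> (\<Sum>i\<in>F. (A + B) powr p * (t * (a i / A) powr p + (1 - t) * (b i / B) powr p))"
      using p nonneg pos t by (intro sum_mono mult_left_mono powr_convex_nonneg) auto
    also have "\<dots> = (A + B) powr p * (t * ((\<Sum>i\<in>F. a i powr p) / A powr p)
        + (1 - t) * ((\<Sum>i\<in>F. b i powr p) / B powr p))"
      using pos nonneg by (simp add: powr_divide sum_distrib_left sum.distrib sum_divide_distrib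
          distrib_left)
    also have "\<dots> \<le> (A + B) powr p * (t * 1 + (1 - t) * 1)"
      using pos A B t by (intro mult_left_mono add_mono) auto
    finally show ?thesis
      by simp
  qed
qed

lemma scaleC_op_apply: "scaleC_op c T x = c *\<^sub>C T x"
  by (simp add: scaleC_op.rep_eq)

lemma scaleR_eq_scaleC_op: "r *\<^sub>R T = scaleC_op (complex_of_real r) T"
  by (rule blinfun_eqI) (simp add: scaleC_op_apply blinfun.scaleR_left scaleR_eq_scaleC)

lemma uminus_eq_scaleC_op: "- T = scaleC_op (- 1) T"
  by (rule blinfun_eqI) (simp add: scaleC_op_apply blinfun.minus_left scaleC_minus_left)

lemma clinear_op_0: "clinear_op 0"
  by (simp add: clinear_op_def)

lemma clinear_op_add: "clinear_op S \<Longrightarrow> clinear_op T \<Longrightarrow> clinear_op (S + T)"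
  by (simp add: clinear_op_def blinfun.add_left scaleC_add_right)

lemma clinear_op_scaleC_op: "clinear_op T \<Longrightarrow> clinear_op (scaleC_op c T)"
  by (simp add: clinear_op_def scaleC_op_apply scaleC_scaleC mult.commute)

lemma clinear_op_limit:
  assumes "\<And>n. clinear_op (T n)" "T \<longlonglongrightarrow> S"
  shows "clinear_op S"
  unfolding clinear_op_def
proof (intro allI)
  fix c x
  have "(\<lambda>n. T n (c *\<^sub>C x)) \<longlonglongrightarrow> S (c *\<^sub>C x)"
    by (intro blinfun.tendsto assms(2) tendsto_const)
  moreover have "(\<lambda>n. c *\<^sub>C T n x) \<longlonglongrightarrow> c *\<^sub>C S x"
    by (intro bounded_linear.tendsto[OF bounded_linear_scaleC] blinfun.tendsto assms(2) tendsto_const)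
  ultimately show "S (c *\<^sub>C x) = c *\<^sub>C S x"
    using LIMSEQ_unique by (simp add: clinear_op_scaleC[OF assms(1)])
qed

context
  fixes p :: real
  assumes p: "2 \<le> p"
begin

lemma schatten_norm_nonneg: "0 \<le> schatten_norm p T"
  by (simp add: schatten_norm_def)

lemma schatten_class_iff: "T \<in> schatten_class p \<longleftrightarrow> clinear_op T \<and> orthonormal_power_sup p T < \<infinity>"
  by (auto simp: schatten_class_def trace_powr_abs_eq_sup[OF _ p])

lemma schatten_class_clinear: "T \<in> schatten_class p \<Longrightarrow> clinear_op T"
  by (simp add: schatten_class_def)

lemma schatten_norm_powr:
  "T \<in> schatten_class p \<Longrightarrow> orthonormal_power_sup p T = ennreal (schatten_norm p T powr p)"
  using p by (simp add: schatten_class_iff schatten_norm_def trace_powr_abs_eq_sup[OF _ p] powr_powr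
      less_top)

lemma orthonormal_sum_le_schatten_norm:
  assumes "T \<in> schatten_class p" "finite F" "orthonormal F"
  shows "(\<Sum>e\<in>F. norm (T e) powr p) \<le> schatten_norm p T powr p"
  using orthonormal_power_sup_upper[OF assms(2,3), of T p] schatten_norm_powr[OF assms(1)] by simp

text \<open>Together with the previous lemma this characterizes the Schatten norm by finite orthonormal
  systems; the norm axioms are then those of \<open>\<ell>\<^sup>p\<close>.\<close>

lemma schatten_class_normI:
  assumes T: "clinear_op T" and C: "0 \<le> C"
    and le: "\<And>F. finite F \<Longrightarrow> orthonormal F \<Longrightarrow> (\<Sum>e\<in>F. norm (T e) powr p) \<le> C powr p"
  shows "T \<in> schatten_class p" "schatten_norm p T \<le> C"
proof -
  have *: "orthonormal_power_sup p T \<le> ennreal (C powr p)"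
    unfolding orthonormal_power_sup_def using le by (auto intro!: SUP_least ennreal_leI)
  then have "orthonormal_power_sup p T < \<infinity>"
    using le_less_trans by fastforce
  then show cls: "T \<in> schatten_class p"
    using T by (simp add: schatten_class_iff)
  then have "schatten_norm p T powr p \<le> C powr p"
    using * by (simp add: schatten_norm_powr)
  then show "schatten_norm p T \<le> C"
    using p C by (meson not_le powr_less_mono2 less_le_trans zero_less_numeral)
qed

lemma norm_le_schatten_norm:
  assumes "T \<in> schatten_class p"
  shows "norm T \<le> schatten_norm p T"
proof (rule norm_blinfun_bound[OF schatten_norm_nonneg])
  fix x
  show "norm (T x) \<le> schatten_norm p T * norm x"
  proof (cases "x = 0")
    case False
    then have "orthonormal {sgn x}"
      by (simp add: orthonormal_def cinner_self norm_sgn)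
    then have "norm (T (sgn x)) powr p \<le> schatten_norm p T powr p"
      using orthonormal_sum_le_schatten_norm[OF assms, of "{sgn x}"] by simp
    then have "norm (T (sgn x)) \<le> schatten_norm p T"
      using p schatten_norm_nonneg[of T] by (meson not_le powr_less_mono2 less_le_trans zero_less_numeral)
    then show ?thesis
      using False by (simp add: sgn_div_norm blinfun.scaleR_right field_simps)
  qed simp
qed

lemma schatten_norm_eq_0: "T \<in> schatten_class p \<Longrightarrow> schatten_norm p T = 0 \<Longrightarrow> T = 0"
  using norm_le_schatten_norm[of T] by simp

lemma schatten_class_0: "0 \<in> schatten_class p" and schatten_norm_0 [simp]: "schatten_norm p 0 = 0"
proof -
  show "0 \<in> schatten_class p"
    using p by (auto intro!: schatten_class_normI[of _ 0] clinear_op_0)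
  have "schatten_norm p 0 \<le> 0"
    using p by (auto intro!: schatten_class_normI clinear_op_0)
  then show "schatten_norm p 0 = 0"
    by (intro antisym schatten_norm_nonneg)
qed

lemma schatten_class_add: "S \<in> schatten_class p \<Longrightarrow> T \<in> schatten_class p \<Longrightarrow> S + T \<in> schatten_class p"
  and schatten_norm_triangle: "S \<in> schatten_class p \<Longrightarrow> T \<in> schatten_class p \<Longrightarrow>
    schatten_norm p (S + T) \<le> schatten_norm p S + schatten_norm p T"
proof -
  assume ST: "S \<in> schatten_class p" "T \<in> schatten_class p"
  have *: "(\<Sum>e\<in>F. norm ((S + T) e) powr p) \<le> (schatten_norm p S + schatten_norm p T) powr p"
    if F: "finite F" "orthonormal F" for F
  proof -
    have "(\<Sum>e\<in>F. norm ((S + T) e) powr p) \<le> (\<Sum>e\<in>F. (norm (S e) + norm (T e)) powr p)"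
      using p by (intro sum_mono powr_mono2) (auto simp: blinfun.add_left norm_triangle_ineq)
    also have "\<dots> \<le> (schatten_norm p S + schatten_norm p T) powr p"
      using p ST F by (intro minkowski_powr orthonormal_sum_le_schatten_norm schatten_norm_nonneg) auto
    finally show ?thesis .
  qed
  show "S + T \<in> schatten_class p" "schatten_norm p (S + T) \<le> schatten_norm p S + schatten_norm p T"
    using schatten_class_normI[OF clinear_op_add[OF schatten_class_clinear schatten_class_clinear]
        add_nonneg_nonneg[OF schatten_norm_nonneg schatten_norm_nonneg] *] ST by blast+
qed

lemma schatten_class_scaleC: "T \<in> schatten_class p \<Longrightarrow> scaleC_op c T \<in> schatten_class p"
  and schatten_norm_scaleC_le: "T \<in> schatten_class p \<Longrightarrow> schatten_norm p (scaleC_op c T)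
      \<le> cmod c * schatten_norm p T"
proof -
  assume T: "T \<in> schatten_class p"
  have *: "(\<Sum>e\<in>F. norm (scaleC_op c T e) powr p) \<le> (cmod c * schatten_norm p T) powr p"
    if F: "finite F" "orthonormal F" for F
    using mult_left_mono[OF orthonormal_sum_le_schatten_norm[OF T F], of "cmod c powr p"]
    by (simp add: scaleC_op_apply norm_scaleC powr_mult schatten_norm_nonneg sum_distrib_left)
  show "scaleC_op c T \<in> schatten_class p" "schatten_norm p (scaleC_op c T) \<le> cmod c * schatten_norm p T"
    using schatten_class_normI[OF clinear_op_scaleC_op[OF schatten_class_clinear]
        mult_nonneg_nonneg[OF norm_ge_zero schatten_norm_nonneg] *] T by blast+
qed

lemma schatten_class_scaleR: "T \<in> schatten_class p \<Longrightarrow> r *\<^sub>R T \<in> schatten_class p"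
  unfolding scaleR_eq_scaleC_op by (rule schatten_class_scaleC)

lemma schatten_norm_scaleR_le: "T \<in> schatten_class p \<Longrightarrow> schatten_norm p (r *\<^sub>R T) \<le> \<bar>r\<bar> * schatten_norm p T"
  unfolding scaleR_eq_scaleC_op using schatten_norm_scaleC_le[of T "complex_of_real r"] by simp

lemma schatten_class_minus: "T \<in> schatten_class p \<Longrightarrow> - T \<in> schatten_class p"
  unfolding uminus_eq_scaleC_op by (rule schatten_class_scaleC)

lemma schatten_norm_minus: "T \<in> schatten_class p \<Longrightarrow> schatten_norm p (- T) = schatten_norm p T"
  using schatten_norm_scaleR_le[of T "-1"] schatten_norm_scaleR_le[of "- T" "-1"] schatten_class_minus[of T]
  by simp

lemma schatten_class_diff: "S \<in> schatten_class p \<Longrightarrow> T \<in> schatten_class p \<Longrightarrow> S - T \<in> schatten_class p"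
  using schatten_class_add[of S "- T"] schatten_class_minus[of T] by simp

lemma schatten_norm_diff_le:
  "S \<in> schatten_class p \<Longrightarrow> T \<in> schatten_class p \<Longrightarrow>
    schatten_norm p (S - T) \<le> schatten_norm p S + schatten_norm p T"
  using schatten_norm_triangle[of S "- T"] schatten_class_minus[of T] schatten_norm_minus[of T] by simp

lemma schatten_norm_minus_commute:
  "S \<in> schatten_class p \<Longrightarrow> T \<in> schatten_class p \<Longrightarrow> schatten_norm p (S - T) = schatten_norm p (T - S)"
  using schatten_norm_minus[OF schatten_class_diff[of S T]] by simp

lemma schatten_norm_triangle_diff:
  assumes "R \<in> schatten_class p" "S \<in> schatten_class p" "T \<in> schatten_class p"
  shows "schatten_norm p (R - T) \<le> schatten_norm p (R - S) + schatten_norm p (S - T)"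
  using schatten_norm_triangle[OF schatten_class_diff[of R S] schatten_class_diff[of S T]] assms by simp

lemma schatten_norm_reverse_triangle:
  assumes "S \<in> schatten_class p" "T \<in> schatten_class p"
  shows "\<bar>schatten_norm p S - schatten_norm p T\<bar> \<le> schatten_norm p (S - T)"
  using schatten_norm_triangle[OF schatten_class_diff[of S T] assms(2)]
    schatten_norm_triangle[OF schatten_class_diff[of T S] assms(1)]
    schatten_norm_minus_commute[OF assms] assms by simp

lemma schatten_class_sum: "(\<And>i. i \<in> I \<Longrightarrow> T i \<in> schatten_class p) \<Longrightarrow> (\<Sum>i\<in>I. T i) \<in> schatten_class p"
  by (induction I rule: infinite_finite_induct) (auto intro: schatten_class_add schatten_class_0)

lemma schatten_norm_sum_le:
  "(\<And>i. i \<in> I \<Longrightarrow> T i \<in> schatten_class p) \<Longrightarrow> schatten_norm p (\<Sum>i\<in>I. T i) \<le> (\<Sum>i\<in>I. schatten_norm p (T i))"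
proof (induction I rule: infinite_finite_induct)
  case (insert i I)
  then show ?case
    using schatten_norm_triangle[of "T i" "sum T I"] schatten_class_sum[of I T] by fastforce
qed auto

text \<open>Each finite sum \<open>\<Sum>e\<in>F. norm (T e) powr p\<close> is continuous in \<open>T\<close> for the operator norm.\<close>

lemma schatten_norm_lower_semicontinuous:
  assumes T: "\<And>n. T n \<in> schatten_class p" and lim: "T \<longlonglongrightarrow> S"
    and le: "\<forall>\<^sub>F n in sequentially. schatten_norm p (T n) \<le> C"
  shows "S \<in> schatten_class p" "schatten_norm p S \<le> C"
proof -
  obtain n0 where "schatten_norm p (T n0) \<le> C"
    using le unfolding eventually_sequentially by blast
  then have C: "0 \<le> C"
    using schatten_norm_nonneg order_trans by blast
  have *: "(\<Sum>e\<in>F. norm (S e) powr p) \<le> C powr p" if F: "finite F" "orthonormal F" for F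
  proof (rule tendsto_upperbound)
    have "(\<lambda>n. norm (T n e) powr p) \<longlonglongrightarrow> norm (S e) powr p" for e
      using p by (intro tendsto_powr' tendsto_norm blinfun.tendsto lim tendsto_const) auto
    then show "(\<lambda>n. \<Sum>e\<in>F. norm (T n e) powr p) \<longlonglongrightarrow> (\<Sum>e\<in>F. norm (S e) powr p)"
      by (intro tendsto_sum)
    show "\<forall>\<^sub>F n in sequentially. (\<Sum>e\<in>F. norm (T n e) powr p) \<le> C powr p"
      using le
    proof eventually_elim
      case (elim n)
      have "(\<Sum>e\<in>F. norm (T n e) powr p) \<le> schatten_norm p (T n) powr p"
        using orthonormal_sum_le_schatten_norm[OF T F] .
      also have "\<dots> \<le> C powr p"
        using elim p by (intro powr_mono2 schatten_norm_nonneg) auto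
      finally show ?case .
    qed
  qed simp
  have "clinear_op S"
    using clinear_op_limit[OF _ lim] T schatten_class_clinear by blast
  then show "S \<in> schatten_class p" "schatten_norm p S \<le> C"
    using schatten_class_normI[OF _ C *] by blast+
qed

text \<open>A Cauchy sequence converges in the operator norm, and lower semicontinuity bounds the distance to
  the limit by the Cauchy estimates.\<close>

lemma schatten_class_complete:
  assumes T: "\<And>n. T n \<in> schatten_class p"
    and Cauchy: "\<And>\<epsilon>. \<epsilon> > 0 \<Longrightarrow> \<exists>N. \<forall>m\<ge>N. \<forall>n\<ge>N. schatten_norm p (T m - T n) < \<epsilon>"
  obtains S where "S \<in> schatten_class p" "(\<lambda>n. schatten_norm p (T n - S)) \<longlonglongrightarrow> 0"
proof -
  have "Cauchy T"
  proof (rule metric_CauchyI)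
    fix \<epsilon> :: real assume "\<epsilon> > 0"
    then obtain N where "\<forall>m\<ge>N. \<forall>n\<ge>N. schatten_norm p (T m - T n) < \<epsilon>"
      using Cauchy by blast
    then show "\<exists>N. \<forall>m\<ge>N. \<forall>n\<ge>N. dist (T m) (T n) < \<epsilon>"
      using norm_le_schatten_norm[OF schatten_class_diff[OF T T]] by (metis dist_norm le_less_trans)
  qed
  then obtain S where S: "T \<longlonglongrightarrow> S"
    using Cauchy_convergent convergent_def by blast
  have tail: "\<exists>N. \<forall>m\<ge>N. T m - S \<in> schatten_class p \<and> schatten_norm p (T m - S) \<le> \<epsilon>" if \<epsilon>: "\<epsilon> > 0" for \<epsilon>
  proof -
    obtain N where N: "\<And>m n. m \<ge> N \<Longrightarrow> n \<ge> N \<Longrightarrow> schatten_norm p (T m - T n) < \<epsilon>"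
      using Cauchy[OF \<epsilon>] by blast
    have "T m - S \<in> schatten_class p \<and> schatten_norm p (T m - S) \<le> \<epsilon>" if "m \<ge> N" for m
    proof (intro conjI)
      have lim: "(\<lambda>n. T m - T n) \<longlonglongrightarrow> T m - S"
        by (intro tendsto_intros S)
      have ev: "\<forall>\<^sub>F n in sequentially. schatten_norm p (T m - T n) \<le> \<epsilon>"
        using eventually_ge_at_top[of N] by eventually_elim (rule less_imp_le[OF N[OF that]])
      show "T m - S \<in> schatten_class p" "schatten_norm p (T m - S) \<le> \<epsilon>"
        using schatten_norm_lower_semicontinuous[OF schatten_class_diff[OF T T] lim ev] by auto
    qed
    then show ?thesis
      by blast
  qed
  obtain N where "T N - S \<in> schatten_class p"
    using tail[of 1] by auto
  then have "T N - (T N - S) \<in> schatten_class p"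
    by (rule schatten_class_diff[OF T])
  then have "S \<in> schatten_class p"
    by simp
  moreover have "(\<lambda>n. schatten_norm p (T n - S)) \<longlonglongrightarrow> 0"
  proof (rule LIMSEQ_I)
    fix \<epsilon> :: real assume "\<epsilon> > 0"
    then obtain N where "\<forall>m\<ge>N. schatten_norm p (T m - S) \<le> \<epsilon> / 2"
      using tail[of "\<epsilon> / 2"] by auto
    then have "norm (schatten_norm p (T n - S) - 0) < \<epsilon>" if "n \<ge> N" for n
      using that \<open>\<epsilon> > 0\<close> schatten_norm_nonneg[of "T n - S"] by force
    then show "\<exists>N. \<forall>n\<ge>N. norm (schatten_norm p (T n - S) - 0) < \<epsilon>"
      by blast
  qed
  ultimately show thesis
    by (rule that)
qed

end

section \<open>Bochner integrals in Schatten classes\<close>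

lemma scaleC_diff_left: "(a - b) *\<^sub>C x = a *\<^sub>C x - b *\<^sub>C (x :: 'h::complex_hilbert_space)"
  by (simp only: diff_conv_add_uminus scaleC_add_left scaleC_minus_left)

lemma scaleC_diff_right: "a *\<^sub>C (x - y) = a *\<^sub>C x - a *\<^sub>C (y :: 'h::complex_hilbert_space)"
  by (rule linear_diff[OF bounded_linear.linear[OF bounded_linear_scaleC]])

lemma simple_bochner_integrable_finite_measure:
  "finite_measure M \<Longrightarrow> simple_function M f \<Longrightarrow> Bochner_Integration.simple_bochner_integrable M f"
  by (intro Bochner_Integration.simple_bochner_integrable.intros) (simp_all add:
      finite_measure.emeasure_finite)

lemma nn_integral_finite_of_powr:
  fixes \<phi> :: "'a \<Rightarrow> real"
  assumes M: "finite_measure M" and \<phi>[measurable]: "\<phi> \<in> borel_measurable M" and nonneg: "\<And>x. 0 \<le> \<phi> x"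
    and q: "1 \<le> q" and fin: "(\<integral>\<^sup>+x. ennreal (\<phi> x powr q) \<partial>M) < \<infinity>"
  shows "(\<integral>\<^sup>+x. ennreal (\<phi> x) \<partial>M) < \<infinity>"
proof -
  interpret finite_measure M
    by fact
  have small: "\<phi> x \<le> 1 + \<phi> x powr q" for x
  proof (cases "\<phi> x \<le> 1")
    case False
    then have "\<phi> x powr 1 \<le> \<phi> x powr q"
      using q by (intro powr_mono) auto
    then show ?thesis
      using False by simp
  qed (use nonneg in \<open>simp add: add_increasing2\<close>)
  have "(\<integral>\<^sup>+x. ennreal (\<phi> x) \<partial>M) \<le> (\<integral>\<^sup>+x. 1 + ennreal (\<phi> x powr q) \<partial>M)"
  proof (rule nn_integral_mono)
    fix x
    have "ennreal (\<phi> x) \<le> ennreal (1 + \<phi> x powr q)"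
      using small[of x] by (rule ennreal_leI)
    then show "ennreal (\<phi> x) \<le> 1 + ennreal (\<phi> x powr q)"
      by simp
  qed
  also have "\<dots> = emeasure M (space M) + (\<integral>\<^sup>+x. ennreal (\<phi> x powr q) \<partial>M)"
    by (subst nn_integral_add) auto
  also have "\<dots> < \<infinity>"
    using fin by (simp add: less_top[symmetric])
  finally show ?thesis .
qed

context
  fixes p :: real
  assumes p: "2 \<le> p"
begin

lemma schatten_norm_tendsto:
  assumes "\<And>n. T n \<in> schatten_class p" "S \<in> schatten_class p" "(\<lambda>n. schatten_norm p (T n - S)) \<longlonglongrightarrow> 0"
  shows "(\<lambda>n. schatten_norm p (T n)) \<longlonglongrightarrow> schatten_norm p S"
proof (rule LIM_zero_cancel, rule tendsto_rabs_zero_cancel)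
  show "(\<lambda>n. \<bar>schatten_norm p (T n) - schatten_norm p S\<bar>) \<longlonglongrightarrow> 0"
    by (rule tendsto_sandwich[OF _ _ tendsto_const assms(3)])
      (auto intro!: always_eventually schatten_norm_reverse_triangle[OF p] assms)
qed

lemma schatten_strongly_measurable_class:
  "schatten_strongly_measurable p M F \<Longrightarrow> x \<in> space M \<Longrightarrow> F x \<in> schatten_class p"
  by (simp add: schatten_strongly_measurable_def)

lemma schatten_strongly_measurable_simple:
  assumes "simple_function M F" "\<And>x. x \<in> space M \<Longrightarrow> F x \<in> schatten_class p"
  shows "schatten_strongly_measurable p M F"
  unfolding schatten_strongly_measurable_def
  using assms by (auto intro!: exI[of _ "\<lambda>_. F"] simp: schatten_norm_0[OF p])

lemma schatten_strongly_measurable_diff: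
  assumes F: "schatten_strongly_measurable p M F" and G: "schatten_strongly_measurable p M G"
  shows "schatten_strongly_measurable p M (\<lambda>x. F x - G x)"
proof -
  obtain s where s: "\<And>n. simple_function M (s n)" "\<And>n x. x \<in> space M \<Longrightarrow> s n x \<in> schatten_class p"
    "AE x in M. (\<lambda>n. schatten_norm p (s n x - F x)) \<longlonglongrightarrow> 0"
    using F unfolding schatten_strongly_measurable_def by blast
  obtain u where u: "\<And>n. simple_function M (u n)" "\<And>n x. x \<in> space M \<Longrightarrow> u n x \<in> schatten_class p"
    "AE x in M. (\<lambda>n. schatten_norm p (u n x - G x)) \<longlonglongrightarrow> 0"
    using G unfolding schatten_strongly_measurable_def by blast
  have cls: "F x \<in> schatten_class p" "G x \<in> schatten_class p" if "x \<in> space M" for x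
    using F G that by (auto intro: schatten_strongly_measurable_class)
  have "AE x in M. (\<lambda>n. schatten_norm p (s n x - u n x - (F x - G x))) \<longlonglongrightarrow> 0"
    using s(3) u(3) AE_space
  proof eventually_elim
    case (elim x)
    have "(\<lambda>n. schatten_norm p (s n x - F x) + schatten_norm p (u n x - G x)) \<longlonglongrightarrow> 0"
      using tendsto_add[OF elim(1,2)] by simp
    then show ?case
    proof (rule tendsto_sandwich[OF _ _ tendsto_const, rotated 2])
      have "schatten_norm p (s n x - u n x - (F x - G x)) \<le> schatten_norm p (s n x - F x)
          + schatten_norm p (u n x - G x)" for n
      proof -
        have "s n x - u n x - (F x - G x) = (s n x - F x) - (u n x - G x)"
          by simp
        then show ?thesis
          using s(2) u(2) cls elim(3) by (simp only:) (intro schatten_norm_diff_le[OF p]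
              schatten_class_diff[OF p])
      qed
      then show "\<forall>\<^sub>F n in sequentially. schatten_norm p (s n x - u n x - (F x - G x))
          \<le> schatten_norm p (s n x - F x) + schatten_norm p (u n x - G x)"
        by simp
    qed (simp add: schatten_norm_nonneg[OF p])
  qed
  moreover have "simple_function M (\<lambda>x. s n x - u n x)" for n
    using s(1) u(1) by (rule simple_function_compose2)
  ultimately show ?thesis
    unfolding schatten_strongly_measurable_def
    using s(2) u(2) cls by (auto intro!: schatten_class_diff[OF p] exI[of _ "\<lambda>n x. s n x - u n x"])
qed

lemma schatten_strongly_measurable_scaleC:
  assumes F: "schatten_strongly_measurable p M F" and k: "k \<in> borel_measurable M"
  shows "schatten_strongly_measurable p M (\<lambda>x. scaleC_op (k x) (F x))"
proof -
  obtain s where s: "\<And>n. simple_function M (s n)" "\<And>n x. x \<in> space M \<Longrightarrow> s n x \<in> schatten_class p"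
    "AE x in M. (\<lambda>n. schatten_norm p (s n x - F x)) \<longlonglongrightarrow> 0"
    using F unfolding schatten_strongly_measurable_def by blast
  obtain c where c: "\<And>n. simple_function M (c n)" "\<And>x. x \<in> space M \<Longrightarrow> (\<lambda>n. c n x) \<longlonglongrightarrow> k x"
    using borel_measurable_implies_sequence_metric[OF k, of 0] by blast
  have cls: "F x \<in> schatten_class p" if "x \<in> space M" for x
    using F that by (rule schatten_strongly_measurable_class)
  have "AE x in M. (\<lambda>n. schatten_norm p (scaleC_op (c n x) (s n x) - scaleC_op (k x) (F x))) \<longlonglongrightarrow> 0"
    using s(3) AE_space
  proof eventually_elim
    case (elim x)
    have "(\<lambda>n. cmod (c n x) * schatten_norm p (s n x - F x) + cmod (c n x - k x) * schatten_norm p (F x))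
        \<longlonglongrightarrow> cmod (k x) * 0 + cmod (k x - k x) * schatten_norm p (F x)"
      by (intro tendsto_intros elim(1) c(2)[OF elim(2)])
    then have "(\<lambda>n. cmod (c n x) * schatten_norm p (s n x - F x)
        + cmod (c n x - k x) * schatten_norm p (F x)) \<longlonglongrightarrow> 0"
      by simp
    then show ?case
    proof (rule tendsto_sandwich[OF _ _ tendsto_const, rotated 2])
      have "schatten_norm p (scaleC_op (c n x) (s n x) - scaleC_op (k x) (F x))
          \<le> cmod (c n x) * schatten_norm p (s n x - F x) + cmod (c n x - k x) * schatten_norm p (F x)" for n
      proof -
        have S: "s n x - F x \<in> schatten_class p" and Fx: "F x \<in> schatten_class p"
          using s(2) cls elim(2) by (auto intro: schatten_class_diff[OF p])
        have "scaleC_op (c n x) (s n x) - scaleC_op (k x) (F x)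
            = scaleC_op (c n x) (s n x - F x) + scaleC_op (c n x - k x) (F x)"
          by (rule blinfun_eqI) (simp add: scaleC_op_apply blinfun.add_left blinfun.diff_left
              scaleC_diff_left scaleC_diff_right)
        also have "schatten_norm p \<dots> \<le> schatten_norm p (scaleC_op (c n x) (s n x - F x))
            + schatten_norm p (scaleC_op (c n x - k x) (F x))"
          by (intro schatten_norm_triangle[OF p] schatten_class_scaleC[OF p] S Fx)
        also have "\<dots> \<le> cmod (c n x) * schatten_norm p (s n x - F x)
            + cmod (c n x - k x) * schatten_norm p (F x)"
          by (intro add_mono schatten_norm_scaleC_le[OF p] S Fx)
        finally show ?thesis .
      qed
      then show "\<forall>\<^sub>F n in sequentially. schatten_norm p (scaleC_op (c n x) (s n x) - scaleC_op (k x) (F x))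
          \<le> cmod (c n x) * schatten_norm p (s n x - F x) + cmod (c n x - k x) * schatten_norm p (F x)"
        by simp
    qed (simp add: schatten_norm_nonneg[OF p])
  qed
  moreover have "simple_function M (\<lambda>x. scaleC_op (c n x) (s n x))" for n
    using c(1) s(1) by (rule simple_function_compose2)
  ultimately show ?thesis
    unfolding schatten_strongly_measurable_def
    using s(2) cls by (auto intro!: schatten_class_scaleC[OF p] exI[of _ "\<lambda>n x. scaleC_op (c n x) (s n x)"])
qed

lemma schatten_norm_AE_measurable:
  assumes F: "schatten_strongly_measurable p M F"
  obtains \<phi> :: "'a \<Rightarrow> real" where "\<phi> \<in> borel_measurable M" "\<And>x. 0 \<le> \<phi> x" "AE x in M. \<phi> x
      = schatten_norm p (F x)"
proof -
  obtain s where s: "\<And>n. simple_function M (s n)" "\<And>n x. x \<in> space M \<Longrightarrow> s n x \<in> schatten_class p"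
    "AE x in M. (\<lambda>n. schatten_norm p (s n x - F x)) \<longlonglongrightarrow> 0"
    using F unfolding schatten_strongly_measurable_def by blast
  define \<phi> where "\<phi> x = max 0 (lim (\<lambda>n. schatten_norm p (s n x)))" for x
  have [measurable]: "(\<lambda>x. schatten_norm p (s n x)) \<in> borel_measurable M" for n
    by (intro borel_measurable_simple_function simple_function_compose1[OF s(1)])
  show thesis
  proof
    show "\<phi> \<in> borel_measurable M"
      unfolding \<phi>_def by measurable
    show "AE x in M. \<phi> x = schatten_norm p (F x)"
      using s(3) AE_space
    proof eventually_elim
      case (elim x)
      have "(\<lambda>n. schatten_norm p (s n x)) \<longlonglongrightarrow> schatten_norm p (F x)"
        using elim by (intro schatten_norm_tendsto s(2) schatten_strongly_measurable_class[OF F])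
      then show ?case
        by (simp add: \<phi>_def limI schatten_norm_nonneg[OF p])
    qed
  qed (simp add: \<phi>_def)
qed

text \<open>For a function that is not measurable, \<^const>\<open>nn_integral\<close> is a lower integral, which need not be
  subadditive. So the triangle inequality goes through measurable functions that agree almost everywhere
  with the norms involved.\<close>

lemma nn_integral_schatten_triangle:
  assumes F: "schatten_strongly_measurable p M F" and G: "schatten_strongly_measurable p M G"
    and H: "schatten_strongly_measurable p M H"
  shows "(\<integral>\<^sup>+x. schatten_norm p (G x - H x) \<partial>M)
    \<le> (\<integral>\<^sup>+x. schatten_norm p (F x - G x) \<partial>M) + (\<integral>\<^sup>+x. schatten_norm p (F x - H x) \<partial>M)"
proof -
  obtain f where f[measurable]: "f \<in> borel_measurable M" and f0: "\<And>x. 0 \<le> f x"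
    and fF: "AE x in M. f x = schatten_norm p (F x - G x)"
    using schatten_norm_AE_measurable[OF schatten_strongly_measurable_diff[OF F G]] by blast
  obtain g where g[measurable]: "g \<in> borel_measurable M" and g0: "\<And>x. 0 \<le> g x"
    and gF: "AE x in M. g x = schatten_norm p (F x - H x)"
    using schatten_norm_AE_measurable[OF schatten_strongly_measurable_diff[OF F H]] by blast
  have "(\<integral>\<^sup>+x. schatten_norm p (G x - H x) \<partial>M) \<le> (\<integral>\<^sup>+x. ennreal (f x) + ennreal (g x) \<partial>M)"
  proof (rule nn_integral_mono_AE)
    show "AE x in M. ennreal (schatten_norm p (G x - H x)) \<le> ennreal (f x) + ennreal (g x)"
      using fF gF AE_space
    proof eventually_elim
      case (elim x)
      have "F x \<in> schatten_class p" "G x \<in> schatten_class p" "H x \<in> schatten_class p"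
        using F G H elim(3) by (auto intro: schatten_strongly_measurable_class)
      then have "schatten_norm p (G x - H x) \<le> f x + g x"
        using schatten_norm_triangle_diff[OF p, of "G x" "F x"
            "H x"] schatten_norm_minus_commute[OF p, of "G x" "F x"]
          elim by simp
      then show ?case
        using f0 g0 by (simp add: ennreal_plus[symmetric] ennreal_leI del: ennreal_plus)
    qed
  qed
  also have "\<dots> = (\<integral>\<^sup>+x. ennreal (f x) \<partial>M) + (\<integral>\<^sup>+x. ennreal (g x) \<partial>M)"
    by (rule nn_integral_add) auto
  also have "(\<integral>\<^sup>+x. ennreal (f x) \<partial>M) = (\<integral>\<^sup>+x. schatten_norm p (F x - G x) \<partial>M)"
    using fF by (intro nn_integral_cong_AE) auto
  also have "(\<integral>\<^sup>+x. ennreal (g x) \<partial>M) = (\<integral>\<^sup>+x. schatten_norm p (F x - H x) \<partial>M)"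
    using gF by (intro nn_integral_cong_AE) auto
  finally show ?thesis .
qed

text \<open>A strongly measurable function with \<open>\<integral> \<parallel>F\<parallel>^q < \<infinity>\<close> is approximated by simple functions that are set
  to \<open>0\<close> where their norm exceeds twice a simple approximation of \<open>\<parallel>F\<parallel>\<close>; this makes dominated
  convergence applicable.\<close>

lemma schatten_simple_approximation:
  assumes M: "finite_measure M" and F: "schatten_strongly_measurable p M F"
    and q: "1 \<le> q" and fin: "(\<integral>\<^sup>+x. schatten_norm p (F x) powr q \<partial>M) < \<infinity>"
  obtains t where "\<And>n. simple_function M (t n)" "\<And>n x. x \<in> space M \<Longrightarrow> t n x \<in> schatten_class p"
    "(\<lambda>n. \<integral>\<^sup>+x. schatten_norm p (F x - t n x) \<partial>M) \<longlonglongrightarrow> 0"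
    "(\<lambda>n. \<integral>\<^sup>+x. schatten_norm p (t n x) powr q \<partial>M) \<longlonglongrightarrow> (\<integral>\<^sup>+x. schatten_norm p (F x) powr q \<partial>M)"
proof -
  interpret finite_measure M
    by fact
  obtain s where s: "\<And>n. simple_function M (s n)" "\<And>n x. x \<in> space M \<Longrightarrow> s n x \<in> schatten_class p"
    "AE x in M. (\<lambda>n. schatten_norm p (s n x - F x)) \<longlonglongrightarrow> 0"
    using F unfolding schatten_strongly_measurable_def by blast
  obtain \<phi> where \<phi>[measurable]: "\<phi> \<in> borel_measurable M" and \<phi>0: "\<And>x. 0 \<le> \<phi> x"
    and \<phi>F: "AE x in M. \<phi> x = schatten_norm p (F x)"
    using schatten_norm_AE_measurable[OF F] by blast
  obtain f where f: "\<And>n. simple_function M (f n)" "\<And>x. x \<in> space M \<Longrightarrow> (\<lambda>n. f n x) \<longlonglongrightarrow> \<phi> x"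
    and fle: "\<And>n x. x \<in> space M \<Longrightarrow> dist (f n x) 0 \<le> 2 * dist (\<phi> x) 0"
    using borel_measurable_implies_sequence_metric[OF \<phi>, of 0] by blast
  have f_meas[measurable]: "f n \<in> borel_measurable M"
      "(\<lambda>x. schatten_norm p (s n x)) \<in> borel_measurable M" for n
    by (intro borel_measurable_simple_function f(1) simple_function_compose1[OF s(1)])+
  define t where "t n x = (if schatten_norm p (s n x) \<le> 2 * f n x then s n x else 0)" for n x
  have t_simple: "simple_function M (t n)" for n
    unfolding t_def by (intro simple_function_If s(1) simple_function_const) measurable
  have t_class: "t n x \<in> schatten_class p" if "x \<in> space M" for n x
    using s(2)[OF that] by (simp add: t_def schatten_class_0[OF p])
  have t_le: "schatten_norm p (t n x) \<le> 4 * \<phi> x" if "x \<in> space M" for n x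
    using fle[OF that, of n] \<phi>0[of x] by (auto simp: t_def schatten_norm_0[OF p] dist_real_def)
  have t_lim: "AE x in M. (\<lambda>n. schatten_norm p (t n x - F x)) \<longlonglongrightarrow> 0"
    using s(3) \<phi>F AE_space
  proof eventually_elim
    case (elim x)
    have Fx: "F x \<in> schatten_class p"
      using F elim(3) by (rule schatten_strongly_measurable_class)
    show ?case
    proof (cases "\<phi> x = 0")
      case True
      then have "F x = 0"
        using schatten_norm_eq_0[OF p Fx] elim(2) by simp
      moreover have "t n x = 0" for n
        using t_le[OF elim(3), of n] True schatten_norm_nonneg[OF p, of "t n x"]
        by (intro schatten_norm_eq_0[OF p t_class[OF elim(3)]]) simp
      ultimately show ?thesis
        by (simp add: schatten_norm_0[OF p])
    next
      case False
      then have pos: "0 < \<phi> x"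
        using \<phi>0[of x] by simp
      have "(\<lambda>n. 2 * f n x - schatten_norm p (s n x - F x)) \<longlonglongrightarrow> 2 * \<phi> x - 0"
        by (intro tendsto_intros elim(1) f(2) elim(3))
      then have "\<forall>\<^sub>F n in sequentially. \<phi> x < 2 * f n x - schatten_norm p (s n x - F x)"
        using pos by (simp add: order_tendsto_iff)
      then have "\<forall>\<^sub>F n in sequentially. schatten_norm p (s n x - F x) = schatten_norm p (t n x - F x)"
      proof eventually_elim
        case (elim n)
        have "schatten_norm p (s n x) \<le> schatten_norm p (F x) + schatten_norm p (s n x - F x)"
          using schatten_norm_reverse_triangle[OF p s(2) Fx, of x n] \<open>x \<in> space M\<close> by simp
        then show ?case
          using elim \<open>\<phi> x = schatten_norm p (F x)\<close> by (simp add: t_def)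
      qed
      with elim(1) show ?thesis
        by (rule Lim_transform_eventually)
    qed
  qed
  have "(\<integral>\<^sup>+x. ennreal (\<phi> x powr q) \<partial>M) = (\<integral>\<^sup>+x. schatten_norm p (F x) powr q \<partial>M)"
    using \<phi>F by (intro nn_integral_cong_AE) auto
  then have fin\<phi>: "(\<integral>\<^sup>+x. ennreal (\<phi> x powr q) \<partial>M) < \<infinity>"
    using fin by simp
  \<comment> \<open>\<open>5 \<phi>\<close> dominates the distance of \<open>F\<close> and \<open>t n\<close>, whose norms are at most \<open>\<phi>\<close> and \<open>4 \<phi>\<close>.\<close>
  have "(\<integral>\<^sup>+x. ennreal (5 * \<phi> x) \<partial>M) = (\<integral>\<^sup>+x. 5 * ennreal (\<phi> x) \<partial>M)"
    using \<phi>0 by (simp add: ennreal_mult)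
  also have "\<dots> = 5 * (\<integral>\<^sup>+x. ennreal (\<phi> x) \<partial>M)"
    by (rule nn_integral_cmult) simp
  finally have fin5: "(\<integral>\<^sup>+x. ennreal (5 * \<phi> x) \<partial>M) < \<infinity>"
    using nn_integral_finite_of_powr[OF M \<phi> \<phi>0 q fin\<phi>] by (simp add: ennreal_mult_less_top)
  show thesis
  proof
    show "simple_function M (t n)" "x \<in> space M \<Longrightarrow> t n x \<in> schatten_class p" for n x
      by (rule t_simple, rule t_class)
    have "\<exists>d. d \<in> borel_measurable M \<and> (\<forall>x. 0 \<le> d x) \<and> (AE x in M. d x
        = schatten_norm p (F x - t n x))" for n
      using schatten_norm_AE_measurable[OF schatten_strongly_measurable_diff[OF F
          schatten_strongly_measurable_simple[OF t_simple t_class]]] by metis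
    then obtain d where d[measurable]: "\<And>n. d n \<in> borel_measurable M" and d0: "\<And>n x. 0 \<le> d n x"
      and dF: "\<And>n. AE x in M. d n x = schatten_norm p (F x - t n x)"
      by metis
    have "(\<lambda>n. \<integral>\<^sup>+x. norm (0 - d n x) \<partial>M) \<longlonglongrightarrow> 0"
    proof (rule nn_integral_dominated_convergence_norm)
      show "(\<integral>\<^sup>+x. ennreal (5 * \<phi> x) \<partial>M) < \<infinity>"
        by (rule fin5)
      show "AE x in M. norm (d j x) \<le> 5 * \<phi> x" for j
        using dF[of j] \<phi>F AE_space
      proof eventually_elim
        case (elim x)
        have "schatten_norm p (F x - t j x) \<le> schatten_norm p (F x) + schatten_norm p (t j x)"
          using F elim(3) by (intro schatten_norm_diff_le[OF p] schatten_strongly_measurable_class t_class)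
        then show ?case
          using elim t_le[OF elim(3), of j] d0[of j x] by simp
      qed
      have "AE x in M. \<forall>n. d n x = schatten_norm p (F x - t n x)"
        using dF by (simp add: AE_all_countable)
      then show "AE x in M. (\<lambda>n. d n x) \<longlonglongrightarrow> 0"
        using t_lim AE_space
      proof eventually_elim
        case (elim x)
        then show ?case
          using schatten_norm_minus_commute[OF p t_class[OF elim(3)]
              schatten_strongly_measurable_class[OF F elim(3)]]
          by simp
      qed
    qed auto
    moreover have "(\<integral>\<^sup>+x. norm (0 - d n x) \<partial>M) = (\<integral>\<^sup>+x. schatten_norm p (F x - t n x) \<partial>M)" for n
      using dF[of n] d0 by (intro nn_integral_cong_AE) auto
    ultimately show "(\<lambda>n. \<integral>\<^sup>+x. schatten_norm p (F x - t n x) \<partial>M) \<longlonglongrightarrow> 0"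
      by simp
    have "(\<lambda>n. \<integral>\<^sup>+x. ennreal (schatten_norm p (t n x) powr q) \<partial>M) \<longlonglongrightarrow> (\<integral>\<^sup>+x. ennreal (\<phi> x powr q) \<partial>M)"
    proof (rule nn_integral_dominated_convergence)
      show "(\<lambda>x. ennreal (schatten_norm p (t n x) powr q)) \<in> borel_measurable M" for n
        by (intro borel_measurable_simple_function simple_function_compose1[OF t_simple])
      show "AE x in M. ennreal (schatten_norm p (t n x) powr q) \<le> 4 powr q * ennreal (\<phi> x powr q)" for n
        using AE_space
      proof eventually_elim
        case (elim x)
        have "schatten_norm p (t n x) powr q \<le> (4 * \<phi> x) powr q"
          using t_le[OF elim] q by (intro powr_mono2 schatten_norm_nonneg[OF p]) auto
        also have "\<dots> = 4 powr q * \<phi> x powr q"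
          using \<phi>0 by (simp add: powr_mult)
        finally show ?case
          by (simp add: ennreal_mult[symmetric] ennreal_leI)
      qed
      show "(\<integral>\<^sup>+x. 4 powr q * ennreal (\<phi> x powr q) \<partial>M) < \<infinity>"
        using fin\<phi> by (simp add: nn_integral_cmult ennreal_mult_less_top)
      show "AE x in M. (\<lambda>n. ennreal (schatten_norm p (t n x) powr q)) \<longlonglongrightarrow> ennreal (\<phi> x powr q)"
        using t_lim \<phi>F AE_space
      proof eventually_elim
        case (elim x)
        have "(\<lambda>n. schatten_norm p (t n x)) \<longlonglongrightarrow> schatten_norm p (F x)"
          using elim by (intro schatten_norm_tendsto t_class schatten_strongly_measurable_class[OF F])
        then show ?case
          unfolding elim(2) using q
          by (intro tendsto_ennrealI tendsto_powr' tendsto_const) (auto simp: schatten_norm_nonneg[OF p])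
      qed
    qed auto
    also have "(\<integral>\<^sup>+x. ennreal (\<phi> x powr q) \<partial>M) = (\<integral>\<^sup>+x. schatten_norm p (F x) powr q \<partial>M)"
      by fact
    finally show "(\<lambda>n. \<integral>\<^sup>+x. ennreal (schatten_norm p (t n x) powr q) \<partial>M)
        \<longlonglongrightarrow> (\<integral>\<^sup>+x. schatten_norm p (F x) powr q \<partial>M)" .
  qed
qed

end

context
  fixes p :: real
  assumes p: "2 \<le> p"
begin

lemma schatten_class_simple_integral:
  assumes "\<And>x. x \<in> space M \<Longrightarrow> u x \<in> schatten_class p"
  shows "Bochner_Integration.simple_bochner_integral M u \<in> schatten_class p"
  unfolding Bochner_Integration.simple_bochner_integral_def
  using assms by (auto intro!: schatten_class_sum[OF p] schatten_class_scaleR[OF p])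

lemma schatten_norm_simple_integral_le:
  assumes M: "finite_measure M" and u: "simple_function M u" "\<And>x. x \<in> space M \<Longrightarrow> u x \<in> schatten_class p"
  shows "ennreal (schatten_norm p (Bochner_Integration.simple_bochner_integral M u))
    \<le> (\<integral>\<^sup>+x. schatten_norm p (u x) \<partial>M)"
proof -
  let ?m = "\<lambda>y. measure M {x \<in> space M. u x = y}"
  have su: "Bochner_Integration.simple_bochner_integrable M u"
    using M u(1) by (rule simple_bochner_integrable_finite_measure)
  have sn: "Bochner_Integration.simple_bochner_integrable M (\<lambda>x. schatten_norm p (u x))"
    using M simple_function_compose1[OF u(1)] by (rule simple_bochner_integrable_finite_measure)
  have "schatten_norm p (Bochner_Integration.simple_bochner_integral M u)
      \<le> (\<Sum>y\<in>u ` space M. schatten_norm p (?m y *\<^sub>R y))"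
    unfolding Bochner_Integration.simple_bochner_integral_def
    using u(2) by (intro schatten_norm_sum_le[OF p]) (auto intro: schatten_class_scaleR[OF p])
  also have "\<dots> \<le> (\<Sum>y\<in>u ` space M. ?m y *\<^sub>R schatten_norm p y)"
  proof (rule sum_mono)
    fix y assume "y \<in> u ` space M"
    then show "schatten_norm p (?m y *\<^sub>R y) \<le> ?m y *\<^sub>R schatten_norm p y"
      using schatten_norm_scaleR_le[OF p, of y "?m y"] u(2) by auto
  qed
  also have "\<dots> = Bochner_Integration.simple_bochner_integral M (\<lambda>x. schatten_norm p (u x))"
    by (rule simple_bochner_integral_partition[symmetric, OF sn u(1)]) auto
  finally have "ennreal (schatten_norm p (Bochner_Integration.simple_bochner_integral M u))
      \<le> ennreal (Bochner_Integration.simple_bochner_integral M (\<lambda>x. schatten_norm p (u x)))"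
    by (rule ennreal_leI)
  also have "\<dots> = (\<integral>\<^sup>+x. schatten_norm p (u x) \<partial>M)"
    by (rule simple_bochner_integral_eq_nn_integral[OF sn schatten_norm_nonneg[OF p]])
  finally show ?thesis .
qed

text \<open>The estimate behind both existence and uniqueness of the integral.\<close>

lemma schatten_norm_simple_integral_diff_le:
  assumes M: "finite_measure M" and F: "schatten_strongly_measurable p M F"
    and u: "simple_function M u" "\<And>x. x \<in> space M \<Longrightarrow> u x \<in> schatten_class p"
    and v: "simple_function M v" "\<And>x. x \<in> space M \<Longrightarrow> v x \<in> schatten_class p"
  shows "ennreal (schatten_norm p (Bochner_Integration.simple_bochner_integral M u
      - Bochner_Integration.simple_bochner_integral M v))
    \<le> (\<integral>\<^sup>+x. schatten_norm p (F x - u x) \<partial>M) + (\<integral>\<^sup>+x. schatten_norm p (F x - v x) \<partial>M)"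
proof -
  have "Bochner_Integration.simple_bochner_integral M u - Bochner_Integration.simple_bochner_integral M v
      = Bochner_Integration.simple_bochner_integral M (\<lambda>x. u x - v x)"
    using M u v by (intro simple_bochner_integral_diff[symmetric] simple_bochner_integrable_finite_measure)
  also have "ennreal (schatten_norm p \<dots>) \<le> (\<integral>\<^sup>+x. schatten_norm p (u x - v x) \<partial>M)"
    using M u v by (intro schatten_norm_simple_integral_le simple_function_compose2[of _ _ _ minus]
        schatten_class_diff[OF p])
  also have "\<dots> \<le> (\<integral>\<^sup>+x. schatten_norm p (F x - u x) \<partial>M) + (\<integral>\<^sup>+x. schatten_norm p (F x - v x) \<partial>M)"
    using u v by (intro nn_integral_schatten_triangle[OF p F] schatten_strongly_measurable_simple[OF p])
  finally show ?thesis .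
qed

lemma schatten_integral_exists:
  assumes M: "finite_measure M" and F: "schatten_strongly_measurable p M F"
    and fin: "(\<integral>\<^sup>+x. schatten_norm p (F x) \<partial>M) < \<infinity>"
  shows "\<exists>I. schatten_has_integral p M F I"
proof -
  have fin1: "(\<integral>\<^sup>+x. schatten_norm p (F x) powr 1 \<partial>M) < \<infinity>"
    using fin by (simp add: schatten_norm_nonneg[OF p])
  obtain t where t: "\<And>n. simple_function M (t n)" "\<And>n x. x \<in> space M \<Longrightarrow> t n x \<in> schatten_class p"
    and lim: "(\<lambda>n. \<integral>\<^sup>+x. schatten_norm p (F x - t n x) \<partial>M) \<longlonglongrightarrow> 0"
    and "(\<lambda>n. \<integral>\<^sup>+x. schatten_norm p (t n x) powr 1 \<partial>M) \<longlonglongrightarrow> (\<integral>\<^sup>+x. schatten_norm p (F x) powr 1 \<partial>M)"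
    by (rule schatten_simple_approximation[OF p M F order_refl fin1], rule that)
  define J where "J n = Bochner_Integration.simple_bochner_integral M (t n)" for n
  have J: "J n \<in> schatten_class p" for n
    unfolding J_def by (rule schatten_class_simple_integral[OF t(2)])
  obtain I where I: "I \<in> schatten_class p" "(\<lambda>n. schatten_norm p (J n - I)) \<longlonglongrightarrow> 0"
  proof (rule schatten_class_complete[OF p, of J])
    fix \<epsilon> :: real assume "\<epsilon> > 0"
    then have "\<forall>\<^sub>F n in sequentially. (\<integral>\<^sup>+x. schatten_norm p (F x - t n x) \<partial>M) < ennreal (\<epsilon> / 2)"
      using lim by (simp add: order_tendsto_iff)
    then obtain N where N: "\<And>n. n \<ge> N \<Longrightarrow> (\<integral>\<^sup>+x. schatten_norm p (F x - t n x) \<partial>M) < ennreal (\<epsilon> / 2)"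
      by (auto simp: eventually_sequentially)
    have "schatten_norm p (J m - J n) < \<epsilon>" if "m \<ge> N" "n \<ge> N" for m n
    proof -
      have "ennreal (schatten_norm p (J m - J n)) \<le>
          (\<integral>\<^sup>+x. schatten_norm p (F x - t m x) \<partial>M) + (\<integral>\<^sup>+x. schatten_norm p (F x - t n x) \<partial>M)"
        unfolding J_def by (intro schatten_norm_simple_integral_diff_le M F t)
      also have "\<dots> < ennreal (\<epsilon> / 2) + ennreal (\<epsilon> / 2)"
        by (intro add_strict_mono N that)
      also have "\<dots> = ennreal \<epsilon>"
        using \<open>\<epsilon> > 0\<close> by (simp add: ennreal_plus[symmetric] del: ennreal_plus)
      finally show ?thesis
        using \<open>\<epsilon> > 0\<close> by (simp add: ennreal_less_iff schatten_norm_nonneg[OF p])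
    qed
    then show "\<exists>N. \<forall>m\<ge>N. \<forall>n\<ge>N. schatten_norm p (J m - J n) < \<epsilon>"
      by blast
  qed (rule J)
  then have "schatten_has_integral p M F I"
    unfolding schatten_has_integral_def J_def
    using F t lim by (auto intro!: exI[of _ t] simple_bochner_integrable_finite_measure[OF M])
  then show ?thesis ..
qed

lemma schatten_has_integral_unique:
  assumes M: "finite_measure M" and I: "schatten_has_integral p M F I" and J:
      "schatten_has_integral p M F J"
  shows "I = J"
proof -
  have F: "schatten_strongly_measurable p M F" and IJ: "I \<in> schatten_class p" "J \<in> schatten_class p"
    using I J by (simp_all add: schatten_has_integral_def)
  obtain s where s: "\<And>n. simple_function M (s n)" "\<And>n x. x \<in> space M \<Longrightarrow> s n x \<in> schatten_class p"
    "(\<lambda>n. \<integral>\<^sup>+x. schatten_norm p (F x - s n x) \<partial>M) \<longlonglongrightarrow> 0"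
    "(\<lambda>n. schatten_norm p (Bochner_Integration.simple_bochner_integral M (s n) - I)) \<longlonglongrightarrow> 0"
    using I unfolding schatten_has_integral_def by (auto elim:
        Bochner_Integration.simple_bochner_integrable.cases)
  obtain u where u: "\<And>n. simple_function M (u n)" "\<And>n x. x \<in> space M \<Longrightarrow> u n x \<in> schatten_class p"
    "(\<lambda>n. \<integral>\<^sup>+x. schatten_norm p (F x - u n x) \<partial>M) \<longlonglongrightarrow> 0"
    "(\<lambda>n. schatten_norm p (Bochner_Integration.simple_bochner_integral M (u n) - J)) \<longlonglongrightarrow> 0"
    using J unfolding schatten_has_integral_def by (auto elim:
        Bochner_Integration.simple_bochner_integrable.cases)
  define S U where "S n = Bochner_Integration.simple_bochner_integral M (s n)"
    and "U n = Bochner_Integration.simple_bochner_integral M (u n)" for n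
  have SU: "S n \<in> schatten_class p" "U n \<in> schatten_class p" for n
    unfolding S_def U_def using s(2) u(2) by (auto intro: schatten_class_simple_integral)
  have bound: "ennreal (schatten_norm p (I - J)) \<le>
      ennreal (schatten_norm p (S n - I)) + ((\<integral>\<^sup>+x. schatten_norm p (F x - s n x) \<partial>M)
        + (\<integral>\<^sup>+x. schatten_norm p (F x - u n x) \<partial>M)) + ennreal (schatten_norm p (U n - J))" for n
  proof -
    have "schatten_norm p (I - J) \<le> schatten_norm p (S n - I) + schatten_norm p (S n - U n)
        + schatten_norm p (U n - J)"
      using schatten_norm_triangle_diff[OF p IJ(1) SU(1) IJ(2), of n] schatten_norm_triangle_diff[OF
          p SU IJ(2), of n n]
        schatten_norm_minus_commute[OF p IJ(1) SU(1)[of n]] by simp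
    then have "ennreal (schatten_norm p (I - J)) \<le>
        ennreal (schatten_norm p (S n - I)) + ennreal (schatten_norm p (S n - U n))
            + ennreal (schatten_norm p (U n - J))"
      by (simp add: ennreal_plus[symmetric] schatten_norm_nonneg[OF p] ennreal_leI del: ennreal_plus)
    also have "\<dots> \<le> ennreal (schatten_norm p (S n - I)) + ((\<integral>\<^sup>+x. schatten_norm p (F x - s n x) \<partial>M)
        + (\<integral>\<^sup>+x. schatten_norm p (F x - u n x) \<partial>M)) + ennreal (schatten_norm p (U n - J))"
      unfolding S_def U_def by (intro add_mono order_refl schatten_norm_simple_integral_diff_le M F s u)
    finally show ?thesis .
  qed
  have "(\<lambda>n. ennreal (schatten_norm p (S n - I)) + ((\<integral>\<^sup>+x. schatten_norm p (F x - s n x) \<partial>M)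
        + (\<integral>\<^sup>+x. schatten_norm p (F x - u n x) \<partial>M)) + ennreal (schatten_norm p (U n - J))) \<longlonglongrightarrow>
      ennreal 0 + (0 + 0) + ennreal 0"
    by (intro tendsto_add tendsto_ennrealI s(3) u(3) s(4)[folded S_def] u(4)[folded U_def])
  then have "ennreal (schatten_norm p (I - J)) \<le> ennreal 0 + (0 + 0) + ennreal 0"
    by (rule tendsto_lowerbound) (use bound in auto)
  then have "schatten_norm p (I - J) = 0"
    using schatten_norm_nonneg[OF p, of "I - J"] by (simp add: ennreal_eq_0_iff antisym)
  then show ?thesis
    using schatten_norm_eq_0[OF p schatten_class_diff[OF p IJ]] by simp
qed

lemma schatten_has_integral_integral:
  assumes "finite_measure M" "schatten_strongly_measurable p M F" "(\<integral>\<^sup>+x. schatten_norm p (F x) \<partial>M) < \<infinity>"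
  shows "schatten_has_integral p M F (schatten_integral p M F)"
proof -
  obtain I where I: "schatten_has_integral p M F I"
    using schatten_integral_exists[OF assms] by blast
  show ?thesis
    unfolding schatten_integral_def
    by (rule theI[of _ I]) (rule I, rule schatten_has_integral_unique[OF assms(1) _ I])
qed

text \<open>The same simple approximations \<open>t\<close> of \<open>F\<close> serve all \<open>k\<close>, although \<open>k t\<close> need not be simple: since
  \<open>|k| \<le> 1\<close>, it is as close to \<open>k F\<close> as \<open>t\<close> is to \<open>F\<close>, hence close to the simple functions that define
  the integral of \<open>k F\<close>.\<close>

lemma cinner_schatten_integral_limit:
  fixes F :: "'a \<Rightarrow> ('h::complex_hilbert_space \<Rightarrow>\<^sub>L 'h)" and k :: "'a \<Rightarrow> complex"
  assumes M: "finite_measure M" and F: "schatten_strongly_measurable p M F"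
    and k: "k \<in> borel_measurable M" "\<And>x. cmod (k x) \<le> 1"
    and I: "schatten_has_integral p M (\<lambda>x. scaleC_op (k x) (F x)) I"
    and t: "\<And>n. simple_function M (t n)" "\<And>n x. x \<in> space M \<Longrightarrow> t n x \<in> schatten_class p"
    and t_lim: "(\<lambda>n. \<integral>\<^sup>+x. schatten_norm p (F x - t n x) \<partial>M) \<longlonglongrightarrow> 0"
  shows "(\<lambda>n. \<integral>x. k x * cinner y (t n x z) \<partial>M) \<longlonglongrightarrow> cinner y (I z)"
proof -
  interpret finite_measure M
    by fact
  let ?kF = "\<lambda>x. scaleC_op (k x) (F x)"
  obtain s where s: "\<And>n. simple_function M (s n)" "\<And>n x. x \<in> space M \<Longrightarrow> s n x \<in> schatten_class p"
    "(\<lambda>n. \<integral>\<^sup>+x. schatten_norm p (?kF x - s n x) \<partial>M) \<longlonglongrightarrow> 0"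
    "(\<lambda>n. schatten_norm p (Bochner_Integration.simple_bochner_integral M (s n) - I)) \<longlonglongrightarrow> 0"
    using I unfolding schatten_has_integral_def by (auto elim:
        Bochner_Integration.simple_bochner_integrable.cases)
  define S where "S n = Bochner_Integration.simple_bochner_integral M (s n)" for n
  have Icl: "I \<in> schatten_class p" and Scl: "S n \<in> schatten_class p" for n
    using I s(2) by (auto simp: schatten_has_integral_def S_def intro: schatten_class_simple_integral)
  have entry: "cmod (cinner y (T z)) \<le> schatten_norm p T * (norm y * norm z)" if
      "T \<in> schatten_class p" for T
  proof -
    have "cmod (cinner y (T z)) \<le> norm y * (norm T * norm z)"
      using cmod_cinner_le[of y "T z"] norm_blinfun[of T z]
          by (meson mult_left_mono norm_ge_zero order_trans)
    also have "\<dots> \<le> norm y * (schatten_norm p T * norm z)"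
      by (intro mult_left_mono mult_right_mono norm_le_schatten_norm[OF p that]) auto
    finally show ?thesis
      by (simp add: mult_ac)
  qed
  have lin: "linear (\<lambda>T. cinner y (blinfun_apply T z))"
    by (intro bounded_linear.linear bounded_linear_compose[OF cinner.bounded_linear_right]
        blinfun.bounded_linear_left)
  have "(\<lambda>n. schatten_norm p (S n - I) * (norm y * norm z)) \<longlonglongrightarrow> 0 * (norm y * norm z)"
    by (intro tendsto_intros s(4)[folded S_def])
  then have lim0: "(\<lambda>n. schatten_norm p (S n - I) * (norm y * norm z)) \<longlonglongrightarrow> 0"
    by simp
  have Slim: "(\<lambda>n. cinner y (S n z)) \<longlonglongrightarrow> cinner y (I z)"
  proof (rule LIM_zero_cancel, rule tendsto_norm_zero_cancel, rule tendsto_sandwich[OF _ _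
      tendsto_const lim0])
    show "\<forall>\<^sub>F n in sequentially. cmod (cinner y (S n z) - cinner y (I z))
        \<le> schatten_norm p (S n - I) * (norm y * norm z)"
      using entry[OF schatten_class_diff[OF p Scl Icl]]
      by (simp add: blinfun.diff_left cinner.diff_right)
  qed simp
  have simple_int: "integrable M (\<lambda>x. cinner y (u x z))" if "simple_function M u" for u ::
      "'a \<Rightarrow> ('h \<Rightarrow>\<^sub>L 'h)"
  proof -
    have "Bochner_Integration.simple_bochner_integrable M (\<lambda>x. cinner y (blinfun_apply (u x) z))"
      by (rule simple_bochner_integrable_finite_measure[OF M]) (rule simple_function_compose1[OF that])
    then show ?thesis
      using has_bochner_integral_simple_bochner_integrable integrable.intros by blast
  qed
  have S_int: "cinner y (S n z) = (\<integral>x. cinner y (s n x z) \<partial>M)" for n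
  proof -
    have sn: "Bochner_Integration.simple_bochner_integrable M (s n)"
      by (rule simple_bochner_integrable_finite_measure[OF M s(1)])
    have sn': "Bochner_Integration.simple_bochner_integrable M (\<lambda>x. cinner y (blinfun_apply (s n x) z))"
      by (rule simple_bochner_integrable_finite_measure[OF M]) (rule simple_function_compose1[OF s(1)])
    show ?thesis
      unfolding S_def simple_bochner_integral_linear[OF lin sn, symmetric]
      by (rule simple_bochner_integrable_eq_integral[OF sn'])
  qed
  have kt: "schatten_strongly_measurable p M (\<lambda>x. scaleC_op (k x) (t n x))" for n
    by (intro schatten_strongly_measurable_scaleC[OF p] schatten_strongly_measurable_simple[OF p] t k)
  have kF: "schatten_strongly_measurable p M ?kF"
    by (intro schatten_strongly_measurable_scaleC[OF p] F k)
  have kt_int: "integrable M (\<lambda>x. k x * cinner y (t n x z))" for n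
  proof (rule Bochner_Integration.integrable_bound[OF simple_int[OF t(1)]])
    show "(\<lambda>x. k x * cinner y (t n x z)) \<in> borel_measurable M"
      using simple_int[OF t(1)] k by measurable
    show "AE x in M. norm (k x * cinner y (t n x z)) \<le> norm (cinner y (t n x z))"
      using k(2) by (simp add: norm_mult mult_left_le_one_le)
  qed
  define D where "D n = (\<integral>x. cinner y (s n x z) \<partial>M) - (\<integral>x. k x * cinner y (t n x z) \<partial>M)" for n
  have D_le: "ennreal (cmod (D n)) \<le> ((\<integral>\<^sup>+x. schatten_norm p (?kF x - s n x) \<partial>M)
      + (\<integral>\<^sup>+x. schatten_norm p (F x - t n x) \<partial>M)) * ennreal (norm y * norm z)" for n
  proof -
    have "D n = (\<integral>x. cinner y (s n x z) - k x * cinner y (t n x z) \<partial>M)"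
      unfolding D_def by (intro Bochner_Integration.integral_diff[symmetric] simple_int s kt_int)
    also have "ennreal (cmod \<dots>) \<le> (\<integral>\<^sup>+x. norm (cinner y (s n x z) - k x * cinner y (t n x z)) \<partial>M)"
      by (intro integral_norm_bound_ennreal Bochner_Integration.integrable_diff simple_int s kt_int)
    also have "\<dots> \<le> (\<integral>\<^sup>+x. ennreal (schatten_norm p (s n x - scaleC_op (k x) (t n x))) * ennreal
        (norm y * norm z) \<partial>M)"
    proof (rule nn_integral_mono)
      fix x assume x: "x \<in> space M"
      have "cinner y (s n x z) - k x * cinner y (t n x z) = cinner y ((s n x - scaleC_op (k x) (t n x)) z)"
        by (simp add: blinfun.diff_left cinner.diff_right scaleC_op_apply cinner_scaleC_right)
      also have "cmod \<dots> \<le> schatten_norm p (s n x - scaleC_op (k x) (t n x)) * (norm y * norm z)"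
        using s(2) t(2) x by (intro entry schatten_class_diff[OF p] schatten_class_scaleC[OF p])
      finally show "ennreal (norm (cinner y (s n x z) - k x * cinner y (t n x z)))
          \<le> ennreal (schatten_norm p (s n x - scaleC_op (k x) (t n x))) * ennreal (norm y * norm z)"
        by (simp add: ennreal_mult[symmetric] schatten_norm_nonneg[OF p] ennreal_leI)
    qed
    also have "\<dots> = (\<integral>\<^sup>+x. schatten_norm p (s n x - scaleC_op (k x) (t n x)) \<partial>M) * ennreal (norm y * norm z)"
    proof -
      have meas: "schatten_strongly_measurable p M (\<lambda>x. s n x - scaleC_op (k x) (t n x))"
        by (intro schatten_strongly_measurable_diff[OF p] schatten_strongly_measurable_simple[OF p] s kt)
      obtain \<phi> where \<phi>: "\<phi> \<in> borel_measurable M" "\<And>x. 0 \<le> \<phi> x"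
          "AE x in M. \<phi> x = schatten_norm p (s n x - scaleC_op (k x) (t n x))"
        by (rule schatten_norm_AE_measurable[OF p meas], rule that)
      have "(\<integral>\<^sup>+x. ennreal (schatten_norm p (s n x - scaleC_op (k x) (t n x))) * ennreal (norm y *
          norm z) \<partial>M)
          = (\<integral>\<^sup>+x. ennreal (\<phi> x) * ennreal (norm y * norm z) \<partial>M)"
        using \<phi>(3) by (intro nn_integral_cong_AE) auto
      also have "\<dots> = (\<integral>\<^sup>+x. ennreal (\<phi> x) \<partial>M) * ennreal (norm y * norm z)"
        using \<phi>(1) by (intro nn_integral_multc) auto
      also have "(\<integral>\<^sup>+x. ennreal (\<phi> x) \<partial>M) = (\<integral>\<^sup>+x. schatten_norm p (s n x - scaleC_op (k x) (t n x)) \<partial>M)"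
        using \<phi>(3) by (intro nn_integral_cong_AE) auto
      finally show ?thesis .
    qed
    also have "\<dots> \<le> ((\<integral>\<^sup>+x. schatten_norm p (?kF x - s n x) \<partial>M)
      + (\<integral>\<^sup>+x. schatten_norm p (?kF x - scaleC_op (k x) (t n x)) \<partial>M)) * ennreal (norm y * norm z)"
      by (intro mult_right_mono nn_integral_schatten_triangle[OF p kF] kt
          schatten_strongly_measurable_simple[OF p s(1) s(2)])
        simp_all
    also have "\<dots> \<le> ((\<integral>\<^sup>+x. schatten_norm p (?kF x - s n x) \<partial>M)
      + (\<integral>\<^sup>+x. schatten_norm p (F x - t n x) \<partial>M)) * ennreal (norm y * norm z)"
    proof (intro mult_right_mono[OF _ zero_le] add_left_mono nn_integral_mono ennreal_leI)
      fix x assume x: "x \<in> space M"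
      have diff: "F x - t n x \<in> schatten_class p"
        using schatten_strongly_measurable_class[OF p F x] t(2)[OF x] by (rule schatten_class_diff[OF p])
      have "?kF x - scaleC_op (k x) (t n x) = scaleC_op (k x) (F x - t n x)"
        by (rule blinfun_eqI) (simp add: scaleC_op_apply blinfun.diff_left scaleC_diff_right)
      then have "schatten_norm p (?kF x - scaleC_op (k x) (t n x))
          \<le> cmod (k x) * schatten_norm p (F x - t n x)"
        using schatten_norm_scaleC_le[OF p diff] by simp
      also have "\<dots> \<le> schatten_norm p (F x - t n x)"
        using k(2) by (simp add: mult_left_le_one_le schatten_norm_nonneg[OF p])
      finally show "schatten_norm p (?kF x - scaleC_op (k x) (t n x)) \<le> schatten_norm p (F x - t n x)" .
    qed
    finally show ?thesis .
  qed
  have "D \<longlonglongrightarrow> 0"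
  proof -
    have "(\<lambda>n. ((\<integral>\<^sup>+x. schatten_norm p (?kF x - s n x) \<partial>M)
      + (\<integral>\<^sup>+x. schatten_norm p (F x - t n x) \<partial>M)) * ennreal (norm y * norm z)) \<longlonglongrightarrow> (0
          + 0) * ennreal (norm y * norm z)"
      by (intro tendsto_mult_ennreal tendsto_add tendsto_const s(3) t_lim) auto
    then have up: "(\<lambda>n. ((\<integral>\<^sup>+x. schatten_norm p (?kF x - s n x) \<partial>M)
      + (\<integral>\<^sup>+x. schatten_norm p (F x - t n x) \<partial>M)) * ennreal (norm y * norm z)) \<longlonglongrightarrow> 0"
      by simp
    have "(\<lambda>n. ennreal (cmod (D n))) \<longlonglongrightarrow> 0"
      by (rule tendsto_sandwich[OF _ _ tendsto_const up]) (use D_le in auto)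
    then have "(\<lambda>n. cmod (D n)) \<longlonglongrightarrow> 0"
      by (simp add: tendsto_ennreal_iff[of _ _ 0, simplified] flip: ennreal_0)
    then show ?thesis
      by (rule tendsto_norm_zero_cancel)
  qed
  with Slim have "(\<lambda>n. cinner y (S n z) - D n) \<longlonglongrightarrow> cinner y (I z) - 0"
    by (rule tendsto_diff)
  then show ?thesis
    by (simp add: S_int D_def)
qed

end

section \<open>Interpolation\<close>

text \<open>After division by \<open>A^(1-z) B^z\<close> both boundary bounds are \<open>1\<close>. The factor \<open>exp (\<epsilon> (z^2 - 1))\<close>
  decays in the strip, so that the maximum principle applies on a large rectangle; then \<open>\<epsilon>\<close> tends to
  \<open>0\<close>.\<close>

theorem hadamard_three_lines:
  fixes f :: "complex \<Rightarrow> complex"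
  assumes f: "f holomorphic_on UNIV"
    and bound: "\<And>z. 0 \<le> Re z \<Longrightarrow> Re z \<le> 1 \<Longrightarrow> cmod (f z) \<le> C"
    and left: "\<And>z. Re z = 0 \<Longrightarrow> cmod (f z) \<le> A" and right: "\<And>z. Re z = 1 \<Longrightarrow> cmod (f z) \<le> B"
    and pos: "0 < A" "0 < B" and z: "0 \<le> Re z" "Re z \<le> 1"
  shows "cmod (f z) \<le> A powr (1 - Re z) * B powr Re z"
proof -
  define g where "g w = f w * exp (- ((1 - w) * of_real (ln A) + w * of_real (ln B)))" for w
  have g_norm: "cmod (g w) = cmod (f w) / (A powr (1 - Re w) * B powr Re w)" for w
  proof -
    have "Re (- ((1 - w) * of_real (ln A) + w * of_real (ln B))) = - ((1 - Re w) * ln A + Re w * ln B)"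
      by simp
    then show ?thesis
      unfolding g_def norm_mult norm_exp_eq_Re
      using pos by (simp only: exp_minus exp_add powr_def divide_inverse) simp
  qed
  \<comment> \<open>\<open>A^(1-x) B^x\<close> is at least \<open>min 1 A * min 1 B\<close> for \<open>x\<close> in \<open>[0, 1]\<close>.\<close>
  define C' where "C' = max 1 (C / (min 1 A * min 1 B))"
  have g_bound: "cmod (g w) \<le> C'" if w: "0 \<le> Re w" "Re w \<le> 1" for w
  proof -
    have low: "min 1 a \<le> a powr r" if "0 < a" "0 \<le> r" "r \<le> 1" for a r :: real
    proof (cases "a \<le> 1")
      case True
      then have "a powr 1 \<le> a powr r"
        using that by (intro powr_mono') auto
      then show ?thesis
        using True that by simp
    next
      case False
      then have "1 \<le> a powr r"
        using that by (simp add: ge_one_powr_ge_zero)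
      then show ?thesis
        by simp
    qed
    have "min 1 A * min 1 B \<le> A powr (1 - Re w) * B powr Re w"
      using w pos by (intro mult_mono low) auto
    moreover have "0 < min 1 A * min 1 B"
      using pos by simp
    ultimately have "cmod (g w) \<le> C / (min 1 A * min 1 B)"
      unfolding g_norm using bound[OF w] by (intro frac_le) (auto intro: order_trans[OF norm_ge_zero])
    then show ?thesis
      by (simp add: C'_def)
  qed
  have g_edge: "cmod (g w) \<le> 1" if "Re w = 0 \<or> Re w = 1" for w
    using that left[of w] right[of w] pos by (auto simp: g_norm)
  define ge where "ge \<epsilon> w = g w * exp (of_real \<epsilon> * (w\<^sup>2 - 1))" for \<epsilon> :: real and w
  have ge_norm: "cmod (ge \<epsilon> w) = cmod (g w) * exp (\<epsilon> * ((Re w)\<^sup>2 - (Im w)\<^sup>2 - 1))" for \<epsilon> w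
    by (simp add: ge_def norm_mult power2_eq_square)
  have ge_le: "cmod (ge \<epsilon> z) \<le> 1" if \<epsilon>: "0 < \<epsilon>" for \<epsilon>
  proof -
    \<comment> \<open>At height \<open>R\<close> the decay \<open>exp (- \<epsilon> R^2)\<close> outweighs the bound \<open>C'\<close> of \<open>g\<close>.\<close>
    define R where "R = \<bar>Im z\<bar> + 1 + ln C' / \<epsilon>"
    have "C' \<ge> 1"
      by (simp add: C'_def)
    then have "0 \<le> ln C' / \<epsilon>"
      using \<epsilon> by simp
    then have R: "\<bar>Im z\<bar> \<le> R" "1 \<le> R" "ln C' / \<epsilon> \<le> R"
      unfolding R_def by linarith+
    have "ln C' / \<epsilon> \<le> R\<^sup>2"
      using R(2,3) self_le_power[of R 2] by linarith
    then have R2: "ln C' \<le> \<epsilon> * R\<^sup>2"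
      using \<epsilon> by (simp add: field_simps)
    define S where "S = cbox (Complex 0 (- R)) (Complex 1 R)"
    show ?thesis
    proof (rule maximum_modulus_frontier[of "ge \<epsilon>" S 1 z])
      have holo: "ge \<epsilon> holomorphic_on UNIV"
        unfolding ge_def g_def by (intro holomorphic_intros f)
      show "ge \<epsilon> holomorphic_on interior S"
        using holo by (rule holomorphic_on_subset) simp
      show "continuous_on (closure S) (ge \<epsilon>)"
        using holomorphic_on_imp_continuous_on[OF holo] by (rule continuous_on_subset) simp
      show "bounded S"
        by (simp add: S_def)
      show "z \<in> S"
        using z R(1) by (auto simp: S_def in_cbox_complex_iff)
      fix w assume "w \<in> frontier S"
      then have "w \<in> S" "w \<notin> box (Complex 0 (- R)) (Complex 1 R)"
        by (auto simp: S_def frontier_def interior_cbox)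
      then have w: "0 \<le> Re w" "Re w \<le> 1" "\<bar>Im w\<bar> \<le> R" and "Re w = 0 \<or> Re w = 1 \<or> \<bar>Im w\<bar> = R"
        by (auto simp: S_def in_cbox_complex_iff in_box_complex_iff)
      then consider "Re w = 0 \<or> Re w = 1" | "\<bar>Im w\<bar> = R"
        by blast
      then show "cmod (ge \<epsilon> w) \<le> 1"
      proof cases
        case 1
        then have "(Re w)\<^sup>2 \<le> 1"
          by auto
        then have "(Re w)\<^sup>2 - (Im w)\<^sup>2 - 1 \<le> 0"
          using zero_le_power2[of "Im w"] by linarith
        then have "\<epsilon> * ((Re w)\<^sup>2 - (Im w)\<^sup>2 - 1) \<le> 0"
          using \<epsilon> by (intro mult_nonneg_nonpos) auto
        then show ?thesis
          unfolding ge_norm using g_edge[OF 1] by (intro mult_le_one) auto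
      next
        case 2
        have "(Re w)\<^sup>2 \<le> 1"
          using w by (simp add: abs_square_le_1)
        then have "\<epsilon> * ((Re w)\<^sup>2 - (Im w)\<^sup>2 - 1) \<le> \<epsilon> * (- R\<^sup>2)"
          using \<epsilon> power2_abs[of "Im w"] 2 by (intro mult_left_mono) auto
        also have "\<dots> \<le> - ln C'"
          using R2 by simp
        finally have "exp (\<epsilon> * ((Re w)\<^sup>2 - (Im w)\<^sup>2 - 1)) \<le> exp (- ln C')"
          by simp
        also have "\<dots> = 1 / C'"
          using \<open>C' \<ge> 1\<close> by (simp add: exp_minus divide_inverse)
        finally have "cmod (ge \<epsilon> w) \<le> C' * (1 / C')"
          unfolding ge_norm using g_bound[OF w(1,2)] \<open>C' \<ge> 1\<close> by (intro mult_mono) auto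
        then show ?thesis
          using \<open>C' \<ge> 1\<close> by simp
      qed
    qed
  qed
  have "((\<lambda>\<epsilon>. cmod (ge \<epsilon> z)) \<longlongrightarrow> cmod (ge 0 z)) (at_right 0)"
    unfolding ge_norm by (intro tendsto_intros)
  then have "cmod (ge 0 z) \<le> 1"
    by (rule tendsto_upperbound) (auto intro!: ge_le eventually_at_rightI[of 0 1])
  then have "cmod (g z) \<le> 1"
    by (simp add: ge_norm)
  then show ?thesis
    using pos by (simp add: g_norm divide_le_eq)
qed

definition strip_bounded :: "(complex \<Rightarrow> complex) \<Rightarrow> bool" where
  "strip_bounded f \<longleftrightarrow> (\<exists>C. \<forall>z. 0 \<le> Re z \<longrightarrow> Re z \<le> 1 \<longrightarrow> cmod (f z) \<le> C)"

lemma strip_bounded_const: "strip_bounded (\<lambda>z. c)"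
  by (auto simp: strip_bounded_def)

lemma strip_bounded_mult: "strip_bounded f \<Longrightarrow> strip_bounded g \<Longrightarrow> strip_bounded (\<lambda>z. f z * g z)"
  unfolding strip_bounded_def norm_mult by (meson mult_mono' norm_ge_zero)

lemma strip_bounded_sum: "(\<And>i. i \<in> I \<Longrightarrow> strip_bounded (f i)) \<Longrightarrow> strip_bounded (\<lambda>z. \<Sum>i\<in>I. f i z)"
proof (induction I rule: infinite_finite_induct)
  case (insert i I)
  then obtain C D where "\<And>z. 0 \<le> Re z \<Longrightarrow> Re z \<le> 1 \<Longrightarrow> cmod (f i z) \<le> C"
    "\<And>z. 0 \<le> Re z \<Longrightarrow> Re z \<le> 1 \<Longrightarrow> cmod (\<Sum>i\<in>I. f i z) \<le> D"
    unfolding strip_bounded_def by (metis insertCI)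
  then have "cmod (\<Sum>i\<in>insert i I. f i z) \<le> C + D" if "0 \<le> Re z" "Re z \<le> 1" for z
    using insert.hyps that norm_triangle_mono[of "f i z" C "\<Sum>i\<in>I. f i z" D] by simp
  then show ?case
    unfolding strip_bounded_def by blast
qed (simp_all add: strip_bounded_const)

lemma strip_bounded_exp: "strip_bounded (\<lambda>z. exp (complex_of_real u + z * complex_of_real v))"
  unfolding strip_bounded_def
proof (intro exI allI impI)
  fix z assume "0 \<le> Re z" "Re z \<le> 1"
  then have "Re z * v \<le> Re z * \<bar>v\<bar>" "Re z * \<bar>v\<bar> \<le> \<bar>v\<bar>"
    by (auto intro: mult_left_mono simp: mult_left_le_one_le)
  then show "cmod (exp (complex_of_real u + z * complex_of_real v)) \<le> exp (u + \<bar>v\<bar>)"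
    by simp
qed

text \<open>Riesz-Thorin interpolation for a matrix with finitely many entries, from a weighted \<open>\<ell>\<^sup>q(\<ell>\<^sup>p)\<close>
  norm to \<open>\<ell>\<^sup>p\<close>, between the endpoints \<open>\<ell>\<^sup>2(\<ell>\<^sup>2) \<rightarrow> \<ell>\<^sup>2\<close> and \<open>\<ell>\<^sup>1(\<ell>\<^sup>\<infinity>) \<rightarrow> \<ell>\<^sup>\<infinity>\<close>. The input \<open>s j i\<close> is
  embedded in the family \<open>s j i ^ (p (1 - z) / 2) * N j ^ ((1 - z) (q - p) / 2 + z q)\<close>, where \<open>N j\<close> is
  the \<open>\<ell>\<^sup>p\<close> norm of \<open>s j\<close>, and the dual element \<open>cnj (sgn (a k)) * |a k| ^ (p - 1)\<close> in \<open>cnj (sgn (a k))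
  * |a k| ^ (p (1 + z) / 2)\<close>; both give back the original at \<open>z = 1 - 2 / p\<close>.\<close>

theorem finite_riesz_thorin:
  fixes m :: "'k \<Rightarrow> 'j \<Rightarrow> 'i \<Rightarrow> complex" and s :: "'j \<Rightarrow> 'i \<Rightarrow> real" and w :: "'j \<Rightarrow> real"
  assumes fin: "finite K" "finite J" "\<And>j. j \<in> J \<Longrightarrow> finite (I j)"
    and w: "\<And>j. j \<in> J \<Longrightarrow> 0 \<le> w j" and s: "\<And>j i. j \<in> J \<Longrightarrow> i \<in> I j \<Longrightarrow> 0 < s j i"
    and L2: "\<And>c. (\<Sum>k\<in>K. (cmod (\<Sum>j\<in>J. \<Sum>i\<in>I j. m k j i * c j i))\<^sup>2)
        \<le> (\<Sum>j\<in>J. w j * (\<Sum>i\<in>I j. (cmod (c j i))\<^sup>2))"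
    and Linf: "\<And>c b k. k \<in> K \<Longrightarrow> (\<And>j i. j \<in> J \<Longrightarrow> i \<in> I j \<Longrightarrow> cmod (c j i) \<le> b j) \<Longrightarrow>
        (\<And>j. j \<in> J \<Longrightarrow> 0 \<le> b j) \<Longrightarrow> cmod (\<Sum>j\<in>J. \<Sum>i\<in>I j. m k j i * c j i) \<le> (\<Sum>j\<in>J. w j * b j)"
    and p: "2 \<le> p" and q: "q = p / (p - 1)"
  shows "(\<Sum>k\<in>K. cmod (\<Sum>j\<in>J. \<Sum>i\<in>I j. m k j i * s j i) powr p)
    \<le> (\<Sum>j\<in>J. w j * (\<Sum>i\<in>I j. s j i powr p) powr (q / p)) powr (p / q)"
proof -
  define a where "a k = (\<Sum>j\<in>J. \<Sum>i\<in>I j. m k j i * s j i)" for k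
  define N where "N j = (\<Sum>i\<in>I j. s j i powr p) powr (1 / p)" for j
  define L where "L = (\<Sum>k\<in>K. cmod (a k) powr p)"
  define \<Omega> where "\<Omega> = (\<Sum>j\<in>J. w j * N j powr q)"
  have q0: "0 < q" and pq: "1 / p + 1 / q = 1"
    using p by (auto simp: q field_simps)
  have \<Omega>_eq: "\<Omega> = (\<Sum>j\<in>J. w j * (\<Sum>i\<in>I j. s j i powr p) powr (q / p))"
    by (simp add: \<Omega>_def N_def powr_powr)
  have Np: "N j powr p = (\<Sum>i\<in>I j. s j i powr p)" for j
    using p by (simp add: N_def powr_powr sum_nonneg)
  have Npos: "0 < N j" if "j \<in> J" "i \<in> I j" for i j
  proof -
    have "0 < s j i' powr p" if "i' \<in> I j" for i'
      using s[OF \<open>j \<in> J\<close> that] by simp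
    then have "0 < (\<Sum>i\<in>I j. s j i powr p)"
      using fin(3)[OF that(1)] that by (intro sum_pos) auto
    then show ?thesis
      by (simp add: N_def)
  qed
  have "0 \<le> L" "0 \<le> \<Omega>"
    using w by (auto simp: L_def \<Omega>_def intro!: sum_nonneg)
  have "L \<le> \<Omega> powr (p / q)"
  proof (cases "L = 0 \<or> \<Omega> = 0")
    case True
    moreover have "L = 0" if "\<Omega> = 0"
    proof -
      have zero: "w j * N j powr q = 0" if "j \<in> J" for j
        using \<open>\<Omega> = 0\<close> fin(2) w that by (auto simp: \<Omega>_def sum_nonneg_eq_0_iff)
      have vanish: "w j * (\<Sum>i\<in>I j. (cmod (complex_of_real (s j i)))\<^sup>2) = 0" if j: "j \<in> J" for j
      proof (cases "I j = {}")
        case False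
        then have "N j \<noteq> 0"
          using Npos[OF j] by fastforce
        then show ?thesis
          using zero[OF j] by simp
      qed simp
      have "(\<Sum>k\<in>K. (cmod (a k))\<^sup>2) \<le> (\<Sum>j\<in>J. w j * (\<Sum>i\<in>I j. (cmod (complex_of_real (s j i)))\<^sup>2))"
        unfolding a_def by (rule L2)
      also have "\<dots> = 0"
        using vanish by (rule sum.neutral[OF ballI])
      finally have "(\<Sum>k\<in>K. (cmod (a k))\<^sup>2) \<le> 0" .
      then have "(\<Sum>k\<in>K. (cmod (a k))\<^sup>2) = 0"
        by (intro antisym sum_nonneg) auto
      then show "L = 0"
        using fin(1) by (simp add: sum_nonneg_eq_0_iff L_def)
    qed
    ultimately show ?thesis
      by auto
  next
    case False
    with \<open>0 \<le> L\<close> \<open>0 \<le> \<Omega>\<close> have Lpos: "0 < L" and \<Omega>pos: "0 < \<Omega>"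
      by simp_all
    define c where "c z j i = exp (complex_of_real (p / 2 * ln (s j i) + (q - p) / 2 * ln (N j))
      + z * complex_of_real (- (p / 2) * ln (s j i) + (q + p) / 2 * ln (N j)))" for z j i
    define b where "b z k = (if a k = 0 then 0 else cnj (sgn (a k)) *
      exp (complex_of_real (p / 2 * ln (cmod (a k)))
          + z * complex_of_real (p / 2 * ln (cmod (a k)))))" for z k
    define G where "G z k = (\<Sum>j\<in>J. \<Sum>i\<in>I j. m k j i * c z j i)" for z k
    define \<Phi> where "\<Phi> z = (\<Sum>k\<in>K. b z k * G z k)" for z
    define \<theta> where "\<theta> = 1 - 2 / p"
    have \<theta>: "0 \<le> \<theta>" "\<theta> \<le> 1"
      using p by (auto simp: \<theta>_def field_simps)
    have c_norm: "cmod (c z j i) = exp (p / 2 * ln (s j i) + (q - p) / 2 * ln (N j)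
        + Re z * (- (p / 2) * ln (s j i) + (q + p) / 2 * ln (N j)))" for z j i
      unfolding c_def norm_exp_eq_Re by simp
    have exp_holo: "(\<lambda>z. exp (complex_of_real u + z * complex_of_real v)) holomorphic_on UNIV" for u v
      by (intro holomorphic_intros)
    have b: "(\<lambda>z. b z k) holomorphic_on UNIV \<and> strip_bounded (\<lambda>z. b z k)" for k
    proof (cases "a k = 0")
      case False
      then have "(\<lambda>z. b z k) = (\<lambda>z. cnj (sgn (a k)) *
          exp (complex_of_real (p / 2 * ln (cmod (a k))) + z * complex_of_real (p / 2 * ln (cmod (a k)))))"
        unfolding b_def by (simp only: if_False)
      then show ?thesis
        by (simp only: holomorphic_on_mult[OF holomorphic_on_const exp_holo]
            strip_bounded_mult[OF strip_bounded_const strip_bounded_exp])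
    qed (simp add: b_def strip_bounded_const)
    have G: "(\<lambda>z. G z k) holomorphic_on UNIV" "strip_bounded (\<lambda>z. G z k)" for k
      unfolding G_def c_def
      by (intro holomorphic_on_sum holomorphic_on_mult holomorphic_on_const exp_holo)
        (intro strip_bounded_sum strip_bounded_mult[OF strip_bounded_const strip_bounded_exp])
    have holo: "\<Phi> holomorphic_on UNIV" and "strip_bounded \<Phi>"
      unfolding \<Phi>_def
      by (intro holomorphic_on_sum holomorphic_on_mult conjunct1[OF b] G(1))
        (intro strip_bounded_sum strip_bounded_mult[OF conjunct2[OF b] G(2)])
    from \<open>strip_bounded \<Phi>\<close> obtain C where C: "\<And>z. 0 \<le> Re z \<Longrightarrow> Re z \<le> 1 \<Longrightarrow> cmod (\<Phi> z) \<le> C"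
      unfolding strip_bounded_def by blast
    have b_norm: "cmod (b z k) = cmod (a k) powr (p / 2 * (1 + Re z))" for z k
      by (auto simp: b_def norm_mult norm_sgn powr_def algebra_simps)
    have left: "cmod (\<Phi> z) \<le> sqrt (L * \<Omega>)" if z: "Re z = 0" for z
    proof -
      have "(\<Sum>k\<in>K. (cmod (b z k))\<^sup>2) = L"
        by (simp add: L_def b_norm z power2_eq_square powr_add[symmetric])
      moreover have "(\<Sum>k\<in>K. (cmod (G z k))\<^sup>2) \<le> \<Omega>"
      proof -
        have c2: "(cmod (c z j i))\<^sup>2 = s j i powr p * N j powr (q - p)" if "j \<in> J" "i \<in> I j" for j i
        proof -
          have "cmod (c z j i) = s j i powr (p / 2) * N j powr ((q - p) / 2)"
            using s[OF that] Npos[OF that] by (simp add: c_norm z powr_def exp_add)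
          moreover have "(x powr (r / 2))\<^sup>2 = x powr r" for x r :: real
            by (simp add: power2_eq_square powr_add[symmetric])
          ultimately show ?thesis
            by (simp only: power_mult_distrib)
        qed
        have "(\<Sum>k\<in>K. (cmod (G z k))\<^sup>2) \<le> (\<Sum>j\<in>J. w j * (\<Sum>i\<in>I j. (cmod (c z j i))\<^sup>2))"
          unfolding G_def by (rule L2)
        also have "\<dots> = (\<Sum>j\<in>J. w j * (N j powr p * N j powr (q - p)))"
          unfolding Np by (simp add: c2 sum_distrib_right)
        also have "\<dots> = \<Omega>"
          by (simp add: \<Omega>_def powr_add[symmetric])
        finally show ?thesis .
      qed
      moreover have "(cmod (\<Phi> z))\<^sup>2 \<le> (\<Sum>k\<in>K. (cmod (b z k))\<^sup>2) * (\<Sum>k\<in>K. (cmod (G z k))\<^sup>2)"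
      proof -
        have "cmod (\<Phi> z) \<le> (\<Sum>k\<in>K. cmod (b z k) * cmod (G z k))"
          unfolding \<Phi>_def by (rule order_trans[OF norm_sum]) (simp add: norm_mult)
        then have "(cmod (\<Phi> z))\<^sup>2 \<le> (\<Sum>k\<in>K. cmod (b z k) * cmod (G z k))\<^sup>2"
          by (intro power_mono) auto
        also have "\<dots> \<le> (\<Sum>k\<in>K. (cmod (b z k))\<^sup>2) * (\<Sum>k\<in>K. (cmod (G z k))\<^sup>2)"
          by (rule Cauchy_Schwarz_ineq_sum)
        finally show ?thesis .
      qed
      ultimately have "(cmod (\<Phi> z))\<^sup>2 \<le> L * \<Omega>"
        using mult_left_mono[of "\<Sum>k\<in>K. (cmod (G z k))\<^sup>2" \<Omega> L] \<open>0 \<le> L\<close> by simp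
      then show ?thesis
        by (rule real_le_rsqrt)
    qed
    have right: "cmod (\<Phi> z) \<le> L * \<Omega>" if z: "Re z = 1" for z
    proof -
      have c1: "cmod (c z j i) \<le> N j powr q" if "j \<in> J" "i \<in> I j" for j i
        using s[OF that] Npos[OF that] by (simp add: c_norm z powr_def field_simps)
      have "cmod (\<Phi> z) \<le> (\<Sum>k\<in>K. cmod (b z k) * cmod (G z k))"
        unfolding \<Phi>_def by (rule order_trans[OF norm_sum]) (simp add: norm_mult)
      also have "\<dots> \<le> (\<Sum>k\<in>K. cmod (b z k) * \<Omega>)"
        unfolding G_def \<Omega>_def by (intro sum_mono mult_left_mono Linf c1) auto
      also have "\<dots> = L * \<Omega>"
        by (simp add: b_norm z L_def sum_distrib_right)
      finally show ?thesis .
    qed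
    have at_\<theta>: "\<Phi> (complex_of_real \<theta>) = complex_of_real L"
    proof -
      have "c (complex_of_real \<theta>) j i = complex_of_real (s j i)" if "j \<in> J" "i \<in> I j" for j i
      proof -
        have regroup: "h * x + u * y + \<theta> * (- h * x + v * y) = h * (1 - \<theta>) * x + (u + \<theta> * v) * y"
          for h u v x y
          by (simp add: algebra_simps)
        have "p / 2 * (1 - \<theta>) = 1"
          using p by (simp add: \<theta>_def)
        moreover have "(q - p) / 2 + \<theta> * ((q + p) / 2) = 0"
          using p by (simp add: \<theta>_def q field_simps)
        ultimately have "p / 2 * x + (q - p) / 2 * y + \<theta> * (- (p / 2) * x + (q + p) / 2 * y) = x" for x y
          by (simp only: regroup mult_1 mult_zero_left add_0_right)
        from this[of "ln (s j i)" "ln (N j)"] have "c (complex_of_real \<theta>) j i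
            = exp (complex_of_real (ln (s j i)))"
          unfolding c_def by (simp only: of_real_mult[symmetric] of_real_add[symmetric])
        then show ?thesis
          using s[OF that] by (simp only: exp_of_real exp_ln)
      qed
      then have "G (complex_of_real \<theta>) k = a k" for k
        by (simp add: G_def a_def)
      moreover have "b (complex_of_real \<theta>) k * a k = complex_of_real (cmod (a k) powr p)" for k
      proof (cases "a k = 0")
        case nz: False
        have "p / 2 * x + \<theta> * (p / 2 * x) = (p - 1) * x" for x
          using p by (simp add: \<theta>_def field_simps)
        then have "b (complex_of_real \<theta>) k = cnj (sgn (a k)) * exp (complex_of_real ((p - 1) * ln
            (cmod (a k))))"
          unfolding b_def using nz by (simp only: of_real_mult[symmetric] of_real_add[symmetric]) simp
        also have "exp (complex_of_real ((p - 1) * ln (cmod (a k))))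
            = complex_of_real (cmod (a k) powr (p - 1))"
          using nz by (simp only: powr_def exp_of_real norm_eq_zero if_False)
        finally have "b (complex_of_real \<theta>) k * a k
            = cnj (sgn (a k)) * a k * complex_of_real (cmod (a k) powr (p - 1))"
          by (simp add: mult_ac)
        also have "\<dots> = complex_of_real (cmod (a k) powr 1 * cmod (a k) powr (p - 1))"
          by (simp add: cnj_sgn_mult)
        also have "cmod (a k) powr 1 * cmod (a k) powr (p - 1) = cmod (a k) powr p"
          by (simp only: powr_add[symmetric]) simp
        finally show ?thesis .
      qed (simp add: b_def)
      ultimately show ?thesis
        by (simp add: \<Phi>_def L_def)
    qed
    have LO: "0 < L * \<Omega>"
      using Lpos \<Omega>pos by simp
    have "L \<le> sqrt (L * \<Omega>) powr (1 - \<theta>) * (L * \<Omega>) powr \<theta>"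
      using hadamard_three_lines[OF holo C left right, of "complex_of_real \<theta>"] \<theta> LO \<open>0 \<le> L\<close>
          by (simp add: at_\<theta>)
    also have "sqrt (L * \<Omega>) = (L * \<Omega>) powr (1 / 2)"
      using LO by (simp add: powr_half_sqrt)
    also have "((L * \<Omega>) powr (1 / 2)) powr (1 - \<theta>) * (L * \<Omega>) powr \<theta> = (L * \<Omega>) powr (1 / 2 * (1 - \<theta>) + \<theta>)"
      by (simp only: powr_powr powr_add[symmetric])
    also have "1 / 2 * (1 - \<theta>) + \<theta> = 1 / q"
      using pq by (simp add: \<theta>_def field_simps)
    also have "(L * \<Omega>) powr (1 / q) = L powr (1 / q) * \<Omega> powr (1 / q)"
      using Lpos \<Omega>pos by (simp add: powr_mult)
    finally have "L powr 1 / L powr (1 / q) \<le> \<Omega> powr (1 / q)"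
      using Lpos by (simp add: divide_le_eq mult.commute)
    then have "L powr (1 / p) \<le> \<Omega> powr (1 / q)"
      using pq by (simp only: powr_diff[symmetric]) (metis add_diff_cancel_right')
    then have "(L powr (1 / p)) powr p \<le> (\<Omega> powr (1 / q)) powr p"
      using p by (intro powr_mono2) auto
    then show ?thesis
      using p Lpos by (simp add: powr_powr)
  qed
  then show ?thesis
    by (simp add: L_def a_def \<Omega>_eq)
qed

section \<open>Characters of a compact abelian group\<close>

lemma character_norm: "k \<in> pontryagin_dual \<Longrightarrow> cmod (k x) = 1"
  by (simp add: pontryagin_dual_def)

definition fourier_coeff_indicator :: "'g measure \<Rightarrow> ('g \<Rightarrow> complex) \<Rightarrow> 'g set \<Rightarrow> complex" where
  "fourier_coeff_indicator \<mu> k E = (\<integral>x. cnj (k x) * indicator E x \<partial>\<mu>)"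

context
  fixes \<mu> :: "'g::{topological_ab_group_add, t2_space} measure"
  assumes haar: "normalized_haar_measure \<mu>"
begin

lemma haar_sets: "sets \<mu> = sets borel"
  using haar by (simp add: normalized_haar_measure_def)

lemma haar_space: "space \<mu> = UNIV"
  using sets_eq_imp_space_eq[OF haar_sets] by simp

lemma haar_measure_UNIV: "measure \<mu> UNIV = 1"
  using haar by (simp add: normalized_haar_measure_def measure_def)

lemma haar_finite_measure: "finite_measure \<mu>"
  using haar by (intro finite_measureI) (simp add: normalized_haar_measure_def haar_space)

lemma haar_measurable_continuous:
  "continuous_on UNIV f \<Longrightarrow> f \<in> borel_measurable \<mu>"
  using borel_measurable_continuous_onI[of f] by (simp cong: measurable_cong_sets add: haar_sets)

lemma haar_integrable_bounded:
  fixes f :: "'g \<Rightarrow> complex"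
  assumes "f \<in> borel_measurable \<mu>" "\<And>x. cmod (f x) \<le> C"
  shows "integrable \<mu> f"
proof -
  interpret finite_measure \<mu>
    by (rule haar_finite_measure)
  show ?thesis
    using assms by (intro integrable_const_bound[of _ C]) auto
qed

lemma haar_integral_translate:
  fixes f :: "'g \<Rightarrow> complex"
  assumes f: "f \<in> borel_measurable \<mu>"
  shows "(\<integral>x. f (g + x) \<partial>\<mu>) = (\<integral>x. f x \<partial>\<mu>)"
proof -
  have cont: "continuous_on UNIV ((+) g)"
    by (intro continuous_intros)
  have meas: "(+) g \<in> measurable \<mu> \<mu>"
    using haar_measurable_continuous[OF cont] by (simp cong: measurable_cong_sets add: haar_sets)
  have "distr \<mu> \<mu> ((+) g) = \<mu>"
  proof (rule measure_eqI)
    fix A assume "A \<in> sets (distr \<mu> \<mu> ((+) g))"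
    then have A: "A \<in> sets \<mu>" "A \<in> sets borel"
      by (simp_all add: haar_sets)
    have "(+) g -` A = (+) (- g) ` A"
      by (auto simp: image_iff intro!: bexI[of _ "g + _"])
    then have "emeasure (distr \<mu> \<mu> ((+) g)) A = emeasure \<mu> ((+) (- g) ` A)"
      using A meas by (simp add: emeasure_distr haar_space)
    also have "\<dots> = emeasure \<mu> A"
      using haar A(2) unfolding normalized_haar_measure_def by blast
    finally show "emeasure (distr \<mu> \<mu> ((+) g)) A = emeasure \<mu> A" .
  qed simp
  then show ?thesis
    using integral_distr[OF meas f] by simp
qed

lemma character_measurable: "k \<in> pontryagin_dual \<Longrightarrow> k \<in> borel_measurable \<mu>"
  by (intro haar_measurable_continuous) (simp add: pontryagin_dual_def)

lemma character_measurable_cnj: "k \<in> pontryagin_dual \<Longrightarrow> (\<lambda>x. cnj (k x)) \<in> borel_measurable \<mu>"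
  by (intro haar_measurable_continuous continuous_on_cnj) (simp add: pontryagin_dual_def)

text \<open>If \<open>k \<noteq> l\<close>, translation by some \<open>g\<close> multiplies the integral of \<open>k * cnj l\<close> by \<open>k g * cnj (l g) \<noteq>
  1\<close> without changing it.\<close>

lemma character_orthogonality:
  assumes k: "k \<in> pontryagin_dual" and l: "l \<in> pontryagin_dual"
  shows "(\<integral>x. k x * cnj (l x) \<partial>\<mu>) = (if k = l then 1 else 0)"
proof (cases "k = l")
  case True
  then have "k x * cnj (l x) = 1" for x
    using character_norm[OF l, of x] by (simp add: complex_norm_square[symmetric])
  then show ?thesis
    using True by (simp add: haar_space haar_measure_UNIV)
next
  case False
  then obtain g where "k g \<noteq> l g"
    by auto
  have "k g * cnj (l g) \<noteq> 1"
  proof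
    assume "k g * cnj (l g) = 1"
    then have "k g * (cnj (l g) * l g) = l g"
      by (simp add: mult.assoc[symmetric])
    moreover have "cnj (l g) * l g = 1"
      using character_norm[OF l, of g] by (simp add: complex_norm_square[symmetric] mult.commute)
    ultimately show False
      using \<open>k g \<noteq> l g\<close> by simp
  qed
  have meas: "(\<lambda>x. k x * cnj (l x)) \<in> borel_measurable \<mu>"
    using character_measurable[OF k] character_measurable_cnj[OF l] by measurable
  have "(\<integral>x. k x * cnj (l x) \<partial>\<mu>) = (\<integral>x. k (g + x) * cnj (l (g + x)) \<partial>\<mu>)"
    by (rule haar_integral_translate[OF meas, symmetric])
  also have "\<dots> = (\<integral>x. (k g * cnj (l g)) * (k x * cnj (l x)) \<partial>\<mu>)"
    using k l by (simp add: pontryagin_dual_def mult_ac)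
  also have "\<dots> = (k g * cnj (l g)) * (\<integral>x. k x * cnj (l x) \<partial>\<mu>)"
    by (rule integral_mult_right_zero)
  finally have "(1 - k g * cnj (l g)) * (\<integral>x. k x * cnj (l x) \<partial>\<mu>) = 0"
    by (simp add: left_diff_distrib)
  then show ?thesis
    using False \<open>k g * cnj (l g) \<noteq> 1\<close> by simp
qed

text \<open>The squared \<open>L\<^sup>2\<close> distance from \<open>f\<close> to its orthogonal projection \<open>h\<close> is nonnegative.\<close>

lemma bessel_characters:
  assumes K: "finite K" "K \<subseteq> pontryagin_dual"
    and f: "f \<in> borel_measurable \<mu>" "\<And>x. cmod (f x) \<le> C"
  shows "(\<Sum>k\<in>K. (cmod (\<integral>x. cnj (k x) * f x \<partial>\<mu>))\<^sup>2) \<le> (\<integral>x. (cmod (f x))\<^sup>2 \<partial>\<mu>)"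
proof -
  define c where "c k = (\<integral>x. cnj (k x) * f x \<partial>\<mu>)" for k
  define h where "h x = (\<Sum>k\<in>K. c k * k x)" for x
  have meas[measurable]: "f \<in> borel_measurable \<mu>" "(\<lambda>x. cnj (f x)) \<in> borel_measurable \<mu>"
    using f(1) by (auto intro: borel_measurable_continuous_on[OF continuous_on_cnj[OF continuous_on_id]])
  have kmeas[measurable]: "k \<in> borel_measurable \<mu>" "(\<lambda>x. cnj (k x)) \<in> borel_measurable \<mu>" if "k \<in> K" for k
    using K that by (auto intro: character_measurable character_measurable_cnj)
  have kn: "cmod (k x) = 1" if "k \<in> K" for k x
    using K that by (auto intro: character_norm)
  have f2: "cmod (f x) * cmod (f x) \<le> C * C" for x
    using f(2)[of x] by (intro mult_mono) (auto intro: order_trans[OF norm_ge_zero])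
  have I1: "integrable \<mu> (\<lambda>x. f x * cnj (f x))"
    by (rule haar_integrable_bounded[of _ "C * C"]) (use f2 in \<open>auto simp: norm_mult\<close>)
  have I2: "integrable \<mu> (\<lambda>x. k x * cnj (f x))" "integrable \<mu> (\<lambda>x. cnj (k x) * f x)" if "k \<in> K" for k
    by (rule haar_integrable_bounded[of _ C]; use f(2) kn[OF that] kmeas[OF that] in \<open>simp add: norm_mult\<close>)+
  have I3: "integrable \<mu> (\<lambda>x. k x * cnj (l x))" if "k \<in> K" "l \<in> K" for k l
    by (rule haar_integrable_bounded[of _ 1]) (use kn that kmeas[OF that(1)] kmeas[OF that(2)] in
        \<open>auto simp: norm_mult\<close>)
  have cc: "(\<integral>x. k x * cnj (f x) \<partial>\<mu>) = cnj (c k)" if "k \<in> K" for k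
    unfolding c_def using integral_bounded_linear[OF bounded_linear_cnj I2(2)[OF that]] by simp
  have expand: "(f x - h x) * cnj (f x - h x) = f x * cnj (f x) - (\<Sum>k\<in>K. cnj (c k) * (cnj (k x) * f x))
      - (\<Sum>k\<in>K. c k * (k x * cnj (f x))) + (\<Sum>k\<in>K. \<Sum>l\<in>K. c k * cnj (c l) * (k x * cnj (l x)))" for x
  proof -
    have "h x * cnj (h x) = (\<Sum>k\<in>K. \<Sum>l\<in>K. c k * cnj (c l) * (k x * cnj (l x)))"
      unfolding h_def cnj_sum sum_product by (simp add: mult_ac)
    moreover have "f x * cnj (h x) = (\<Sum>k\<in>K. cnj (c k) * (cnj (k x) * f x))"
      unfolding h_def cnj_sum sum_distrib_left by (simp add: mult_ac)
    moreover have "h x * cnj (f x) = (\<Sum>k\<in>K. c k * (k x * cnj (f x)))"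
      unfolding h_def sum_distrib_right by (simp add: mult_ac)
    ultimately show ?thesis
      by (simp add: left_diff_distrib right_diff_distrib)
  qed
  have "complex_of_real (\<integral>x. (cmod (f x - h x))\<^sup>2 \<partial>\<mu>) = (\<integral>x. (f x - h x) * cnj (f x - h x) \<partial>\<mu>)"
    unfolding integral_complex_of_real[symmetric] complex_norm_square ..
  also have "\<dots> = (\<integral>x. f x * cnj (f x) \<partial>\<mu>) - (\<Sum>k\<in>K. cnj (c k) * c k) - (\<Sum>k\<in>K. c k * cnj (c k))
      + (\<Sum>k\<in>K. \<Sum>l\<in>K. c k * cnj (c l) * (\<integral>x. k x * cnj (l x) \<partial>\<mu>))"
    unfolding expand using I1 I2 I3
    by (simp add: Bochner_Integration.integral_diff Bochner_Integration.integral_add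
        Bochner_Integration.integral_sum cc c_def[symmetric])
  also have "(\<Sum>k\<in>K. \<Sum>l\<in>K. c k * cnj (c l) * (\<integral>x. k x * cnj (l x) \<partial>\<mu>)) = (\<Sum>k\<in>K. c k * cnj (c k))"
  proof (rule sum.cong[OF refl])
    fix k assume k: "k \<in> K"
    have "(\<Sum>l\<in>K. c k * cnj (c l) * (\<integral>x. k x * cnj (l x) \<partial>\<mu>)) = (\<Sum>l\<in>K. if l = k then c k * cnj (c k) else 0)"
      using K k by (intro sum.cong) (auto simp: character_orthogonality subset_iff)
    then show "(\<Sum>l\<in>K. c k * cnj (c l) * (\<integral>x. k x * cnj (l x) \<partial>\<mu>)) = c k * cnj (c k)"
      using K k by simp
  qed
  also have "(\<integral>x. f x * cnj (f x) \<partial>\<mu>) - (\<Sum>k\<in>K. cnj (c k) * c k) - (\<Sum>k\<in>K. c k * cnj (c k))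
      + (\<Sum>k\<in>K. c k * cnj (c k))
      = complex_of_real ((\<integral>x. (cmod (f x))\<^sup>2 \<partial>\<mu>) - (\<Sum>k\<in>K. (cmod (c k))\<^sup>2))"
    by (simp only: of_real_diff integral_complex_of_real[symmetric] of_real_sum complex_norm_square
        diff_add_cancel mult.commute)
  finally have "(\<integral>x. (cmod (f x - h x))\<^sup>2 \<partial>\<mu>) = (\<integral>x. (cmod (f x))\<^sup>2 \<partial>\<mu>) - (\<Sum>k\<in>K. (cmod (c k))\<^sup>2)"
    by (simp only: of_real_eq_iff)
  moreover have "0 \<le> (\<integral>x. (cmod (f x - h x))\<^sup>2 \<partial>\<mu>)"
    by (rule Bochner_Integration.integral_nonneg) simp
  ultimately show ?thesis
    by (simp add: c_def)
qed

lemma integrable_character_indicator: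
  assumes "k \<in> pontryagin_dual" "E \<in> sets \<mu>"
  shows "integrable \<mu> (\<lambda>x. cnj (k x) * indicator E x)"
proof (rule haar_integrable_bounded[of _ 1])
  show "(\<lambda>x. cnj (k x) * indicator E x) \<in> borel_measurable \<mu>"
    using character_measurable_cnj[OF assms(1)] assms(2) by measurable
qed (use character_norm[OF assms(1)] in \<open>simp add: norm_mult split: split_indicator\<close>)

lemma integral_character_step:
  assumes "k \<in> pontryagin_dual" "\<And>j. j \<in> J \<Longrightarrow> E j \<in> sets \<mu>"
  shows "(\<integral>x. cnj (k x) * (\<Sum>j\<in>J. indicator (E j) x * a j) \<partial>\<mu>)
      = (\<Sum>j\<in>J. fourier_coeff_indicator \<mu> k (E j) * a j)"
proof -
  have "(\<integral>x. cnj (k x) * (\<Sum>j\<in>J. indicator (E j) x * a j) \<partial>\<mu>)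
      = (\<integral>x. (\<Sum>j\<in>J. (cnj (k x) * indicator (E j) x) * a j) \<partial>\<mu>)"
    by (simp add: sum_distrib_left mult_ac)
  also have "\<dots> = (\<Sum>j\<in>J. \<integral>x. (cnj (k x) * indicator (E j) x) * a j \<partial>\<mu>)"
    using assms by (intro Bochner_Integration.integral_sum integrable_mult_left
        integrable_character_indicator)
  finally show ?thesis
    by (simp add: fourier_coeff_indicator_def)
qed

lemma cmod_fourier_coeff_indicator_le:
  assumes "k \<in> pontryagin_dual" "E \<in> sets \<mu>"
  shows "cmod (fourier_coeff_indicator \<mu> k E) \<le> measure \<mu> E"
proof -
  have "cmod (fourier_coeff_indicator \<mu> k E) \<le> (\<integral>x. cmod (cnj (k x) * indicator E x) \<partial>\<mu>)"
    unfolding fourier_coeff_indicator_def by (rule integral_norm_bound)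
  also have "\<dots> = (\<integral>x. indicator E x \<partial>\<mu>)"
    using character_norm[OF assms(1)] by (intro Bochner_Integration.integral_cong) (auto simp:
        norm_mult split: split_indicator)
  finally show ?thesis
    using assms(2) by (simp add: haar_space)
qed

lemma bessel_characters_step:
  assumes K: "finite K" "K \<subseteq> pontryagin_dual" and J: "finite J"
    and E: "\<And>j. j \<in> J \<Longrightarrow> E j \<in> sets \<mu>" "disjoint_family_on E J"
  shows "(\<Sum>k\<in>K. (cmod (\<Sum>j\<in>J. fourier_coeff_indicator \<mu> k (E j) * a j))\<^sup>2)
      \<le> (\<Sum>j\<in>J. measure \<mu> (E j) * (cmod (a j))\<^sup>2)"
proof -
  interpret finite_measure \<mu>
    by (rule haar_finite_measure)
  define f where "f x = (\<Sum>j\<in>J. indicator (E j) x * a j)" for x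
  have f: "f \<in> borel_measurable \<mu>"
    unfolding f_def using E(1) by (intro borel_measurable_sum borel_measurable_times
        borel_measurable_indicator) auto
  have bound: "cmod (f x) \<le> (\<Sum>j\<in>J. cmod (a j))" for x
    unfolding f_def
    by (rule order_trans[OF norm_sum]) (auto intro!: sum_mono simp: norm_mult split: split_indicator)
  have f2: "(cmod (f x))\<^sup>2 = (\<Sum>j\<in>J. indicator (E j) x * (cmod (a j))\<^sup>2)" for x
  proof (cases "\<exists>j\<in>J. x \<in> E j")
    case True
    then obtain i where i: "i \<in> J" "x \<in> E i"
      by blast
    then have other: "indicator (E j) x = (0 :: real)" "indicator (E j) x = (0 :: complex)" if
        "j \<in> J" "j \<noteq> i" for j
      using E(2) that unfolding disjoint_family_on_def by (auto split: split_indicator)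
    have "f x = a i"
      unfolding f_def using J i by (subst sum.remove[of _ i]) (auto intro!: sum.neutral simp: other)
    moreover have "(\<Sum>j\<in>J. indicator (E j) x * (cmod (a j))\<^sup>2) = (cmod (a i))\<^sup>2"
      using J i by (subst sum.remove[of _ i]) (auto intro!: sum.neutral simp: other)
    ultimately show ?thesis
      by simp
  next
    case False
    then show ?thesis
      by (simp add: f_def)
  qed
  have "(\<Sum>k\<in>K. (cmod (\<Sum>j\<in>J. fourier_coeff_indicator \<mu> k (E j) * a j))\<^sup>2)
      = (\<Sum>k\<in>K. (cmod (\<integral>x. cnj (k x) * f x \<partial>\<mu>))\<^sup>2)"
    unfolding f_def using K E by (intro sum.cong refl) (simp add: integral_character_step subset_iff)
  also have "\<dots> \<le> (\<integral>x. (cmod (f x))\<^sup>2 \<partial>\<mu>)"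
    by (rule bessel_characters[OF K f bound])
  also have "\<dots> = (\<Sum>j\<in>J. measure \<mu> (E j) * (cmod (a j))\<^sup>2)"
    unfolding f2 using E(1) by (subst Bochner_Integration.integral_sum) (auto simp: haar_space
        emeasure_finite less_top[symmetric])
  finally show ?thesis .
qed

end

section \<open>Operators of finite rank\<close>

lemma infsum_cmult_ennreal:
  fixes f :: "'a \<Rightarrow> ennreal"
  shows "(\<Sum>\<^sub>\<infinity>x\<in>A. c * f x) = c * (\<Sum>\<^sub>\<infinity>x\<in>A. f x)"
  by (simp add: nonneg_infsum_complete SUP_mult_left_ennreal sum_distrib_left)

lift_definition rank_one :: "'h::complex_hilbert_space \<Rightarrow> 'h \<Rightarrow> ('h \<Rightarrow>\<^sub>L 'h)"
  is "\<lambda>v u x. cinner u x *\<^sub>C v"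
proof (rule bounded_linear_intro)
  fix v u x :: 'h
  show "norm (cinner u x *\<^sub>C v) \<le> norm x * (norm u * norm v)"
    using mult_right_mono[OF cmod_cinner_le[of u x], of "norm v"] by (simp add: norm_scaleC mult_ac)
qed (simp_all add: cinner_add_right scaleC_add_left cinner_scaleC_right scaleR_eq_scaleC scaleC_scaleC)

text \<open>For orthonormal \<open>I\<close> and \<open>v\<close>, the operator that maps each \<open>i\<close> in \<open>I\<close> to \<open>c i\<close> times \<open>v i\<close>: a
  singular value decomposition with complex coefficients.\<close>

definition diag_op :: "'h::complex_hilbert_space set \<Rightarrow> ('h \<Rightarrow> 'h) \<Rightarrow> ('h \<Rightarrow> complex) \<Rightarrow> ('h \<Rightarrow>\<^sub>L 'h)" where
  "diag_op I v c = (\<Sum>i\<in>I. scaleC_op (c i) (rank_one (v i) i))"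

lemma clinear_op_sum: "(\<And>i. i \<in> I \<Longrightarrow> clinear_op (T i)) \<Longrightarrow> clinear_op (\<Sum>i\<in>I. T i)"
  by (induction I rule: infinite_finite_induct) (auto intro: clinear_op_add clinear_op_0)

lemma clinear_rank_one: "clinear_op (rank_one v u)"
  by (simp add: clinear_op_def rank_one.rep_eq cinner_scaleC_right scaleC_scaleC)

lemma clinear_diag_op: "clinear_op (diag_op I v c)"
  unfolding diag_op_def by (intro clinear_op_sum clinear_op_scaleC_op clinear_rank_one)

lemma diag_op_apply: "diag_op I v c x = (\<Sum>i\<in>I. (c i * cinner i x) *\<^sub>C v i)"
  by (simp add: diag_op_def blinfun.sum_left scaleC_op_apply rank_one.rep_eq scaleC_scaleC)

lemma norm_diag_op:
  assumes "finite I" "orthonormal_family I v"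
  shows "(norm (diag_op I v c x))\<^sup>2 = (\<Sum>i\<in>I. (cmod (c i))\<^sup>2 * (cmod (cinner i x))\<^sup>2)"
  by (simp add: diag_op_apply norm_orthonormal_family_combination[OF assms] norm_mult power_mult_distrib)

lemma norm_diag_op_le:
  assumes I: "finite I" "orthonormal I" "orthonormal_family I v"
    and c: "\<And>i. i \<in> I \<Longrightarrow> cmod (c i) \<le> b" and b: "0 \<le> b"
  shows "norm (diag_op I v c x) \<le> b * norm x"
proof (rule power2_le_imp_le)
  have "(norm (diag_op I v c x))\<^sup>2 \<le> (\<Sum>i\<in>I. b\<^sup>2 * (cmod (cinner i x))\<^sup>2)"
    unfolding norm_diag_op[OF I(1,3)] using c by (intro sum_mono mult_right_mono power_mono) auto
  also have "\<dots> = b\<^sup>2 * (\<Sum>i\<in>I. (cmod (cinner i x))\<^sup>2)"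
    by (simp add: sum_distrib_left)
  also have "\<dots> \<le> b\<^sup>2 * (norm x)\<^sup>2"
    by (intro mult_left_mono bessel_inequality I) simp
  finally show "(norm (diag_op I v c x))\<^sup>2 \<le> (b * norm x)\<^sup>2"
    by (simp add: power_mult_distrib)
qed (use b in simp)

lemma hilbert_schmidt_diag_op:
  assumes I: "finite I" "orthonormal I" "orthonormal_family I v" and B: "is_onb B"
  shows "(\<Sum>\<^sub>\<infinity>b\<in>B. ennreal ((norm (diag_op I v c b))\<^sup>2)) = ennreal (\<Sum>i\<in>I. (cmod (c i))\<^sup>2)"
proof -
  have "(\<Sum>\<^sub>\<infinity>b\<in>B. ennreal ((norm (diag_op I v c b))\<^sup>2))
      = (\<Sum>\<^sub>\<infinity>b\<in>B. \<Sum>i\<in>I. ennreal ((cmod (c i))\<^sup>2) * ennreal ((cmod (cinner i b))\<^sup>2))"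
    unfolding norm_diag_op[OF I(1,3)] by (simp add: sum_ennreal[symmetric] ennreal_mult)
  also have "\<dots> = (\<Sum>i\<in>I. ennreal ((cmod (c i))\<^sup>2) * (\<Sum>\<^sub>\<infinity>b\<in>B. ennreal ((cmod (cinner i b))\<^sup>2)))"
    by (simp add: sum_infsum_swap_ennreal[OF I(1), symmetric] infsum_cmult_ennreal)
  also have "\<dots> = (\<Sum>i\<in>I. ennreal ((cmod (c i))\<^sup>2))"
  proof (rule sum.cong[OF refl])
    fix i assume "i \<in> I"
    have "cmod (cinner i b) = cmod (cinner b i)" for b
      using cinner_commute[of i b] by simp
    then show "ennreal ((cmod (c i))\<^sup>2) * (\<Sum>\<^sub>\<infinity>b\<in>B. ennreal ((cmod (cinner i b))\<^sup>2))
        = ennreal ((cmod (c i))\<^sup>2)"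
      using parseval[OF B, of i] orthonormal_norm[OF I(2) \<open>i \<in> I\<close>] by simp
  qed
  finally show ?thesis
    by (simp add: sum_ennreal)
qed

text \<open>Passing to the adjoint twice returns to \<open>X\<close>, with the system \<open>F\<close> replaced by a basis.\<close>

lemma hilbert_schmidt_orthonormal_le:
  assumes X: "clinear_op X" and B: "is_onb B" and F: "finite F" "orthonormal F"
  shows "(\<Sum>e\<in>F. ennreal ((norm (X e))\<^sup>2)) \<le> (\<Sum>\<^sub>\<infinity>b\<in>B. ennreal ((norm (X b))\<^sup>2))"
proof -
  have adj: "cinner (X x) y = cinner x (adjoint_op X y)" "cinner (adjoint_op X x) y
      = cinner x (X y)" for x y
    using cinner_adjoint[OF X] cinner_commute by (metis, metis)
  have "(\<Sum>e\<in>F. ennreal ((norm (X e))\<^sup>2)) \<le> (\<Sum>\<^sub>\<infinity>b\<in>B. ennreal ((norm (adjoint_op X b))\<^sup>2))"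
    using hilbert_schmidt_sum_le[of "adjoint_op X" X, OF adj(2) B F(2)] F(1) by simp
  also have "\<dots> \<le> (\<Sum>\<^sub>\<infinity>b\<in>B. ennreal ((norm (X b))\<^sup>2))"
    by (rule hilbert_schmidt_sum_le[OF adj(1) B is_onb_orthonormal[OF B]])
  finally show ?thesis .
qed

section \<open>The inequality for step functions with values of finite rank\<close>

text \<open>Bessel's inequality for the characters, applied to each matrix element in an orthonormal basis:
  the endpoint \<open>p = 2\<close>.\<close>

lemma hilbert_schmidt_bessel_characters:
  fixes T :: "'j \<Rightarrow> ('h::complex_hilbert_space \<Rightarrow>\<^sub>L 'h)"
    and \<mu> :: "'g::{topological_ab_group_add, t2_space} measure"
  assumes \<mu>: "normalized_haar_measure \<mu>" and K: "finite K" "K \<subseteq> pontryagin_dual" and J: "finite J"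
    and E: "\<And>j. j \<in> J \<Longrightarrow> E j \<in> sets \<mu>" "disjoint_family_on E J"
    and T: "\<And>j. j \<in> J \<Longrightarrow> clinear_op (T j)"
    and F: "\<And>k. k \<in> K \<Longrightarrow> finite (F k)" "\<And>k. k \<in> K \<Longrightarrow> orthonormal (F k)" and B: "is_onb B"
  shows "(\<Sum>k\<in>K. \<Sum>e\<in>F k. ennreal ((norm (\<Sum>j\<in>J. fourier_coeff_indicator \<mu> k (E j) *\<^sub>C T j e))\<^sup>2))
    \<le> (\<Sum>j\<in>J. ennreal (measure \<mu> (E j)) * (\<Sum>\<^sub>\<infinity>b\<in>B. ennreal ((norm (T j b))\<^sup>2)))"
proof -
  define X where "X k = (\<Sum>j\<in>J. scaleC_op (fourier_coeff_indicator \<mu> k (E j)) (T j))" for k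
  have X_apply: "X k x = (\<Sum>j\<in>J. fourier_coeff_indicator \<mu> k (E j) *\<^sub>C T j x)" for k x
    by (simp add: X_def blinfun.sum_left scaleC_op_apply)
  have X: "clinear_op (X k)" for k
    unfolding X_def by (intro clinear_op_sum clinear_op_scaleC_op T)
  have "(\<Sum>k\<in>K. \<Sum>e\<in>F k. ennreal ((norm (X k e))\<^sup>2)) \<le> (\<Sum>k\<in>K. \<Sum>\<^sub>\<infinity>b\<in>B. ennreal ((norm (X k b))\<^sup>2))"
    by (intro sum_mono hilbert_schmidt_orthonormal_le X B F)
  also have "\<dots> = (\<Sum>k\<in>K. \<Sum>\<^sub>\<infinity>b\<in>B. \<Sum>\<^sub>\<infinity>c\<in>B. ennreal ((cmod (cinner c (X k b)))\<^sup>2))"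
    by (simp add: parseval[OF B])
  also have "\<dots> = (\<Sum>\<^sub>\<infinity>b\<in>B. \<Sum>\<^sub>\<infinity>c\<in>B. \<Sum>k\<in>K. ennreal ((cmod (cinner c (X k b)))\<^sup>2))"
    by (simp add: sum_infsum_swap_ennreal[OF K(1)])
  also have "\<dots> \<le> (\<Sum>\<^sub>\<infinity>b\<in>B. \<Sum>\<^sub>\<infinity>c\<in>B. \<Sum>j\<in>J. ennreal (measure \<mu> (E j)) * ennreal ((cmod (cinner c (T j b)))\<^sup>2))"
  proof (intro infsum_mono summable_ennreal)
    fix b c
    have "(\<Sum>k\<in>K. (cmod (cinner c (X k b)))\<^sup>2) \<le> (\<Sum>j\<in>J. measure \<mu> (E j) * (cmod (cinner c (T j b)))\<^sup>2)"
      using bessel_characters_step[OF \<mu> K J E, of "\<lambda>j. cinner c (T j b)"]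
      by (simp add: X_apply cinner.sum_right cinner_scaleC_right)
    then show "(\<Sum>k\<in>K. ennreal ((cmod (cinner c (X k b)))\<^sup>2))
        \<le> (\<Sum>j\<in>J. ennreal (measure \<mu> (E j)) * ennreal ((cmod (cinner c (T j b)))\<^sup>2))"
      by (simp add: sum_ennreal ennreal_mult[symmetric] ennreal_leI)
  qed
  also have "\<dots> = (\<Sum>j\<in>J. ennreal (measure \<mu> (E j)) * (\<Sum>\<^sub>\<infinity>b\<in>B. \<Sum>\<^sub>\<infinity>c\<in>B. ennreal ((cmod (cinner c (T j
      b)))\<^sup>2)))"
    by (simp add: sum_infsum_swap_ennreal[OF J, symmetric] infsum_cmult_ennreal)
  finally show ?thesis
    by (simp add: parseval[OF B] X_apply)
qed

text \<open>The matrix \<open>m\<close> maps the coefficients \<open>c j i\<close> of the values of a step function to its matrix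
  elements \<open>cinner (f k e) (X k e)\<close>, where \<open>X k\<close> is the Fourier coefficient at \<open>k\<close>. The vectors \<open>e\<close> may
  depend on \<open>k\<close>. For interpolation both endpoints must hold for all complex \<open>c\<close>: at \<open>p = 2\<close> this is
  Bessel's inequality for the characters, and at \<open>p = \<infinity>\<close> the operator norm of a value is at most its
  largest coefficient.\<close>

lemma hausdorff_young_finite_rank:
  fixes \<mu> :: "'g::{topological_ab_group_add, t2_space} measure"
    and v :: "'j \<Rightarrow> 'h::complex_hilbert_space \<Rightarrow> 'h"
  assumes \<mu>: "normalized_haar_measure \<mu>" and K: "finite K" "K \<subseteq> pontryagin_dual" and J: "finite J"
    and E: "\<And>j. j \<in> J \<Longrightarrow> E j \<in> sets \<mu>" "disjoint_family_on E J"
    and F: "\<And>k. k \<in> K \<Longrightarrow> finite (F k)" "\<And>k. k \<in> K \<Longrightarrow> orthonormal (F k)"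
    and f: "\<And>k e. norm (f k e) \<le> 1"
    and I: "\<And>j. j \<in> J \<Longrightarrow> finite (I j)" "\<And>j. j \<in> J \<Longrightarrow> orthonormal (I j)" "\<And>j. j \<in> J
        \<Longrightarrow> orthonormal_family (I j) (v j)"
    and s: "\<And>j i. j \<in> J \<Longrightarrow> i \<in> I j \<Longrightarrow> 0 < s j i"
    and p: "2 \<le> p" and q: "q = p / (p - 1)"
  shows "(\<Sum>k\<in>K. \<Sum>e\<in>F k. cmod (\<Sum>j\<in>J. fourier_coeff_indicator \<mu> k (E j) *
        cinner (f k e) (diag_op (I j) (v j) (\<lambda>i. complex_of_real (s j i)) e)) powr p)
    \<le> (\<Sum>j\<in>J. measure \<mu> (E j) * (\<Sum>i\<in>I j. s j i powr p) powr (q / p)) powr (p / q)"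
proof -
  obtain B :: "'h set" where B: "is_onb B"
    using onb_exists by blast
  define m where "m = (\<lambda>(k, e) j i. fourier_coeff_indicator \<mu> k (E j) * (cinner i e * cinner (f k e)
      (v j i)))"
  define X where "X c k e = (\<Sum>j\<in>J. fourier_coeff_indicator \<mu> k (E j) *\<^sub>C diag_op (I j) (v j) (c j)
      e)" for c k e
  have m_sum: "(\<Sum>j\<in>J. \<Sum>i\<in>I j. m (k, e) j i * c j i) = cinner (f k e) (X c k e)" for k e c
    by (simp add: m_def X_def diag_op_apply cinner.sum_right cinner_scaleC_right sum_distrib_left mult_ac)
  have fX: "cmod (cinner (f k e) x) \<le> norm x" for k e x
    using cmod_cinner_le[of "f k e" x] mult_right_mono[OF f[of k e], of "norm x"] by simp
  have Sigma: "(\<Sum>ke\<in>Sigma K F. g ke) = (\<Sum>k\<in>K. \<Sum>e\<in>F k. g (k, e))" for g :: "_ \<Rightarrow> real"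
    using K(1) F(1) by (subst sum.Sigma) auto
  have "(\<Sum>ke\<in>Sigma K F. cmod (\<Sum>j\<in>J. \<Sum>i\<in>I j. m ke j i * complex_of_real (s j i)) powr p)
    \<le> (\<Sum>j\<in>J. measure \<mu> (E j) * (\<Sum>i\<in>I j. s j i powr p) powr (q / p)) powr (p / q)"
  proof (rule finite_riesz_thorin[OF _ J I(1) _ s _ _ p q])
    show "finite (Sigma K F)"
      using K(1) F(1) by (rule finite_SigmaI)
  next
    fix c :: "'j \<Rightarrow> 'h \<Rightarrow> complex"
    have "ennreal (\<Sum>ke\<in>Sigma K F. (cmod (\<Sum>j\<in>J. \<Sum>i\<in>I j. m ke j i * c j i))\<^sup>2)
        \<le> ennreal (\<Sum>k\<in>K. \<Sum>e\<in>F k. (norm (X c k e))\<^sup>2)"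
      unfolding Sigma m_sum by (intro ennreal_leI sum_mono power_mono fX) auto
    also have "\<dots> = (\<Sum>k\<in>K. \<Sum>e\<in>F k. ennreal ((norm (X c k e))\<^sup>2))"
      by (simp add: sum_ennreal sum_nonneg)
    also have "\<dots> \<le> (\<Sum>j\<in>J. ennreal (measure \<mu> (E j)) * (\<Sum>\<^sub>\<infinity>b\<in>B. ennreal ((norm (diag_op (I j) (v j)
        (c j) b))\<^sup>2)))"
      unfolding X_def by (intro hilbert_schmidt_bessel_characters[OF \<mu> K J E _ F B] clinear_diag_op)
    also have "\<dots> = (\<Sum>j\<in>J. ennreal (measure \<mu> (E j)) * ennreal (\<Sum>i\<in>I j. (cmod (c j i))\<^sup>2))"
      by (simp add: hilbert_schmidt_diag_op[OF I(1-3) B])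
    also have "\<dots> = ennreal (\<Sum>j\<in>J. measure \<mu> (E j) * (\<Sum>i\<in>I j. (cmod (c j i))\<^sup>2))"
      by (simp add: ennreal_mult[symmetric] sum_nonneg sum_ennreal)
    finally show "(\<Sum>ke\<in>Sigma K F. (cmod (\<Sum>j\<in>J. \<Sum>i\<in>I j. m ke j i * c j i))\<^sup>2)
        \<le> (\<Sum>j\<in>J. measure \<mu> (E j) * (\<Sum>i\<in>I j. (cmod (c j i))\<^sup>2))"
      by (subst (asm) ennreal_le_iff) (auto intro!: sum_nonneg mult_nonneg_nonneg)
  next
    fix c :: "'j \<Rightarrow> 'h \<Rightarrow> complex" and b :: "'j \<Rightarrow> real" and ke
    assume "ke \<in> Sigma K F" and c: "\<And>j i. j \<in> J \<Longrightarrow> i \<in> I j \<Longrightarrow> cmod (c j i) \<le> b j" and b: "\<And>j. j \<in> J \<Longrightarrow> 0 \<le> b j"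
    then obtain k e where ke: "ke = (k, e)" "k \<in> K" "e \<in> F k"
      by auto
    have "cmod (\<Sum>j\<in>J. \<Sum>i\<in>I j. m ke j i * c j i) \<le> norm (X c k e)"
      unfolding ke(1) m_sum by (rule fX)
    also have "\<dots> \<le> (\<Sum>j\<in>J. cmod (fourier_coeff_indicator \<mu> k (E j)) * norm (diag_op (I j) (v j) (c j) e))"
      unfolding X_def by (rule order_trans[OF norm_sum]) (simp add: norm_scaleC)
    also have "\<dots> \<le> (\<Sum>j\<in>J. measure \<mu> (E j) * b j)"
    proof (rule sum_mono)
      fix j assume j: "j \<in> J"
      have "norm (diag_op (I j) (v j) (c j) e) \<le> b j"
        using norm_diag_op_le[OF I(1-3)[OF j] c[OF j] b[OF j], where x
            = e] orthonormal_norm[OF F(2)[OF ke(2)] ke(3)] by simp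
      moreover have "cmod (fourier_coeff_indicator \<mu> k (E j)) \<le> measure \<mu> (E j)"
        using K(2) ke(2) E(1)[OF j] by (intro cmod_fourier_coeff_indicator_le[OF \<mu>]) auto
      ultimately show "cmod (fourier_coeff_indicator \<mu> k (E j)) * norm (diag_op (I j) (v j) (c j) e)
          \<le> measure \<mu> (E j) * b j"
        by (intro mult_mono) auto
    qed
    finally show "cmod (\<Sum>j\<in>J. \<Sum>i\<in>I j. m ke j i * c j i) \<le> (\<Sum>j\<in>J. measure \<mu> (E j) * b j)" .
  qed auto
  then show ?thesis
    unfolding Sigma m_sum by (simp add: X_def cinner.sum_right cinner_scaleC_right)
qed

section \<open>The Hausdorff-Young inequality\<close>

text \<open>A truncated singular value decomposition of \<open>T\<close>, in the eigenbasis of \<open>T\<^sup>* T\<close>. The truncations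
  converge strongly, so finitely many vectors \<open>x\<close> are handled at once.\<close>

lemma schmidt_approximation:
  fixes T :: "'h::complex_hilbert_space \<Rightarrow>\<^sub>L 'h"
  assumes p: "2 \<le> p" and T: "T \<in> schatten_class p" and X: "finite X" and \<epsilon>: "0 < \<epsilon>"
  obtains I where "finite I" "orthonormal I" "orthonormal_family I (\<lambda>i. sgn (T i))" "\<And>i. i \<in> I \<Longrightarrow> T i \<noteq> 0"
    "\<And>x. x \<in> X \<Longrightarrow> norm (T x - diag_op I (\<lambda>i. sgn (T i)) (\<lambda>i. complex_of_real (norm (T i))) x) < \<epsilon>"
proof -
  have cl: "clinear_op T" and fin: "orthonormal_power_sup p T < \<infinity>"
    using T by (auto simp: schatten_class_iff[OF p])
  obtain E where E: "is_onb E" and ev: "\<And>e. e \<in> E \<Longrightarrow> adjoint_op T (T e) = ((norm (T e))\<^sup>2) *\<^sub>R e"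
    using eigenbasis_exists[OF cl fin] p by auto
  have oE: "orthonormal E"
    using E by (rule is_onb_orthonormal)
  have TT: "cinner (T e) (T f) = (if e = f then complex_of_real ((norm (T e))\<^sup>2) else 0)" if "e \<in> E"
      "f \<in> E" for e f
  proof -
    have "cinner (T e) (T f) = cinner e (adjoint_op T (T f))"
      by (rule cinner_adjoint[OF cl])
    then show ?thesis
      using oE that by (simp add: ev cinner_scaleR_right orthonormal_def)
  qed
  define E0 where "E0 = {e \<in> E. T e \<noteq> 0}"
  have sum: "((\<lambda>e. T (cinner e x *\<^sub>C e)) has_sum T x) E0" for x
  proof -
    have "((\<lambda>e. T (cinner e x *\<^sub>C e)) has_sum T x) E"
      by (rule has_sum_bounded_linear[OF blinfun.bounded_linear_right onb_expansion[OF E]])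
    then show ?thesis
      by (subst has_sum_cong_neutral[where T = E]) (auto simp: E0_def clinear_op_scaleC[OF cl])
  qed
  have "\<forall>\<^sub>F I in finite_subsets_at_top E0. \<forall>x\<in>X. dist (\<Sum>e\<in>I. T (cinner e x *\<^sub>C e)) (T x) < \<epsilon>"
    using X \<epsilon> sum by (intro eventually_ball_finite) (auto simp: has_sum_def tendsto_iff)
  then obtain I where I: "finite I" "I \<subseteq> E0"
    and near: "\<And>x. x \<in> X \<Longrightarrow> dist (\<Sum>e\<in>I. T (cinner e x *\<^sub>C e)) (T x) < \<epsilon>"
    by (auto simp: eventually_finite_subsets_at_top)
  show thesis
  proof
    show "finite I" "orthonormal I" "\<And>i. i \<in> I \<Longrightarrow> T i \<noteq> 0"
      using I by (auto simp: E0_def intro: orthonormal_subset[OF oE])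
    show "orthonormal_family I (\<lambda>i. sgn (T i))"
      unfolding orthonormal_family_def
    proof (intro ballI)
      fix i j assume "i \<in> I" "j \<in> I"
      then have ij: "i \<in> E" "j \<in> E" "T i \<noteq> 0" "T j \<noteq> 0"
        using I by (auto simp: E0_def)
      have "cinner (sgn (T i)) (sgn (T j)) = complex_of_real (inverse (norm (T i)))
          * (complex_of_real (inverse (norm (T j))) * cinner (T i) (T j))"
        by (simp add: sgn_div_norm cinner_scaleR_left cinner_scaleR_right)
      then show "cinner (sgn (T i)) (sgn (T j)) = (if i = j then 1 else 0)"
        using ij by (cases "i = j") (simp_all add: TT power2_eq_square field_simps)
    qed
    fix x assume "x \<in> X"
    have "diag_op I (\<lambda>i. sgn (T i)) (\<lambda>i. complex_of_real (norm (T i))) x = (\<Sum>e\<in>I. T (cinner e x *\<^sub>C e))"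
      unfolding diag_op_apply
    proof (rule sum.cong[OF refl])
      fix i assume "i \<in> I"
      then have "T i \<noteq> 0"
        using I by (auto simp: E0_def)
      then have "complex_of_real (norm (T i)) *\<^sub>C sgn (T i) = T i"
        by (simp add: scaleR_eq_scaleC[symmetric] sgn_div_norm)
      then show "(complex_of_real (norm (T i)) * cinner i x) *\<^sub>C sgn (T i) = T (cinner i x *\<^sub>C i)"
        by (simp add: clinear_op_scaleC[OF cl] scaleC_scaleC[symmetric] mult.commute[of
            "complex_of_real (norm (T i))"])
    qed
    then show "norm (T x - diag_op I (\<lambda>i. sgn (T i)) (\<lambda>i. complex_of_real (norm (T i))) x) < \<epsilon>"
      using near[OF \<open>x \<in> X\<close>] by (simp add: dist_norm norm_minus_commute)
  qed
qed

lemma nn_integral_simple_powr: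
  assumes p: "2 \<le> p" and M: "finite_measure M" and t: "simple_function M t"
  shows "(\<integral>\<^sup>+x. schatten_norm p (t x) powr q \<partial>M)
    = ennreal (\<Sum>T\<in>t ` space M. measure M {x \<in> space M. t x = T} * schatten_norm p T powr q)"
proof -
  have sn: "Bochner_Integration.simple_bochner_integrable M (\<lambda>x. schatten_norm p (t x) powr q)"
    using M simple_function_compose1[OF t] by (rule simple_bochner_integrable_finite_measure)
  have "(\<integral>\<^sup>+x. schatten_norm p (t x) powr q \<partial>M)
      = ennreal (Bochner_Integration.simple_bochner_integral M (\<lambda>x. schatten_norm p (t x) powr q))"
    by (rule simple_bochner_integral_eq_nn_integral[OF sn, symmetric]) simp
  also have "Bochner_Integration.simple_bochner_integral M (\<lambda>x. schatten_norm p (t x) powr q)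
      = (\<Sum>T\<in>t ` space M. measure M {x \<in> space M. t x = T} *\<^sub>R schatten_norm p T powr q)"
    by (rule simple_bochner_integral_partition[OF sn t]) auto
  finally show ?thesis
    by simp
qed

text \<open>The finitely many values are replaced by truncated singular value decompositions. These do not
  increase the Schatten norm, and only finitely many vectors enter the left-hand side.\<close>

lemma hausdorff_young_simple:
  fixes \<mu> :: "'g::{topological_ab_group_add, t2_space} measure"
    and t :: "'g \<Rightarrow> ('h::complex_hilbert_space \<Rightarrow>\<^sub>L 'h)"
  assumes \<mu>: "normalized_haar_measure \<mu>" and K: "finite K" "K \<subseteq> pontryagin_dual"
    and F: "\<And>k. k \<in> K \<Longrightarrow> finite (F k)" "\<And>k. k \<in> K \<Longrightarrow> orthonormal (F k)"
    and f: "\<And>k e. norm (f k e) \<le> 1"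
    and p: "2 \<le> p" and q: "q = p / (p - 1)"
    and t: "simple_function \<mu> t" "\<And>x. t x \<in> schatten_class p"
  shows "(\<Sum>k\<in>K. \<Sum>e\<in>F k. cmod (\<integral>x. cnj (k x) * cinner (f k e) (t x e) \<partial>\<mu>) powr p)
    \<le> enn2real (\<integral>\<^sup>+x. schatten_norm p (t x) powr q \<partial>\<mu>) powr (p / q)"
proof -
  have M: "finite_measure \<mu>"
    by (rule haar_finite_measure[OF \<mu>])
  have q0: "0 < q"
    using p by (simp add: q)
  define J where "J = range t"
  define E where "E T = {x. t x = T}" for T
  have J: "finite J"
    using t(1) by (simp add: simple_function_def J_def haar_space[OF \<mu>])
  have E: "E T \<in> sets \<mu>" for T
    using simple_functionD(2)[OF t(1), of "{T}"] by (simp add: E_def vimage_def haar_space[OF \<mu>])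
  have disj: "disjoint_family_on E J"
    by (auto simp: disjoint_family_on_def E_def)
  define a where "a k e = (\<Sum>T\<in>J. fourier_coeff_indicator \<mu> k (E T) * cinner (f k e) (T e))" for k e
  have entry: "(\<integral>x. cnj (k x) * cinner (f k e) (t x e) \<partial>\<mu>) = a k e" if "k \<in> K" for k e
  proof -
    have "cinner (f k e) (t x e) = (\<Sum>T\<in>J. indicator (E T) x * cinner (f k e) (T e))" for x
    proof -
      have "(\<Sum>T\<in>J. indicator (E T) x * cinner (f k e) (T e)) = (\<Sum>T\<in>J. if T
          = t x then cinner (f k e) (T e) else 0)"
        by (intro sum.cong refl) (auto simp: E_def)
      then show ?thesis
        using J by (simp add: J_def)
    qed
    then show ?thesis
      unfolding a_def using K that E by (simp add: integral_character_step[OF \<mu>] subset_iff)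
  qed
  define X where "X = (\<Union>k\<in>K. F k)"
  have X: "finite X"
    using K(1) F(1) by (simp add: X_def)
  define V where "V = (\<lambda>(T :: 'h \<Rightarrow>\<^sub>L 'h) i. sgn (T i))"
  define S where "S = (\<lambda>(T :: 'h \<Rightarrow>\<^sub>L 'h) i. norm (T i))"
  define P where "P n T I \<longleftrightarrow> finite I \<and> orthonormal I \<and> orthonormal_family I (V T) \<and> (\<forall>i\<in>I. 0 < S T i) \<and>
      (\<forall>x\<in>X. norm (T x - diag_op I (V T) (\<lambda>i. complex_of_real (S T i)) x) < inverse (real (Suc n)))"
          for n T I
  have ex: "\<exists>I. P n T I" if "T \<in> J" for n T
  proof -
    have "T \<in> schatten_class p"
      using t(2) that by (auto simp: J_def)
    then obtain I where "finite I" "orthonormal I" "orthonormal_family I (\<lambda>i. sgn (T i))" "\<And>i. i \<in> I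
        \<Longrightarrow> T i \<noteq> 0"
      "\<And>x. x \<in> X \<Longrightarrow> norm (T x - diag_op I (\<lambda>i. sgn (T i)) (\<lambda>i. complex_of_real (norm (T i))) x)
          < inverse (real (Suc n))"
      using schmidt_approximation[OF p _ X, of T "inverse (real (Suc n))"] by auto
    then show ?thesis
      unfolding P_def V_def S_def by (intro exI[of _ I]) simp
  qed
  define I where "I n T = (SOME I. P n T I)" for n T
  have "P n T (I n T)" if "T \<in> J" for n T
    unfolding I_def using ex[OF that] by (rule someI_ex)
  then have I: "\<And>n T. T \<in> J \<Longrightarrow> finite (I n T)" "\<And>n T. T \<in> J \<Longrightarrow> orthonormal (I n T)"
      "\<And>n T. T \<in> J \<Longrightarrow> orthonormal_family (I n T) (V T)" "\<And>n T i. T \<in> J \<Longrightarrow> i \<in> I n T \<Longrightarrow> 0 < S T i"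
    and near: "\<And>n T x. T \<in> J \<Longrightarrow> x \<in> X \<Longrightarrow>
        norm (T x - diag_op (I n T) (V T) (\<lambda>i. complex_of_real (S T i)) x) < inverse (real (Suc n))"
    unfolding P_def by blast+
  define D where "D n T = diag_op (I n T) (V T) (\<lambda>i. complex_of_real (S T i))" for n T
  define R where "R = (\<Sum>T\<in>J. measure \<mu> (E T) * schatten_norm p T powr q)"
  have bound: "(\<Sum>k\<in>K. \<Sum>e\<in>F k. cmod (\<Sum>T\<in>J. fourier_coeff_indicator \<mu> k (E T) * cinner (f k e) (D n T
      e)) powr p) \<le> R powr (p / q)" for n
  proof -
    have "(\<Sum>k\<in>K. \<Sum>e\<in>F k. cmod (\<Sum>T\<in>J. fourier_coeff_indicator \<mu> k (E T) * cinner (f k e) (D n T e)) powr p)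
        \<le> (\<Sum>T\<in>J. measure \<mu> (E T) * (\<Sum>i\<in>I n T. S T i powr p) powr (q / p)) powr (p / q)"
      unfolding D_def by (rule hausdorff_young_finite_rank[OF \<mu> K J E disj F f I p q])
    also have "\<dots> \<le> R powr (p / q)"
    proof (rule powr_mono2)
      show "(\<Sum>T\<in>J. measure \<mu> (E T) * (\<Sum>i\<in>I n T. S T i powr p) powr (q / p)) \<le> R"
        unfolding R_def
      proof (intro sum_mono mult_left_mono)
        fix T assume T: "T \<in> J"
        then have "T \<in> schatten_class p"
          using t(2) by (auto simp: J_def)
        then have "(\<Sum>i\<in>I n T. S T i powr p) \<le> schatten_norm p T powr p"
          unfolding S_def using T by (intro orthonormal_sum_le_schatten_norm[OF p] I)
        then have "(\<Sum>i\<in>I n T. S T i powr p) powr (q / p) \<le> (schatten_norm p T powr p) powr (q / p)"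
          using p q0 by (intro powr_mono2 sum_nonneg) auto
        then show "(\<Sum>i\<in>I n T. S T i powr p) powr (q / p) \<le> schatten_norm p T powr q"
          using p by (simp add: powr_powr)
      qed simp
    qed (use p q0 in \<open>auto intro!: sum_nonneg\<close>)
    finally show ?thesis .
  qed
  have lim: "(\<lambda>n. \<Sum>T\<in>J. fourier_coeff_indicator \<mu> k (E T) * cinner (f k e) (D n T e)) \<longlonglongrightarrow> a k e"
    if "k \<in> K" "e \<in> F k" for k e
    unfolding a_def
  proof (intro tendsto_sum tendsto_mult tendsto_const cinner.tendsto)
    fix T assume T: "T \<in> J"
    have "e \<in> X"
      using that by (auto simp: X_def)
    show "(\<lambda>n. D n T e) \<longlonglongrightarrow> T e"
    proof (rule LIM_zero_cancel, rule tendsto_norm_zero_cancel,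
        rule tendsto_sandwich[OF _ _ tendsto_const LIMSEQ_inverse_real_of_nat])
      show "\<forall>\<^sub>F n in sequentially. norm (D n T e - T e) \<le> inverse (real (Suc n))"
        using less_imp_le[OF near[OF T \<open>e \<in> X\<close>]] by (simp add: D_def norm_minus_commute)
    qed simp
  qed
  have "(\<Sum>k\<in>K. \<Sum>e\<in>F k. cmod (a k e) powr p) \<le> R powr (p / q)"
  proof (rule LIMSEQ_le_const2)
    show "(\<lambda>n. \<Sum>k\<in>K. \<Sum>e\<in>F k. cmod (\<Sum>T\<in>J. fourier_coeff_indicator \<mu> k (E T) * cinner (f k e) (D n T
        e)) powr p)
        \<longlonglongrightarrow> (\<Sum>k\<in>K. \<Sum>e\<in>F k. cmod (a k e) powr p)"
      using p by (intro tendsto_sum tendsto_powr' tendsto_norm lim tendsto_const) auto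
  qed (use bound in blast)
  also have "R = enn2real (\<integral>\<^sup>+x. schatten_norm p (t x) powr q \<partial>\<mu>)"
    unfolding nn_integral_simple_powr[OF p M t(1)]
    by (simp add: R_def J_def E_def haar_space[OF \<mu>] sum_nonneg)
  finally show ?thesis
    using entry by simp
qed

theorem theorem3p6:
  fixes \<mu> :: "'g::{topological_ab_group_add, t2_space} measure"
    and A :: "'g \<Rightarrow> ('h::complex_hilbert_space \<Rightarrow>\<^sub>L 'h)"
    and p q :: real
  assumes "compact (UNIV :: 'g set)"
    and "normalized_haar_measure \<mu>"
    and "2 \<le> p"
    and "q = p / (p - 1)"
    and "A \<in> schatten_Lq q \<mu> p"
  shows "(\<Sum>\<^sub>\<infinity>k\<in>pontryagin_dual.
            ennreal (schatten_norm p
              (schatten_integral p \<mu> (\<lambda>\<theta>. scaleC_op (cnj (k \<theta>)) (A \<theta>))) powr p))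
         \<le> ennreal (enn2real (\<integral>\<^sup>+\<theta>. ennreal (schatten_norm p (A \<theta>) powr q) \<partial>\<mu>) powr (p / q))"
proof (rule infsum_ennreal_leI)
  note \<mu> = assms(2) and p = assms(3) and q = assms(4)
  have q1: "1 \<le> q"
    using p by (simp add: q)
  have M: "finite_measure \<mu>"
    by (rule haar_finite_measure[OF \<mu>])
  have A: "schatten_strongly_measurable p \<mu> A"
    and fin: "(\<integral>\<^sup>+\<theta>. schatten_norm p (A \<theta>) powr q \<partial>\<mu>) < \<infinity>"
    using assms(5) by (simp_all add: schatten_Lq_def)
  define R where "R = (\<integral>\<^sup>+\<theta>. schatten_norm p (A \<theta>) powr q \<partial>\<mu>)"
  define C where "C = enn2real R powr (p / q)"
  define I where "I k = schatten_integral p \<mu> (\<lambda>\<theta>. scaleC_op (cnj (k \<theta>)) (A \<theta>))" for k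
  have fin1: "(\<integral>\<^sup>+\<theta>. schatten_norm p (A \<theta>) \<partial>\<mu>) < \<infinity>"
  proof -
    obtain \<phi> where \<phi>: "\<phi> \<in> borel_measurable \<mu>" "\<And>x. 0 \<le> \<phi> x" "AE x in \<mu>. \<phi> x = schatten_norm p (A x)"
      by (rule schatten_norm_AE_measurable[OF p A], rule that)
    have "(\<integral>\<^sup>+\<theta>. ennreal (\<phi> \<theta> powr q) \<partial>\<mu>) = R"
      unfolding R_def using \<phi>(3) by (intro nn_integral_cong_AE) auto
    then have "(\<integral>\<^sup>+\<theta>. ennreal (\<phi> \<theta>) \<partial>\<mu>) < \<infinity>"
      using fin by (intro nn_integral_finite_of_powr[OF M \<phi>(1,2) q1]) (simp add: R_def)
    also have "(\<integral>\<^sup>+\<theta>. ennreal (\<phi> \<theta>) \<partial>\<mu>) = (\<integral>\<^sup>+\<theta>. schatten_norm p (A \<theta>) \<partial>\<mu>)"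
      using \<phi>(3) by (intro nn_integral_cong_AE) auto
    finally show ?thesis .
  qed
  have I: "schatten_has_integral p \<mu> (\<lambda>\<theta>. scaleC_op (cnj (k \<theta>)) (A \<theta>)) (I k)" if k:
      "k \<in> pontryagin_dual" for k
    unfolding I_def
  proof (rule schatten_has_integral_integral[OF p M])
    show "schatten_strongly_measurable p \<mu> (\<lambda>\<theta>. scaleC_op (cnj (k \<theta>)) (A \<theta>))"
      by (intro schatten_strongly_measurable_scaleC[OF p A] character_measurable_cnj[OF \<mu> k])
    have "(\<integral>\<^sup>+\<theta>. schatten_norm p (scaleC_op (cnj (k \<theta>)) (A \<theta>)) \<partial>\<mu>) \<le> (\<integral>\<^sup>+\<theta>. schatten_norm p (A \<theta>) \<partial>\<mu>)"
    proof (intro nn_integral_mono ennreal_leI)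
      fix \<theta> assume "\<theta> \<in> space \<mu>"
      then show "schatten_norm p (scaleC_op (cnj (k \<theta>)) (A \<theta>)) \<le> schatten_norm p (A \<theta>)"
        using schatten_norm_scaleC_le[OF p schatten_strongly_measurable_class[OF p A], of \<theta> "cnj (k \<theta>)"]
          character_norm[OF k, of \<theta>] by simp
    qed
    then show "(\<integral>\<^sup>+\<theta>. schatten_norm p (scaleC_op (cnj (k \<theta>)) (A \<theta>)) \<partial>\<mu>) < \<infinity>"
      using fin1 by (rule le_less_trans)
  qed
  obtain t where t: "\<And>n. simple_function \<mu> (t n)" "\<And>n x. x \<in> space \<mu> \<Longrightarrow> t n x \<in> schatten_class p"
    "(\<lambda>n. \<integral>\<^sup>+x. schatten_norm p (A x - t n x) \<partial>\<mu>) \<longlonglongrightarrow> 0"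
    "(\<lambda>n. \<integral>\<^sup>+x. schatten_norm p (t n x) powr q \<partial>\<mu>) \<longlonglongrightarrow> (\<integral>\<^sup>+x. schatten_norm p (A x) powr q \<partial>\<mu>)"
    by (rule schatten_simple_approximation[OF p M A q1 fin], rule that)
  fix K :: "('g \<Rightarrow> complex) set" assume K: "finite K" "K \<subseteq> pontryagin_dual"
  have entries: "(\<Sum>k\<in>K. \<Sum>e\<in>F k. norm (I k e) powr p) \<le> C"
    if F: "\<And>k. k \<in> K \<Longrightarrow> finite (F k)" "\<And>k. k \<in> K \<Longrightarrow> orthonormal (F k)" for F
  proof (rule LIMSEQ_le)
    \<comment> \<open>With these vectors the matrix elements of \<open>I k\<close> are norms.\<close>
    define f where "f k e = sgn (I k e)" for k e
    have f_norm: "norm (f k e) \<le> 1" for k e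
      by (simp add: f_def norm_sgn)
    have f_I: "cmod (cinner (f k e) (I k e)) = norm (I k e)" for k e
      by (simp add: f_def cinner_sgn_left)
    have lim: "(\<lambda>n. \<integral>x. cnj (k x) * cinner (f k e) (t n x e) \<partial>\<mu>) \<longlonglongrightarrow> cinner (f k e) (I k e)" if
        "k \<in> K" for k e
    proof (rule cinner_schatten_integral_limit[OF p M A _ _ I t(1,2,3)])
      show "k \<in> pontryagin_dual"
        using K that by blast
      then show "(\<lambda>x. cnj (k x)) \<in> borel_measurable \<mu>" "\<And>x. cmod (cnj (k x)) \<le> 1"
        by (simp_all add: character_measurable_cnj[OF \<mu>] character_norm)
    qed
    have "(\<lambda>n. cmod (\<integral>x. cnj (k x) * cinner (f k e) (t n x e) \<partial>\<mu>)) \<longlonglongrightarrow> norm (I k e)" if "k \<in> K" for k e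
      using tendsto_norm[OF lim[OF that]] by (simp only: f_I)
    then show "(\<lambda>n. \<Sum>k\<in>K. \<Sum>e\<in>F k. cmod (\<integral>x. cnj (k x) * cinner (f k e) (t n x e) \<partial>\<mu>) powr p)
        \<longlonglongrightarrow> (\<Sum>k\<in>K. \<Sum>e\<in>F k. norm (I k e) powr p)"
      using p by (intro tendsto_sum tendsto_powr' tendsto_const) auto
    show "(\<lambda>n. enn2real (\<integral>\<^sup>+x. schatten_norm p (t n x) powr q \<partial>\<mu>) powr (p / q)) \<longlonglongrightarrow> C"
      unfolding C_def using p q1 t(4) fin
      by (intro tendsto_powr' tendsto_enn2real tendsto_const) (auto simp: R_def)
    show "\<exists>N. \<forall>n\<ge>N. (\<Sum>k\<in>K. \<Sum>e\<in>F k. cmod (\<integral>x. cnj (k x) * cinner (f k e) (t n x e) \<partial>\<mu>) powr p)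
        \<le> enn2real (\<integral>\<^sup>+x. schatten_norm p (t n x) powr q \<partial>\<mu>) powr (p / q)"
      using hausdorff_young_simple[OF \<mu> K F f_norm p q t(1)] t(2) by (auto simp: haar_space[OF \<mu>])
  qed
  \<comment> \<open>For each \<open>k\<close> a finite orthonormal system nearly attains the Schatten norm.\<close>
  have "0 \<le> C - (\<Sum>k\<in>K. schatten_norm p (I k) powr p)"
  proof (rule nonneg_if_nonneg_add_epsilon)
    fix \<epsilon> :: real assume "\<epsilon> > 0"
    have "\<exists>F. finite F \<and> orthonormal F \<and> schatten_norm p (I k) powr p \<le> (\<Sum>e\<in>F. norm (I k e) powr p) + \<epsilon>"
      if "k \<in> K" for k
    proof (rule ccontr)
      assume no: "\<not> ?thesis"
      have Ik: "I k \<in> schatten_class p"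
        using I[of k] K that by (auto simp: schatten_has_integral_def)
      have big: "(\<Sum>e\<in>F. norm (I k e) powr p) \<le> schatten_norm p (I k) powr p - \<epsilon>" if "finite F"
          "orthonormal F" for F
        using no that by force
      have "0 \<le> schatten_norm p (I k) powr p - \<epsilon>"
        using big[of "{}"] by (simp add: orthonormal_def)
      moreover have "orthonormal_power_sup p (I k) \<le> ennreal (schatten_norm p (I k) powr p - \<epsilon>)"
        unfolding orthonormal_power_sup_def using big by (auto intro!: SUP_least ennreal_leI)
      ultimately show False
        using \<open>\<epsilon> > 0\<close> by (simp add: schatten_norm_powr[OF p Ik])
    qed
    then obtain F where F: "\<And>k. k \<in> K \<Longrightarrow> finite (F k)" "\<And>k. k \<in> K \<Longrightarrow> orthonormal (F k)"
      and le: "\<And>k. k \<in> K \<Longrightarrow> schatten_norm p (I k) powr p \<le> (\<Sum>e\<in>F k. norm (I k e) powr p) + \<epsilon>"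
      by metis
    have "(\<Sum>k\<in>K. schatten_norm p (I k) powr p) \<le> (\<Sum>k\<in>K. (\<Sum>e\<in>F k. norm (I k e) powr p) + \<epsilon>)"
      by (intro sum_mono le)
    also have "\<dots> \<le> C + \<epsilon> * real (card K)"
      using entries[OF F] by (simp add: sum.distrib mult.commute)
    finally show "0 \<le> C - (\<Sum>k\<in>K. schatten_norm p (I k) powr p) + \<epsilon> * real (card K)"
      by simp
  qed
  then show "(\<Sum>k\<in>K. ennreal (schatten_norm p (schatten_integral p \<mu> (\<lambda>\<theta>. scaleC_op (cnj (k \<theta>)) (A
      \<theta>))) powr p))
      \<le> ennreal (enn2real (\<integral>\<^sup>+\<theta>. ennreal (schatten_norm p (A \<theta>) powr q) \<partial>\<mu>) powr (p / q))"
    by (simp add: I_def C_def R_def sum_ennreal ennreal_leI)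
qed

end
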